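(* Let $A$ be a maximal generic Lipschitz operator Banach ideal and $\alpha$ a finitely generated generic Lipschitz cross-norm which are associated with each other. Then, for every pointed metric space $X$ and every Banach space $E$, the relations $$A(X,E^* ) = (X\widehat{\boxtimes}_\alpha E)^*,$$ $$A(X,E) = (X\widehat{\boxtimes}_\alpha E^* )^* \cap \mathrm{Lip}_0(X,E)$$ hold isometrically.
   Context: $\mathbb{K}$ is $\mathbb R$ or $\mathbb C$. Pointed metric spaces have base point $0$ and metric $d$; normed spaces are pointed by $0$. $\mathrm{Lip}_0(X,Y)$ is the set of base-point preserving Lipschitz maps, $\mathrm{Lip}(f)$ the least Lipschitz constant, $X^\#=\mathrm{Lip}_0(X,\mathbb K)$. $\mathcal L(E,F)$: bounded linear operators. $B_F$: closed unit ball. Tensor products. $X\boxtimes E$ is the linear span of the functionals $\delta_{(x,y)}\boxtimes e$ on $\mathrm{Lip}_0(X,E^* )$, $(\delta_{(x,y)}\boxtimes e)(f)=\langle f(x)-f(y),e\rangle$. A norm $\alpha$ on it is a Lipschitz cross-norm if $\alpha(\delta_{(x,y)}\boxtimes e)=d(x,y)\|e\|$ always; $X\boxtimes_\alpha E$ is the normed space and $X\widehat\boxtimes_\alpha E$ its completion. For $h\in\mathrm{Lip}_0(X,Y)$, $T\in\mathcal L(E,F)$, $h\boxtimes T\colon X\boxtimes E\to Y\boxtimes F$ is linear with $\delta_{(x,y)}\boxtimes e\mapsto\delta_{(h(x),h(y))}\boxtimes T(e)$. The projective and injective norms are $\pi(u)=\inf\{\sum_i d(x_i,y_i)\|e_i\|\}$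 over representations $u=\sum_i\delta_{(x_i,y_i)}\boxtimes e_i$, and $\varepsilon(u)=\sup\{|\sum_i(g(x_i)-g(y_i))\langle\phi,e_i\rangle|\colon g\in B_{X^\#},\phi\in B_{E^*}\}$. Generic cross-norms. A generic Lipschitz cross-norm $\alpha$ assigns to each pointed metric space $X$ and Banach space $E$ a Lipschitz cross-norm $\alpha(\cdot;X,E)$ on $X\boxtimes E$ with $\varepsilon\le\alpha\le\pi$ and $\|h\boxtimes T\colon X_0\boxtimes_\alpha E_0\to X_1\boxtimes_\alpha E_1\|\le\mathrm{Lip}(h)\|T\|$ for all $h\in\mathrm{Lip}_0(X_0,X_1)$, $T\in\mathcal L(E_0,E_1)$. It is finitely generated if $\alpha(u;X,E)=\inf\{\alpha(u;X_0,E_0)\}$ over all finite $X_0\subset X$ containing $0$ and finite-dimensional subspaces $E_0\subset E$ with $u\in X_0\boxtimes E_0$. Generic ideals. A generic Lipschitz operator Banach ideal $A$ assigns to each pointed metric space $X$ and Banach space $E$ a linear subspace $A(X,E)\subset\mathrm{Lip}_0(X,E)$ with a complete norm $\|\cdot\|_A\ge\mathrm{Lip}$ such that: each $g\cdot e\colon x\mapsto g(x)e$ ($g\in X^\#$, $e\in E$) is in $A(X,E)$ with $\|g\cdot e\|_A\le\mathrm{Lip}(g)\|e\|$; and if $f\in A(X,E)$, $h\in\mathrm{Lip}_0(Z,X)$, $S\in\mathcal L(E,F)$ then $Sfh\in A(Z,F)$ with $\|Sfh\|_A\le\|S\|\|f\|_A\mathrm{Lip}(h)$. For $f\in\mathrm{Lip}_0(X,E)$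 put $\|f\|_{A^{\max}}=\sup\|Q^E_L\circ f\circ I^X_Y\|_A$ over finite $Y\subset X$ containing $0$ and closed finite-codimensional subspaces $L\subset E$, where $I^X_Y\colon Y\to X$ is the inclusion and $Q^E_L\colon E\to E/L$ the quotient map; $A^{\max}(X,E)=\{f\colon\|f\|_{A^{\max}}<\infty\}$. $A$ is maximal if $(A,\|\cdot\|_A)=(A^{\max},\|\cdot\|_{A^{\max}})$. $A$ and $\alpha$ are associated ($A\sim\alpha$) if for every finite pointed metric space $X$ and finite-dimensional Banach space $E$, $A(X,E^* )=(X\boxtimes_\alpha E)^*$ isometrically. Identifications: $f\in\mathrm{Lip}_0(X,E^* )$ is identified with the functional $\sum_i\delta_{(x_i,y_i)}\boxtimes e_i\mapsto\sum_i\langle f(x_i)-f(y_i),e_i\rangle$ on $X\boxtimes E$. Similarly $f\in\mathrm{Lip}_0(X,E)$ is identified with the functional $\sum_i\delta_{(x_i,y_i)}\boxtimes e_i^*\mapsto\sum_i\langle e_i^*,f(x_i)-f(y_i)\rangle$ on $X\boxtimes E^*$; thus the second relation means that $f\in\mathrm{Lip}_0(X,E)$ is in $A(X,E)$ iff this functional is bounded for $\alpha(\cdot;X,E^* )$, with $\|f\|_A$ equal to its norm. *)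

theory Defs
  imports "HOL-Analysis.Analysis" "HOL-Library.Extended_Nonnegative_Real"
begin

text \<open>
  Conventions. A pointed metric space is a metric (\<open>'m metric\<close>, with an arbitrary carrier set in
  \<open>'m\<close>) together with a base point. A normed space is a record whose carrier is an arbitrary set
  in some type, over the scalar field \<open>'k\<close>, which is the real or the complex field. Functions between
  such objects are extensional: equal to \<^term>\<open>undefined\<close> off their domain.

  HOL cannot quantify over all types inside a formula. A generic ideal \<open>A\<close> or a generic norm \<open>\<alpha>\<close> is
  therefore a function on all pointed metric spaces carried by subsets of \<open>'m\<close> and all Banach
  spaces carried by subsets of \<open>'u\<close>, where \<open>'m\<close> and \<open>'u\<close> are arbitrary types. The dual \<open>E\<^sup>*\<close>
  (functions \<open>'u \<Rightarrow> 'k\<close>) and a quotient \<open>E/L\<close> (cosets, \<open>'u set\<close>) are formed literally, but \<open>A\<close> and \<open>\<alpha>\<close>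
  are evaluated at an isometrically isomorphic space with carrier in \<open>'u\<close>; the identifying map \<open>J\<close> is
  always explicit, and the choice does not matter because \<open>A\<close> and \<open>\<alpha>\<close> respect isometric isomorphisms
  by their defining properties. If \<open>'u\<close> carries a given space at all, it also carries a copy
  of each of its finite-dimensional quotients, and of its dual if it is finite-dimensional.
\<close>

class real_or_complex = real_normed_field +
  assumes real_or_complex:
    "\<exists>\<phi> :: 'a \<Rightarrow> complex.
       (\<forall>x y. \<phi> (x + y) = \<phi> x + \<phi> y) \<and> (\<forall>x y. \<phi> (x * y) = \<phi> x * \<phi> y) \<and>
       (\<forall>x. norm (\<phi> x) = norm x) \<and> (range \<phi> = \<real> \<or> range \<phi> = UNIV)"

instance real :: real_or_complex
  by standard (rule exI[of _ complex_of_real], auto simp: Reals_def)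

instance complex :: real_or_complex
  by standard (rule exI[of _ id], auto)

record ('k, 'a) nspace =
  carr :: "'a set"
  vadd :: "'a \<Rightarrow> 'a \<Rightarrow> 'a"
  vzero :: 'a
  vscale :: "'k \<Rightarrow> 'a \<Rightarrow> 'a"
  vnorm :: "'a \<Rightarrow> real"

definition vsub :: "('k::real_or_complex, 'a) nspace \<Rightarrow> 'a \<Rightarrow> 'a \<Rightarrow> 'a" where
  "vsub V x y = vadd V x (vscale V (- 1) y)"

definition vector_sp :: "('k::real_or_complex, 'a) nspace \<Rightarrow> bool" where
  "vector_sp V \<longleftrightarrow>
     vzero V \<in> carr V \<and>
     (\<forall>x\<in>carr V. \<forall>y\<in>carr V. vadd V x y \<in> carr V \<and> vadd V x y = vadd V y x) \<and>
     (\<forall>x\<in>carr V. \<forall>y\<in>carr V. \<forall>z\<in>carr V. vadd V (vadd V x y) z = vadd V x (vadd V y z)) \<and>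
     (\<forall>x\<in>carr V. vadd V (vzero V) x = x \<and> vsub V x x = vzero V \<and> vscale V 1 x = x) \<and>
     (\<forall>c. \<forall>x\<in>carr V. vscale V c x \<in> carr V) \<and>
     (\<forall>c. \<forall>x\<in>carr V. \<forall>y\<in>carr V. vscale V c (vadd V x y) = vadd V (vscale V c x) (vscale V c y)) \<and>
     (\<forall>b c. \<forall>x\<in>carr V. vscale V (b + c) x = vadd V (vscale V b x) (vscale V c x)) \<and>
     (\<forall>b c. \<forall>x\<in>carr V. vscale V (b * c) x = vscale V b (vscale V c x))"

definition normed_sp :: "('k::real_or_complex, 'a) nspace \<Rightarrow> bool" where
  "normed_sp V \<longleftrightarrow> vector_sp V \<and>
     (\<forall>x\<in>carr V. 0 \<le> vnorm V x \<and> (vnorm V x = 0 \<longleftrightarrow> x = vzero V)) \<and>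
     (\<forall>c. \<forall>x\<in>carr V. vnorm V (vscale V c x) = norm c * vnorm V x) \<and>
     (\<forall>x\<in>carr V. \<forall>y\<in>carr V. vnorm V (vadd V x y) \<le> vnorm V x + vnorm V y)"

text \<open>The case distinction makes the distance function total, as \<^locale>\<open>Metric_space\<close> requires.\<close>

definition nmetric :: "('k::real_or_complex, 'a) nspace \<Rightarrow> 'a metric" where
  "nmetric V = metric (carr V, \<lambda>x y. if x \<in> carr V \<and> y \<in> carr V then vnorm V (vsub V x y) else 0)"

definition banach_sp :: "('k::real_or_complex, 'a) nspace \<Rightarrow> bool" where
  "banach_sp V \<longleftrightarrow> normed_sp V \<and> mcomplete_of (nmetric V)"

definition vsubspace :: "('k::real_or_complex, 'a) nspace \<Rightarrow> 'a set \<Rightarrow> bool" where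
  "vsubspace V S \<longleftrightarrow> S \<subseteq> carr V \<and> vzero V \<in> S \<and>
     (\<forall>x\<in>S. \<forall>y\<in>S. vadd V x y \<in> S) \<and> (\<forall>c. \<forall>x\<in>S. vscale V c x \<in> S)"

definition vspan :: "('k::real_or_complex, 'a) nspace \<Rightarrow> 'a set \<Rightarrow> 'a set" where
  "vspan V S = vsubspace V hull S"

definition fin_dim :: "('k::real_or_complex, 'a) nspace \<Rightarrow> bool" where
  "fin_dim V \<longleftrightarrow> (\<exists>B. finite B \<and> B \<subseteq> carr V \<and> vspan V B = carr V)"

definition subsp :: "('k::real_or_complex, 'a) nspace \<Rightarrow> 'a set \<Rightarrow> ('k, 'a) nspace" where
  "subsp V S = V\<lparr>carr := S\<rparr>"

definition scalars :: "('k::real_or_complex, 'k) nspace" where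
  "scalars = \<lparr>carr = UNIV, vadd = (+), vzero = 0, vscale = (*), vnorm = norm\<rparr>"

text \<open>A set \<open>C\<close> of functions from \<open>S\<close> to \<open>V\<close> with pointwise operations and norm \<open>N\<close>.\<close>

definition fspace ::
  "'x set \<Rightarrow> ('k::real_or_complex, 'a) nspace \<Rightarrow> ('x \<Rightarrow> 'a) set \<Rightarrow> (('x \<Rightarrow> 'a) \<Rightarrow> real)
     \<Rightarrow> ('k, 'x \<Rightarrow> 'a) nspace" where
  "fspace S V C N =
     \<lparr>carr = C,
      vadd = (\<lambda>f g. \<lambda>x\<in>S. vadd V (f x) (g x)),
      vzero = (\<lambda>x\<in>S. vzero V),
      vscale = (\<lambda>c f. \<lambda>x\<in>S. vscale V c (f x)),
      vnorm = N\<rparr>"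

definition linear_map ::
  "('k::real_or_complex, 'a) nspace \<Rightarrow> ('k, 'b) nspace \<Rightarrow> ('a \<Rightarrow> 'b) \<Rightarrow> bool" where
  "linear_map V W T \<longleftrightarrow> T \<in> carr V \<rightarrow> carr W \<and>
     (\<forall>x\<in>carr V. \<forall>y\<in>carr V. T (vadd V x y) = vadd W (T x) (T y)) \<and>
     (\<forall>c. \<forall>x\<in>carr V. T (vscale V c x) = vscale W c (T x))"

definition bounded_ops ::
  "('k::real_or_complex, 'a) nspace \<Rightarrow> ('k, 'b) nspace \<Rightarrow> ('a \<Rightarrow> 'b) set" where
  "bounded_ops V W = {T \<in> extensional (carr V). linear_map V W T \<and>
     (\<exists>C. \<forall>x\<in>carr V. vnorm W (T x) \<le> C * vnorm V x)}"

definition op_norm ::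
  "('k::real_or_complex, 'a) nspace \<Rightarrow> ('k, 'b) nspace \<Rightarrow> ('a \<Rightarrow> 'b) \<Rightarrow> real" where
  "op_norm V W T = Inf {C. 0 \<le> C \<and> (\<forall>x\<in>carr V. vnorm W (T x) \<le> C * vnorm V x)}"

definition ndual :: "('k::real_or_complex, 'a) nspace \<Rightarrow> ('k, 'a \<Rightarrow> 'k) nspace" where
  "ndual V = fspace (carr V) scalars (bounded_ops V scalars) (op_norm V scalars)"

definition isometric_iso ::
  "('k::real_or_complex, 'a) nspace \<Rightarrow> ('k, 'b) nspace \<Rightarrow> ('a \<Rightarrow> 'b) \<Rightarrow> bool" where
  "isometric_iso V W J \<longleftrightarrow> linear_map V W J \<and> bij_betw J (carr V) (carr W) \<and>
     (\<forall>x\<in>carr V. vnorm W (J x) = vnorm V x)"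

definition vcoset :: "('k::real_or_complex, 'a) nspace \<Rightarrow> 'a set \<Rightarrow> 'a \<Rightarrow> 'a set" where
  "vcoset V L x = {vadd V x l | l. l \<in> L}"

definition quotient :: "('k::real_or_complex, 'a) nspace \<Rightarrow> 'a set \<Rightarrow> ('k, 'a set) nspace" where
  "quotient V L =
     \<lparr>carr = vcoset V L ` carr V,
      vadd = (\<lambda>A B. {vadd V a b | a b. a \<in> A \<and> b \<in> B}),
      vzero = L,
      vscale = (\<lambda>c A. {vadd V (vscale V c a) l | a l. a \<in> A \<and> l \<in> L}),
      vnorm = (\<lambda>A. Inf (vnorm V ` A))\<rparr>"

text \<open>The completion: Cauchy sequences, with the seminorm \<open>lim \<parallel>s n\<parallel>\<close>, modulo null sequences.\<close>

definition cauchy_seqs :: "('k::real_or_complex, 'a) nspace \<Rightarrow> ('k, nat \<Rightarrow> 'a) nspace" where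
  "cauchy_seqs V = fspace UNIV V
     {s. Metric_space.MCauchy (mspace (nmetric V)) (mdist (nmetric V)) s}
     (\<lambda>s. lim (\<lambda>n. vnorm V (s n)))"

definition ncompletion :: "('k::real_or_complex, 'a) nspace \<Rightarrow> ('k, (nat \<Rightarrow> 'a) set) nspace" where
  "ncompletion V = quotient (cauchy_seqs V)
     {s \<in> carr (cauchy_seqs V). (\<lambda>n. vnorm V (s n)) \<longlonglongrightarrow> 0}"

definition into_completion :: "('k::real_or_complex, 'a) nspace \<Rightarrow> 'a \<Rightarrow> (nat \<Rightarrow> 'a) set" where
  "into_completion V v = vcoset (cauchy_seqs V)
     {s \<in> carr (cauchy_seqs V). (\<lambda>n. vnorm V (s n)) \<longlonglongrightarrow> 0} (\<lambda>n. v)"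

type_synonym 'm pmetric = "'m metric \<times> 'm"

abbreviation pts :: "'m pmetric \<Rightarrow> 'm set" where "pts X \<equiv> mspace (fst X)"
abbreviation pdist :: "'m pmetric \<Rightarrow> 'm \<Rightarrow> 'm \<Rightarrow> real" where "pdist X \<equiv> mdist (fst X)"
abbreviation base :: "'m pmetric \<Rightarrow> 'm" where "base X \<equiv> snd X"

definition pointed :: "'m pmetric \<Rightarrow> bool" where
  "pointed X \<longleftrightarrow> base X \<in> pts X"

definition subpm :: "'m pmetric \<Rightarrow> 'm set \<Rightarrow> 'm pmetric" where
  "subpm X Y = (submetric (fst X) Y, base X)"

definition of_normed :: "('k::real_or_complex, 'a) nspace \<Rightarrow> 'a pmetric" where
  "of_normed V = (nmetric V, vzero V)"

definition lip0 :: "'x pmetric \<Rightarrow> 'y pmetric \<Rightarrow> ('x \<Rightarrow> 'y) set" where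
  "lip0 X Y = {f \<in> extensional (pts X). Lipschitz_continuous_map (fst X) (fst Y) f \<and> f (base X) = base Y}"

definition Lip :: "'x pmetric \<Rightarrow> 'y pmetric \<Rightarrow> ('x \<Rightarrow> 'y) \<Rightarrow> real" where
  "Lip X Y f = Inf {C. 0 \<le> C \<and> (\<forall>x\<in>pts X. \<forall>y\<in>pts X. pdist Y (f x) (f y) \<le> C * pdist X x y)}"

abbreviation lipv :: "'m pmetric \<Rightarrow> ('k::real_or_complex, 'a) nspace \<Rightarrow> ('m \<Rightarrow> 'a) set" where
  "lipv X V \<equiv> lip0 X (of_normed V)"

abbreviation Lipv :: "'m pmetric \<Rightarrow> ('k::real_or_complex, 'a) nspace \<Rightarrow> ('m \<Rightarrow> 'a) \<Rightarrow> real" where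
  "Lipv X V \<equiv> Lip X (of_normed V)"

definition lip_space ::
  "'m pmetric \<Rightarrow> ('k::real_or_complex, 'a) nspace \<Rightarrow> ('k, 'm \<Rightarrow> 'a) nspace" where
  "lip_space X V = fspace (pts X) V (lipv X V) (Lipv X V)"

type_synonym ('m, 'u, 'k) tensor = "('m \<Rightarrow> 'u \<Rightarrow> 'k) \<Rightarrow> 'k"

definition elem ::
  "'m pmetric \<Rightarrow> ('k::real_or_complex, 'u) nspace \<Rightarrow> 'm \<Rightarrow> 'm \<Rightarrow> 'u \<Rightarrow> ('m, 'u, 'k) tensor" where
  "elem X E x y e = (\<lambda>f\<in>lipv X (ndual E). f x e - f y e)"

definition tensors ::
  "'m pmetric \<Rightarrow> ('k::real_or_complex, 'u) nspace \<Rightarrow> ('m, 'u, 'k) tensor set" where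
  "tensors X E = vspan (fspace (lipv X (ndual E)) scalars (extensional (lipv X (ndual E))) (\<lambda>_. 0))
     {elem X E x y e | x y e. x \<in> pts X \<and> y \<in> pts X \<and> e \<in> carr E}"

text \<open>\<open>is_rep X E l u\<close>: the list \<open>l\<close> of triples \<open>(x\<^sub>i, y\<^sub>i, e\<^sub>i)\<close> represents
  \<open>u = (\<Sum>i. \<delta>(x\<^sub>i, y\<^sub>i) \<boxtimes> e\<^sub>i)\<close>.\<close>

definition is_rep ::
  "'m pmetric \<Rightarrow> ('k::real_or_complex, 'u) nspace \<Rightarrow> ('m \<times> 'm \<times> 'u) list
     \<Rightarrow> ('m, 'u, 'k) tensor \<Rightarrow> bool" where
  "is_rep X E l u \<longleftrightarrow> set l \<subseteq> pts X \<times> pts X \<times> carr E \<and>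
     u = (\<lambda>f\<in>lipv X (ndual E). \<Sum>(x, y, e)\<leftarrow>l. elem X E x y e f)"

definition proj_norm ::
  "'m pmetric \<Rightarrow> ('k::real_or_complex, 'u) nspace \<Rightarrow> ('m, 'u, 'k) tensor \<Rightarrow> real" where
  "proj_norm X E u = Inf {\<Sum>(x, y, e)\<leftarrow>l. pdist X x y * vnorm E e | l. is_rep X E l u}"

definition inj_norm ::
  "'m pmetric \<Rightarrow> ('k::real_or_complex, 'u) nspace \<Rightarrow> ('m, 'u, 'k) tensor \<Rightarrow> real" where
  "inj_norm X E u = Sup {norm (\<Sum>(x, y, e)\<leftarrow>l. (g x - g y) * \<phi> e) | g \<phi> l.
     g \<in> lipv X (scalars :: ('k, 'k) nspace) \<and> Lipv X (scalars :: ('k, 'k) nspace) g \<le> 1 \<and>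
     \<phi> \<in> carr (ndual E) \<and> vnorm (ndual E) \<phi> \<le> 1 \<and> is_rep X E l u}"

text \<open>\<open>h \<boxtimes> T\<close>, given as precomposition with \<open>g \<mapsto> T\<^sup>* \<circ> g \<circ> h\<close>. This is linear by construction,
  and the lemma \<open>tensor_map_elem\<close> at the end of the theory computes it on generators.\<close>

definition tensor_map ::
  "'m pmetric \<Rightarrow> ('k::real_or_complex, 'u) nspace \<Rightarrow> 'n pmetric \<Rightarrow> ('k, 'v) nspace
     \<Rightarrow> ('m \<Rightarrow> 'n) \<Rightarrow> ('u \<Rightarrow> 'v) \<Rightarrow> ('m, 'u, 'k) tensor \<Rightarrow> ('n, 'v, 'k) tensor" where
  "tensor_map X E Y F h T u =
     (\<lambda>g\<in>lipv Y (ndual F). u (\<lambda>x\<in>pts X. \<lambda>e\<in>carr E. g (h x) (T e)))"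

type_synonym ('m, 'u, 'k) gnorm =
  "'m pmetric \<Rightarrow> ('k, 'u) nspace \<Rightarrow> ('m, 'u, 'k) tensor \<Rightarrow> real"

definition tensor_sp ::
  "('m, 'u, 'k::real_or_complex) gnorm \<Rightarrow> 'm pmetric \<Rightarrow> ('k, 'u) nspace
     \<Rightarrow> ('k, ('m, 'u, 'k) tensor) nspace" where
  "tensor_sp \<alpha> X E = fspace (lipv X (ndual E)) scalars (tensors X E) (\<alpha> X E)"

definition lipschitz_cross_norm ::
  "('m, 'u, 'k::real_or_complex) gnorm \<Rightarrow> 'm pmetric \<Rightarrow> ('k, 'u) nspace \<Rightarrow> bool" where
  "lipschitz_cross_norm \<alpha> X E \<longleftrightarrow> normed_sp (tensor_sp \<alpha> X E) \<and>
     (\<forall>x\<in>pts X. \<forall>y\<in>pts X. \<forall>e\<in>carr E. \<alpha> X E (elem X E x y e) = pdist X x y * vnorm E e)"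

definition generic_cross_norm :: "('m, 'u, 'k::real_or_complex) gnorm \<Rightarrow> bool" where
  "generic_cross_norm \<alpha> \<longleftrightarrow>
     (\<forall>X E. pointed X \<and> banach_sp E \<longrightarrow>
        lipschitz_cross_norm \<alpha> X E \<and>
        (\<forall>u\<in>tensors X E. inj_norm X E u \<le> \<alpha> X E u \<and> \<alpha> X E u \<le> proj_norm X E u)) \<and>
     (\<forall>X\<^sub>0 X\<^sub>1 E\<^sub>0 E\<^sub>1 h T.
        pointed X\<^sub>0 \<and> pointed X\<^sub>1 \<and> banach_sp E\<^sub>0 \<and> banach_sp E\<^sub>1 \<and>
        h \<in> lip0 X\<^sub>0 X\<^sub>1 \<and> T \<in> bounded_ops E\<^sub>0 E\<^sub>1 \<longrightarrow>
        restrict (tensor_map X\<^sub>0 E\<^sub>0 X\<^sub>1 E\<^sub>1 h T) (tensors X\<^sub>0 E\<^sub>0)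
          \<in> bounded_ops (tensor_sp \<alpha> X\<^sub>0 E\<^sub>0) (tensor_sp \<alpha> X\<^sub>1 E\<^sub>1) \<and>
        op_norm (tensor_sp \<alpha> X\<^sub>0 E\<^sub>0) (tensor_sp \<alpha> X\<^sub>1 E\<^sub>1) (tensor_map X\<^sub>0 E\<^sub>0 X\<^sub>1 E\<^sub>1 h T)
          \<le> Lip X\<^sub>0 X\<^sub>1 h * op_norm E\<^sub>0 E\<^sub>1 T)"

text \<open>The tensor \<open>u\<close> belongs to \<open>X\<^sub>0 \<boxtimes> E\<^sub>0\<close> if it is the image of some \<open>v\<close> under the
  canonical embedding, the tensor product of the two inclusion maps.\<close>

definition finitely_generated :: "('m, 'u, 'k::real_or_complex) gnorm \<Rightarrow> bool" where
  "finitely_generated \<alpha> \<longleftrightarrow>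
     (\<forall>X E. pointed X \<and> banach_sp E \<longrightarrow> (\<forall>u\<in>tensors X E.
        \<alpha> X E u = Inf {\<alpha> (subpm X X\<^sub>0) (subsp E E\<^sub>0) v | X\<^sub>0 E\<^sub>0 v.
          finite X\<^sub>0 \<and> X\<^sub>0 \<subseteq> pts X \<and> base X \<in> X\<^sub>0 \<and>
          vsubspace E E\<^sub>0 \<and> fin_dim (subsp E E\<^sub>0) \<and>
          v \<in> tensors (subpm X X\<^sub>0) (subsp E E\<^sub>0) \<and>
          tensor_map (subpm X X\<^sub>0) (subsp E E\<^sub>0) X E (\<lambda>x. x) (\<lambda>e. e) v = u}))"

type_synonym ('m, 'u, 'k) gideal = "'m pmetric \<Rightarrow> ('k, 'u) nspace \<Rightarrow> ('m \<Rightarrow> 'u) set"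
type_synonym ('m, 'u, 'k) gideal_norm = "'m pmetric \<Rightarrow> ('k, 'u) nspace \<Rightarrow> ('m \<Rightarrow> 'u) \<Rightarrow> real"

definition generic_ideal ::
  "('m, 'u, 'k::real_or_complex) gideal \<Rightarrow> ('m, 'u, 'k) gideal_norm \<Rightarrow> bool" where
  "generic_ideal A nA \<longleftrightarrow>
     (\<forall>X E. pointed X \<and> banach_sp E \<longrightarrow>
        vsubspace (lip_space X E) (A X E) \<and>
        banach_sp (fspace (pts X) E (A X E) (nA X E)) \<and>
        (\<forall>f\<in>A X E. Lipv X E f \<le> nA X E f) \<and>
        (\<forall>g\<in>lipv X (scalars :: ('k, 'k) nspace). \<forall>e\<in>carr E.
           (\<lambda>x\<in>pts X. vscale E (g x) e) \<in> A X E \<and>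
           nA X E (\<lambda>x\<in>pts X. vscale E (g x) e)
             \<le> Lipv X (scalars :: ('k, 'k) nspace) g * vnorm E e)) \<and>
     (\<forall>X Z E F f h S.
        pointed X \<and> pointed Z \<and> banach_sp E \<and> banach_sp F \<and>
        f \<in> A X E \<and> h \<in> lip0 Z X \<and> S \<in> bounded_ops E F \<longrightarrow>
        (\<lambda>z\<in>pts Z. S (f (h z))) \<in> A Z F \<and>
        nA Z F (\<lambda>z\<in>pts Z. S (f (h z))) \<le> op_norm E F S * nA X E f * Lip Z X h)"

text \<open>In the supremum, \<open>J\<close> identifies \<open>E/L\<close> with a Banach space \<open>F\<close> carried by \<open>'u\<close>,
  so that the ideal norm of \<open>Q \<circ> f \<circ> I\<close> is that of \<open>J \<circ> Q \<circ> f \<circ> I\<close>.\<close>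

definition max_norm ::
  "('m, 'u, 'k::real_or_complex) gideal_norm \<Rightarrow> 'm pmetric \<Rightarrow> ('k, 'u) nspace
     \<Rightarrow> ('m \<Rightarrow> 'u) \<Rightarrow> ennreal" where
  "max_norm nA X E f =
     Sup {ennreal (nA (subpm X Y) F (\<lambda>y\<in>Y. J (vcoset E L (f y)))) | Y L F J.
       finite Y \<and> Y \<subseteq> pts X \<and> base X \<in> Y \<and>
       vsubspace E L \<and> closedin (mtopology_of (nmetric E)) L \<and> fin_dim (quotient E L) \<and>
       banach_sp F \<and> isometric_iso (quotient E L) F J}"

definition maximal_ideal ::
  "('m, 'u, 'k::real_or_complex) gideal \<Rightarrow> ('m, 'u, 'k) gideal_norm \<Rightarrow> bool" where
  "maximal_ideal A nA \<longleftrightarrow>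
     (\<forall>X E. pointed X \<and> banach_sp E \<longrightarrow>
        A X E = {f \<in> lipv X E. max_norm nA X E f < \<infinity>} \<and>
        (\<forall>f\<in>A X E. ennreal (nA X E f) = max_norm nA X E f))"

text \<open>
  \<open>A(X, E\<^sup>*) = W\<^sup>*\<close> isometrically, where \<open>J\<close> identifies \<open>D\<close> with \<open>E\<^sup>*\<close> and \<open>\<iota>\<close> maps \<open>X \<boxtimes> E\<close> to \<open>W\<close>
  (identically, or into the completion). As tensors are functionals on \<open>lip0 X E\<^sup>*\<close>, the functional
  \<open>(\<Sum>i. \<delta>(x\<^sub>i, y\<^sub>i) \<boxtimes> e\<^sub>i) \<mapsto> (\<Sum>i. \<langle>f x\<^sub>i - f y\<^sub>i, e\<^sub>i\<rangle>)\<close> attached to \<open>f\<close> is the evaluation \<open>u \<mapsto> u f\<close>.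
\<close>

definition dual_relation ::
  "('m, 'u, 'k::real_or_complex) gideal \<Rightarrow> ('m, 'u, 'k) gideal_norm \<Rightarrow> 'm pmetric
     \<Rightarrow> ('k, 'u) nspace \<Rightarrow> ('k, 'u) nspace \<Rightarrow> ('u \<Rightarrow> 'u \<Rightarrow> 'k)
     \<Rightarrow> ('k, 'w) nspace \<Rightarrow> (('m, 'u, 'k) tensor \<Rightarrow> 'w) \<Rightarrow> bool" where
  "dual_relation A nA X E D J W \<iota> \<longleftrightarrow>
     (\<exists>\<Theta>. bij_betw \<Theta> (A X D) (carr (ndual W)) \<and>
        (\<forall>f\<in>A X D. vnorm (ndual W) (\<Theta> f) = nA X D f \<and>
           (\<forall>u\<in>tensors X E. \<Theta> f (\<iota> u) = u (\<lambda>x\<in>pts X. J (f x)))))"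

text \<open>
  \<open>A(X, E) = W\<^sup>* \<inter> lip0 X E\<close> isometrically, where \<open>J\<close> identifies \<open>D\<close> with \<open>E\<^sup>*\<close> and \<open>\<iota>\<close> maps
  \<open>X \<boxtimes> D\<close> to \<open>W\<close>. The functional \<open>(\<Sum>i. \<delta>(x\<^sub>i, y\<^sub>i) \<boxtimes> d\<^sub>i) \<mapsto> (\<Sum>i. \<langle>J d\<^sub>i, f x\<^sub>i - f y\<^sub>i\<rangle>)\<close> attached
  to \<open>f\<close> is the evaluation of tensors at \<open>x \<mapsto> (d \<mapsto> J d (f x))\<close>, an element of \<open>lip0 X D\<^sup>*\<close>.
\<close>

definition predual_relation ::
  "('m, 'u, 'k::real_or_complex) gideal \<Rightarrow> ('m, 'u, 'k) gideal_norm \<Rightarrow> 'm pmetric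
     \<Rightarrow> ('k, 'u) nspace \<Rightarrow> ('k, 'u) nspace \<Rightarrow> ('u \<Rightarrow> 'u \<Rightarrow> 'k)
     \<Rightarrow> ('k, 'w) nspace \<Rightarrow> (('m, 'u, 'k) tensor \<Rightarrow> 'w) \<Rightarrow> bool" where
  "predual_relation A nA X E D J W \<iota> \<longleftrightarrow>
     (let represents = (\<lambda>\<Phi> f. \<forall>u\<in>tensors X D.
            \<Phi> (\<iota> u) = u (\<lambda>x\<in>pts X. \<lambda>d\<in>carr D. J d (f x)))
      in A X E = {f \<in> lipv X E. \<exists>\<Phi>\<in>carr (ndual W). represents \<Phi> f} \<and>
         (\<forall>f\<in>A X E. \<forall>\<Phi>\<in>carr (ndual W). represents \<Phi> f \<longrightarrow> nA X E f = vnorm (ndual W) \<Phi>))"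

definition associated ::
  "('m, 'u, 'k::real_or_complex) gideal \<Rightarrow> ('m, 'u, 'k) gideal_norm
     \<Rightarrow> ('m, 'u, 'k) gnorm \<Rightarrow> bool" where
  "associated A nA \<alpha> \<longleftrightarrow>
     (\<forall>X E D J. pointed X \<and> finite (pts X) \<and> banach_sp E \<and> fin_dim E \<and>
        banach_sp D \<and> isometric_iso D (ndual E) J \<longrightarrow>
        dual_relation A nA X E D J (tensor_sp \<alpha> X E) (\<lambda>u. u))"

lemma vsub_closed: "vector_sp V \<Longrightarrow> x \<in> carr V \<Longrightarrow> y \<in> carr V \<Longrightarrow> vsub V x y \<in> carr V"
  unfolding vector_sp_def vsub_def by blast

lemma vsub_self_iff:
  assumes V: "vector_sp V" and x: "x \<in> carr V" and y: "y \<in> carr V" and 0: "vsub V x y = vzero V"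
  shows "x = y"
proof -
  let ?m = "vscale V (- 1) y"
  have m: "?m \<in> carr V" using V y unfolding vector_sp_def by blast
  have "x = vadd V x (vadd V ?m y)"
    using V x y m unfolding vector_sp_def vsub_def by metis
  also have "\<dots> = vadd V (vadd V x ?m) y"
    using V x y m unfolding vector_sp_def by metis
  also have "\<dots> = vadd V (vzero V) y"
    using 0 by (simp add: vsub_def)
  also have "\<dots> = y"
    using V y unfolding vector_sp_def by blast
  finally show ?thesis .
qed

lemma vsub_swap:
  assumes V: "vector_sp V" and x: "x \<in> carr V" and y: "y \<in> carr V"
  shows "vsub V y x = vscale V (- 1) (vsub V x y)"
proof -
  let ?m = "vscale V (- 1) y" and ?n = "vscale V (- 1) x"
  have m: "?m \<in> carr V" "?n \<in> carr V" using V x y unfolding vector_sp_def by blast+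
  have 1: "vscale V (- 1) ?m = y"
  proof -
    have "vscale V ((- 1) * (- 1)) y = vscale V (- 1) ?m"
      using V y unfolding vector_sp_def by blast
    then show ?thesis using V y unfolding vector_sp_def by simp
  qed
  have "vscale V (- 1) (vsub V x y) = vadd V ?n (vscale V (- 1) ?m)"
    using V x m unfolding vector_sp_def vsub_def by blast
  also have "\<dots> = vadd V y ?n"
    using 1 V y m unfolding vector_sp_def by metis
  finally show ?thesis by (simp add: vsub_def)
qed

lemma vsub_split:
  assumes V: "vector_sp V" and x: "x \<in> carr V" and y: "y \<in> carr V" and z: "z \<in> carr V"
  shows "vsub V x z = vadd V (vsub V x y) (vsub V y z)"
proof -
  let ?m = "vscale V (- 1) y" and ?n = "vscale V (- 1) z"
  have m: "?m \<in> carr V" "?n \<in> carr V" using V y z unfolding vector_sp_def by blast+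
  have c: "vadd V ?m y = vzero V"
    using V y m unfolding vector_sp_def vsub_def by metis
  have yn: "vadd V y ?n \<in> carr V" using V y m unfolding vector_sp_def by blast
  have "vadd V (vadd V x ?m) (vadd V y ?n) = vadd V x (vadd V ?m (vadd V y ?n))"
    using V x m yn unfolding vector_sp_def by blast
  also have "vadd V ?m (vadd V y ?n) = vadd V (vadd V ?m y) ?n"
    using V y m unfolding vector_sp_def by metis
  also have "\<dots> = ?n" using c V m unfolding vector_sp_def by metis
  finally show ?thesis by (simp add: vsub_def)
qed

lemma Metric_space_normed:
  assumes "normed_sp V"
  shows "Metric_space (carr V)
           (\<lambda>x y. if x \<in> carr V \<and> y \<in> carr V then vnorm V (vsub V x y) else 0)"
proof -
  have V: "vector_sp V" and nn: "\<And>x. x \<in> carr V \<Longrightarrow> 0 \<le> vnorm V x"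
    and n0: "\<And>x. x \<in> carr V \<Longrightarrow> vnorm V x = 0 \<longleftrightarrow> x = vzero V"
    and sc: "\<And>c x. x \<in> carr V \<Longrightarrow> vnorm V (vscale V c x) = norm c * vnorm V x"
    and tr: "\<And>x y. x \<in> carr V \<Longrightarrow> y \<in> carr V \<Longrightarrow> vnorm V (vadd V x y) \<le> vnorm V x + vnorm V y"
    using assms unfolding normed_sp_def by blast+
  have self: "vsub V x x = vzero V" if "x \<in> carr V" for x
    using V that unfolding vector_sp_def by blast
  show ?thesis
  proof (unfold_locales, goal_cases)
    case (1 x y)
    then show ?case using nn vsub_closed[OF V] by simp
  next
    case (2 x y)
    then show ?case using vsub_swap[OF V, of x y] sc[OF vsub_closed[OF V, of x y], of "- 1"] by simp
  next
    case (3 x y)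
    then show ?case using n0 vsub_closed[OF V] vsub_self_iff[OF V] self by auto
  next
    case (4 x y z)
    then show ?case
      using vsub_split[OF V, of x y z] tr[OF vsub_closed[OF V, of x y] vsub_closed[OF V, of y z]]
      by simp
  qed
qed

lemma mspace_nmetric: "normed_sp V \<Longrightarrow> mspace (nmetric V) = carr V"
  unfolding nmetric_def by (simp add: Metric_space.mspace_metric Metric_space_normed)

lemma mdist_nmetric:
  "normed_sp V \<Longrightarrow> x \<in> carr V \<Longrightarrow> y \<in> carr V \<Longrightarrow> mdist (nmetric V) x y = vnorm V (vsub V x y)"
  unfolding nmetric_def by (simp add: Metric_space.mdist_metric Metric_space_normed)

lemma op_norm_bound:
  assumes "\<exists>C. \<forall>x\<in>carr V. vnorm W (T x) \<le> C * vnorm V x"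
    and nn: "\<And>x. x \<in> carr V \<Longrightarrow> 0 \<le> vnorm V x"
  shows "0 \<le> op_norm V W T" and "x \<in> carr V \<Longrightarrow> vnorm W (T x) \<le> op_norm V W T * vnorm V x"
proof -
  let ?S = "{C. 0 \<le> C \<and> (\<forall>x\<in>carr V. vnorm W (T x) \<le> C * vnorm V x)}"
  obtain C where C: "\<And>x. x \<in> carr V \<Longrightarrow> vnorm W (T x) \<le> C * vnorm V x"
    using assms(1) by blast
  have "max C 0 \<in> ?S"
  proof (clarsimp)
    fix x assume x: "x \<in> carr V"
    have "C * vnorm V x \<le> max C 0 * vnorm V x"
      by (rule mult_right_mono) (use nn x in auto)
    then show "vnorm W (T x) \<le> max C 0 * vnorm V x" using C[OF x] by linarith
  qed
  then have ne: "?S \<noteq> {}" by blast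
  show "0 \<le> op_norm V W T"
    unfolding op_norm_def by (rule cInf_greatest[OF ne]) auto
  show "vnorm W (T x) \<le> op_norm V W T * vnorm V x" if x: "x \<in> carr V"
  proof (cases "vnorm V x = 0")
    case True
    then show ?thesis using C[OF x] by simp
  next
    case False
    then have pos: "0 < vnorm V x" using nn[OF x] by simp
    have "vnorm W (T x) / vnorm V x \<le> op_norm V W T"
      unfolding op_norm_def
      by (rule cInf_greatest[OF ne]) (use x pos in \<open>auto simp: divide_le_eq\<close>)
    then show ?thesis using pos by (simp add: divide_le_eq)
  qed
qed

lemma op_norm_le:
  assumes "0 \<le> C" and "\<And>x. x \<in> carr V \<Longrightarrow> vnorm W (T x) \<le> C * vnorm V x"
  shows "op_norm V W T \<le> C"
  unfolding op_norm_def by (rule cInf_lower) (use assms in \<open>auto intro!: bdd_belowI\<close>)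

lemma scalars_simps [simp]:
  "carr scalars = UNIV" "vadd scalars = (+)" "vzero scalars = 0" "vscale scalars = (*)"
  "vnorm scalars = norm"
  by (simp_all add: scalars_def)

lemma ndual_simps [simp]:
  "carr (ndual V) = bounded_ops V scalars"
  "vadd (ndual V) = (\<lambda>f g. \<lambda>x\<in>carr V. f x + g x)"
  "vzero (ndual V) = (\<lambda>x\<in>carr V. 0)"
  "vscale (ndual V) = (\<lambda>c f. \<lambda>x\<in>carr V. c * f x)"
  "vnorm (ndual V) = op_norm V scalars"
  by (simp_all add: ndual_def fspace_def scalars_def)

lemma normed_sp_ndual:
  assumes N: "normed_sp V"
  shows "normed_sp (ndual V)"
proof -
  have V: "vector_sp V" and nn: "\<And>x. x \<in> carr V \<Longrightarrow> 0 \<le> vnorm V x"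
    using N unfolding normed_sp_def by blast+
  have cl: "\<And>x y. x \<in> carr V \<Longrightarrow> y \<in> carr V \<Longrightarrow> vadd V x y \<in> carr V"
      "\<And>c x. x \<in> carr V \<Longrightarrow> vscale V c x \<in> carr V"
    using V unfolding vector_sp_def by blast+
  have mem: "f \<in> bounded_ops V scalars \<longleftrightarrow> f \<in> extensional (carr V) \<and>
      (\<forall>x\<in>carr V. \<forall>y\<in>carr V. f (vadd V x y) = f x + f y) \<and>
      (\<forall>c. \<forall>x\<in>carr V. f (vscale V c x) = c * f x) \<and>
      (\<exists>C. \<forall>x\<in>carr V. norm (f x) \<le> C * vnorm V x)" for f :: "'b \<Rightarrow> 'a"
    unfolding bounded_ops_def linear_map_def by simp
  have bound: "0 \<le> op_norm V scalars f"
      "\<And>x. x \<in> carr V \<Longrightarrow> norm (f x) \<le> op_norm V scalars f * vnorm V x"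
    if "f \<in> bounded_ops V scalars" for f
    using that op_norm_bound[of V scalars f, OF _ nn] unfolding mem by auto
  have addb: "norm (f x + g x) \<le> (op_norm V scalars f + op_norm V scalars g) * vnorm V x"
    if "f \<in> bounded_ops V scalars" "g \<in> bounded_ops V scalars" "x \<in> carr V" for f g x
    using bound(2)[OF that(1,3)] bound(2)[OF that(2,3)] norm_triangle_ineq[of "f x" "g x"]
    by (simp add: distrib_right)
  have sclb: "norm (c * f x) \<le> (norm c * op_norm V scalars f) * vnorm V x"
    if "f \<in> bounded_ops V scalars" "x \<in> carr V" for f c x
    using mult_left_mono[OF bound(2)[OF that] norm_ge_zero[of c]] by (simp add: norm_mult mult.assoc)
  have addm: "(\<lambda>x\<in>carr V. f x + g x) \<in> bounded_ops V scalars"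
    if "f \<in> bounded_ops V scalars" "g \<in> bounded_ops V scalars" for f g
  proof -
    have "\<exists>C. \<forall>x\<in>carr V. norm (f x + g x) \<le> C * vnorm V x"
      using addb[OF that] by blast
    then show ?thesis using that cl unfolding mem by (auto simp: algebra_simps)
  qed
  have sclm: "(\<lambda>x\<in>carr V. c * f x) \<in> bounded_ops V scalars"
    if "f \<in> bounded_ops V scalars" for c f
  proof -
    have "\<exists>C. \<forall>x\<in>carr V. norm (c * f x) \<le> C * vnorm V x"
      using sclb[OF that] by blast
    then show ?thesis using that cl unfolding mem by (auto simp: algebra_simps)
  qed
  have zm: "(\<lambda>x\<in>carr V. 0) \<in> bounded_ops V scalars"
    using cl unfolding mem by (auto intro!: exI[of _ 0])
  have ext: "f \<in> extensional (carr V)" if "f \<in> bounded_ops V scalars" for f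
    using that unfolding bounded_ops_def by blast
  have vs: "vector_sp (ndual V)"
    unfolding vector_sp_def vsub_def
    by (auto simp: addm sclm zm algebra_simps intro!: extensionalityI[of _ "carr V"] intro: ext)
  have n0: "op_norm V scalars f = 0 \<longleftrightarrow> f = (\<lambda>x\<in>carr V. 0)" if f: "f \<in> bounded_ops V scalars" for f
  proof
    assume "op_norm V scalars f = 0"
    then show "f = (\<lambda>x\<in>carr V. 0)"
      using bound(2)[OF f] by (auto intro!: extensionalityI[of _ "carr V"] ext[OF f])
  next
    assume "f = (\<lambda>x\<in>carr V. 0)"
    then have "op_norm V scalars f \<le> 0"
      by (intro op_norm_le) auto
    then show "op_norm V scalars f = 0" using bound(1)[OF f] by simp
  qed
  have tri: "op_norm V scalars (\<lambda>x\<in>carr V. f x + g x) \<le> op_norm V scalars f + op_norm V scalars g"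
    if "f \<in> bounded_ops V scalars" "g \<in> bounded_ops V scalars" for f g
    by (rule op_norm_le) (use that bound addb in auto)
  have le: "op_norm V scalars (\<lambda>x\<in>carr V. c * f x) \<le> norm c * op_norm V scalars f"
    if "f \<in> bounded_ops V scalars" for c f
    by (rule op_norm_le) (use that bound sclb in auto)
  have sc: "op_norm V scalars (\<lambda>x\<in>carr V. c * f x) = norm c * op_norm V scalars f"
    if f: "f \<in> bounded_ops V scalars" for c f
  proof (cases "c = 0")
    case True
    then show ?thesis using le[OF f, of c] bound(1)[OF sclm[OF f, of c]] by simp
  next
    case False
    have eq: "(\<lambda>x\<in>carr V. inverse c * (\<lambda>x\<in>carr V. c * f x) x) = f"
      using False
      by (auto simp: mult.assoc[symmetric] intro!: extensionalityI[of _ "carr V"] ext[OF f])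
    have "op_norm V scalars f \<le> norm (inverse c) * op_norm V scalars (\<lambda>x\<in>carr V. c * f x)"
      using le[OF sclm[OF f, of c], of "inverse c"] unfolding eq .
    then have "norm c * op_norm V scalars f \<le> op_norm V scalars (\<lambda>x\<in>carr V. c * f x)"
      using False by (simp add: norm_divide field_simps)
    then show ?thesis using le[OF f, of c] by simp
  qed
  show ?thesis
    unfolding normed_sp_def using vs n0 tri sc bound(1) by simp
qed

lemma lip0_precompose:
  assumes h: "h \<in> lip0 X Y" and X: "pointed X"
    and E: "normed_sp E" and F: "normed_sp F" and T: "T \<in> bounded_ops E F"
    and g: "g \<in> lipv Y (ndual F)"
  shows "(\<lambda>x\<in>pts X. \<lambda>e\<in>carr E. g (h x) (T e)) \<in> lipv X (ndual E)"
proof -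
  have nE: "\<And>x. x \<in> carr E \<Longrightarrow> 0 \<le> vnorm E x" and nF: "\<And>x. x \<in> carr F \<Longrightarrow> 0 \<le> vnorm F x"
    and vE: "vector_sp E"
    using E F unfolding normed_sp_def by blast+
  have clE: "\<And>x y. x \<in> carr E \<Longrightarrow> y \<in> carr E \<Longrightarrow> vadd E x y \<in> carr E"
      "\<And>c x. x \<in> carr E \<Longrightarrow> vscale E c x \<in> carr E"
    using vE unfolding vector_sp_def by blast+
  note dE = normed_sp_ndual[OF E] and dF = normed_sp_ndual[OF F]
  have Tm: "T e \<in> carr F" if "e \<in> carr E" for e
    using T that unfolding bounded_ops_def linear_map_def by auto
  have Tadd: "T (vadd E a b) = vadd F (T a) (T b)" if "a \<in> carr E" "b \<in> carr E" for a b
    using T that unfolding bounded_ops_def linear_map_def by auto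
  have Tsc: "T (vscale E c a) = vscale F c (T a)" if "a \<in> carr E" for a c
    using T that unfolding bounded_ops_def linear_map_def by auto
  define t where "t = op_norm E F T"
  have tb: "0 \<le> t" "\<And>e. e \<in> carr E \<Longrightarrow> vnorm F (T e) \<le> t * vnorm E e"
    using T op_norm_bound[of E F T, OF _ nE] unfolding bounded_ops_def t_def by auto
  have adj: "(\<lambda>e\<in>carr E. \<phi> (T e)) \<in> bounded_ops E scalars \<and>
      op_norm E scalars (\<lambda>e\<in>carr E. \<phi> (T e)) \<le> t * op_norm F scalars \<phi>"
    if p: "\<phi> \<in> bounded_ops F scalars" for \<phi>
  proof -
    have pl: "\<And>a b. a \<in> carr F \<Longrightarrow> b \<in> carr F \<Longrightarrow> \<phi> (vadd F a b) = \<phi> a + \<phi> b"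
        "\<And>c a. a \<in> carr F \<Longrightarrow> \<phi> (vscale F c a) = c * \<phi> a"
      and pe: "\<exists>C. \<forall>x\<in>carr F. norm (\<phi> x) \<le> C * vnorm F x"
      using p unfolding bounded_ops_def linear_map_def by auto
    have pb: "0 \<le> op_norm F scalars \<phi>"
        "\<And>a. a \<in> carr F \<Longrightarrow> norm (\<phi> a) \<le> op_norm F scalars \<phi> * vnorm F a"
      using op_norm_bound[of F scalars \<phi>, OF _ nF] pe by auto
    have b: "norm (\<phi> (T e)) \<le> (t * op_norm F scalars \<phi>) * vnorm E e" if e: "e \<in> carr E" for e
      using pb(2)[OF Tm[OF e]] mult_left_mono[OF tb(2)[OF e] pb(1)] by (simp add: mult_ac)
    have ex: "\<exists>C. \<forall>e\<in>carr E. norm (\<phi> (T e)) \<le> C * vnorm E e" using b by blast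
    have "(\<lambda>e\<in>carr E. \<phi> (T e)) \<in> bounded_ops E scalars"
      unfolding bounded_ops_def linear_map_def using clE Tm Tadd Tsc pl ex by auto
    moreover have "op_norm E scalars (\<lambda>e\<in>carr E. \<phi> (T e)) \<le> t * op_norm F scalars \<phi>"
      by (rule op_norm_le) (use tb pb b in auto)
    ultimately show ?thesis by blast
  qed
  have hm: "h x \<in> pts Y" if "x \<in> pts X" for x
    using h that unfolding lip0_def Lipschitz_continuous_map_def by auto
  have gm: "g y \<in> bounded_ops F scalars" if "y \<in> pts Y" for y
    using g that mspace_nmetric[OF dF]
    unfolding lip0_def Lipschitz_continuous_map_def of_normed_def by auto
  obtain B where B: "0 < B" "\<And>x y. x \<in> pts X \<Longrightarrow> y \<in> pts X \<Longrightarrow> pdist Y (h x) (h y) \<le> B * pdist X x y"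
    using h unfolding lip0_def Lipschitz_continuous_map_pos by auto
  obtain C where C: "0 < C" "\<And>x y. x \<in> pts Y \<Longrightarrow> y \<in> pts Y \<Longrightarrow>
      mdist (nmetric (ndual F)) (g x) (g y) \<le> C * pdist Y x y"
    using g unfolding lip0_def Lipschitz_continuous_map_pos of_normed_def by auto
  let ?f = "\<lambda>x\<in>pts X. \<lambda>e\<in>carr E. g (h x) (T e)"
  have fm: "?f x \<in> bounded_ops E scalars" if "x \<in> pts X" for x
    using adj gm hm that by simp
  have d: "mdist (nmetric (ndual E)) (?f x) (?f y) \<le> (t * C * B) * pdist X x y"
    if x: "x \<in> pts X" and y: "y \<in> pts X" for x y
  proof -
    let ?d = "vsub (ndual F) (g (h x)) (g (h y))"
    have gg: "g (h x) \<in> carr (ndual F)" "g (h y) \<in> carr (ndual F)"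
      using gm hm x y by simp_all
    have dm: "?d \<in> bounded_ops F scalars"
      using vsub_closed[OF _ gg] dF unfolding normed_sp_def by simp
    have "vsub (ndual E) (?f x) (?f y) = (\<lambda>e\<in>carr E. ?d (T e))"
      using x y by (auto simp: vsub_def fun_eq_iff restrict_def Tm)
    then have "mdist (nmetric (ndual E)) (?f x) (?f y) = op_norm E scalars (\<lambda>e\<in>carr E. ?d (T e))"
      using mdist_nmetric[OF dE] fm[OF x] fm[OF y] by simp
    also have "\<dots> \<le> t * op_norm F scalars ?d" using adj[OF dm] by blast
    also have "op_norm F scalars ?d = mdist (nmetric (ndual F)) (g (h x)) (g (h y))"
      using mdist_nmetric[OF dF gg] by simp
    also have "t * \<dots> \<le> t * (C * (B * pdist X x y))"
    proof (rule mult_left_mono[OF _ tb(1)])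
      have "mdist (nmetric (ndual F)) (g (h x)) (g (h y)) \<le> C * pdist Y (h x) (h y)"
        using C(2) hm x y by blast
      also have "\<dots> \<le> C * (B * pdist X x y)"
        by (rule mult_left_mono) (use B(2) x y C(1) in auto)
      finally show "mdist (nmetric (ndual F)) (g (h x)) (g (h y)) \<le> C * (B * pdist X x y)" .
    qed
    finally show ?thesis by (simp only: mult.assoc)
  qed
  have b: "?f (base X) = (\<lambda>e\<in>carr E. 0)"
    using X h g Tm unfolding pointed_def lip0_def of_normed_def by auto
  show ?thesis
    unfolding lip0_def Lipschitz_continuous_map_def
    using fm d b by (auto simp: of_normed_def mspace_nmetric[OF dE])
qed

lemma tensor_map_elem:
  assumes "h \<in> lip0 X Y" and "pointed X" and "normed_sp E" and "normed_sp F"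
    and "T \<in> bounded_ops E F" and "x \<in> pts X" and "y \<in> pts X" and "e \<in> carr E"
  shows "tensor_map X E Y F h T (elem X E x y e) = elem Y F (h x) (h y) (T e)"
  unfolding tensor_map_def elem_def
  by (rule restrict_ext) (use assms lip0_precompose[of h X Y E F T] in simp)

end

theory Submission
  imports Defs
begin

text \<open>
  Both relations are instances of one statement about two Banach spaces \<open>F\<close> and \<open>G\<close> with a pairing
  \<open>B : F \<rightarrow> G\<^sup>*\<close> of norm at most 1: the pairs \<open>(F, G) = (E\<^sup>*, E)\<close> and \<open>(F, G) = (E, E\<^sup>*)\<close>. A map
  \<open>f \<in> Lip\<^sub>0(X, F)\<close> defines the functional \<open>\<phi>\<^sub>f : u \<mapsto> u (B \<circ> f)\<close> on \<open>X \<boxtimes> G\<close>, and the point is that \<open>f\<close>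
  belongs to \<open>A(X, F)\<close> if and only if \<open>\<phi>\<^sub>f\<close> is bounded for \<open>\<alpha>\<close>, with \<open>\<parallel>f\<parallel>\<^sub>A = \<parallel>\<phi>\<^sub>f\<parallel>\<close>
  (\<open>ideal_norm_eq_op_norm\<close>). The association of \<open>A\<close> with \<open>\<alpha>\<close> gives this for finite \<open>X\<close> and finite
  dimensions; one inequality reduces to that case on the side of the tensors, the other one on the side
  of the maps.

  The inequality \<open>\<parallel>\<phi>\<^sub>f\<parallel> \<le> \<parallel>f\<parallel>\<^sub>A\<close> holds because \<open>\<alpha>\<close> is finitely generated: a tensor lives on some
  \<open>X\<^sub>0 \<boxtimes> G\<^sub>0\<close> with \<open>X\<^sub>0\<close> finite and \<open>G\<^sub>0\<close> of finite dimension, at almost no cost in the norm, and there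
  only the restriction of \<open>B \<circ> f\<close> to \<open>X\<^sub>0\<close> and \<open>G\<^sub>0\<close> matters, which the ideal property controls
  (\<open>ideal_norm_bounds_functional\<close>).

  The inequality \<open>\<parallel>f\<parallel>\<^sub>A \<le> \<parallel>\<phi>\<^sub>f\<parallel>\<close> holds because \<open>A\<close> is maximal: one has to bound the maps
  \<open>Q \<circ> f \<circ> I\<close> into finite-dimensional quotients \<open>F/L\<close>. Association expresses their norms by
  functionals on \<open>Y \<boxtimes> (F/L)\<^sup>*\<close>, and the adjoint \<open>Q\<^sup>* : (F/L)\<^sup>* \<rightarrow> F\<^sup>*\<close> carries the tensors to
  \<open>X \<boxtimes> F\<^sup>*\<close> (\<open>functional_bounds_ideal_norm\<close>). For \<open>F = E\<close> this is \<open>X \<boxtimes> G\<close> and nothing is left to do. For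
  \<open>F = E\<^sup>*\<close> one arrives at \<open>X \<boxtimes> E\<^sup>*\<^sup>*\<close> and has to get back to \<open>X \<boxtimes> E\<close>. This is what local
  reflexivity is for; the weak form proved here (\<open>local_reflexivity\<close>) replaces an operator into
  \<open>E\<^sup>*\<^sup>*\<close> by operators into \<open>E\<close> as long as only finitely many elements of \<open>E\<^sup>*\<close> are tested, and rests on
  the Hahn--Banach theorem in a finite power of \<open>E\<close>.

  It remains to see that every bounded functional on \<open>X \<boxtimes>\<^sub>\<alpha> E\<close> is some \<open>\<phi>\<^sub>f\<close>, because \<open>\<alpha>\<close> is a
  cross-norm (\<open>functional_is_evaluation\<close>), and that passing to the completion does not change the
  dual (\<open>completion_dual\<close>).

  To apply the association, the dual of a finite-dimensional space must be carried by the same type.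
  A basis provides a symmetric form that identifies the space with its dual linearly, so that the
  space itself with another norm is a copy of its dual, and conversely (\<open>fin_dim_dual_pair\<close>).
\<close>

section \<open>The scalar field\<close>

text \<open>
  The embedding fixes the real numbers because it is isometric: the distances of a complex number
  from 0 and from 1 being \<open>\<bar>r\<bar>\<close> and \<open>\<bar>r - 1\<bar>\<close> forces it to be \<open>r\<close>.
\<close>

lemma real_or_complex_embedding:
  "\<exists>\<phi> :: 'k::real_or_complex \<Rightarrow> complex.
     (\<forall>x y. \<phi> (x + y) = \<phi> x + \<phi> y) \<and> (\<forall>x y. \<phi> (x * y) = \<phi> x * \<phi> y) \<and>
     (\<forall>x y. \<phi> (x - y) = \<phi> x - \<phi> y) \<and> (\<forall>x. norm (\<phi> x) = norm x) \<and>
     (\<forall>r. \<phi> (of_real r) = of_real r) \<and> inj \<phi> \<and> (range \<phi> = \<real> \<or> range \<phi> = UNIV)"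
proof -
  obtain \<phi> :: "'k \<Rightarrow> complex" where add: "\<And>x y. \<phi> (x + y) = \<phi> x + \<phi> y"
    and mult: "\<And>x y. \<phi> (x * y) = \<phi> x * \<phi> y" and n: "\<And>x. norm (\<phi> x) = norm x"
    and ran: "range \<phi> = \<real> \<or> range \<phi> = UNIV"
    using real_or_complex by blast
  have diff: "\<phi> (x - y) = \<phi> x - \<phi> y" for x y
    using add[of "x - y" y] by simp
  have inj: "inj \<phi>"
  proof (rule injI)
    fix x y assume "\<phi> x = \<phi> y"
    then have "norm (x - y) = 0" using n[of "x - y"] diff by simp
    then show "x = y" by simp
  qed
  have one: "\<phi> 1 = 1"
  proof -
    have "\<phi> 1 * \<phi> 1 = \<phi> 1" using mult[of 1 1] by simp
    moreover have "\<phi> 1 \<noteq> 0" using n[of 1] by auto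
    ultimately show ?thesis by simp
  qed
  have real: "\<phi> (of_real r) = of_real r" for r
  proof -
    let ?z = "\<phi> (of_real r)"
    have "\<phi> (of_real (r - 1)) = ?z - 1" using diff[of "of_real r" 1] one by simp
    then have "norm ?z = \<bar>r\<bar>" "norm (?z - 1) = \<bar>r - 1\<bar>"
      using n[of "of_real r"] n[of "of_real (r - 1)"] by (simp_all only: norm_of_real)
    then have "(norm ?z)\<^sup>2 = r\<^sup>2" "(norm (?z - 1))\<^sup>2 = (r - 1)\<^sup>2" by simp_all
    then have 1: "(Re ?z)\<^sup>2 + (Im ?z)\<^sup>2 = r\<^sup>2" "(Re ?z - 1)\<^sup>2 + (Im ?z)\<^sup>2 = (r - 1)\<^sup>2"
      by (simp_all add: cmod_power2)
    then have "Re ?z = r" by (simp add: power2_eq_square algebra_simps)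
    with 1 show ?thesis by (simp add: complex_eq_iff)
  qed
  show ?thesis using add mult diff n real inj ran by blast
qed

text \<open>
  The last condition recovers a scalar from real parts, and with it a linear functional from its real
  part. It covers both fields at once: \<open>i\<close> is an imaginary unit over the complex numbers and \<open>0\<close>
  over the reals.
\<close>

definition is_real_part :: "('k::real_or_complex \<Rightarrow> real) \<Rightarrow> 'k \<Rightarrow> bool" where
  "is_real_part re i \<longleftrightarrow>
     (\<forall>x y. re (x + y) = re x + re y) \<and> (\<forall>r x. re (of_real r * x) = r * re x) \<and>
     (\<forall>x. re x \<le> norm x) \<and> re 1 = 1 \<and> re i = 0 \<and> (i = 0 \<or> i * i = - 1) \<and>
     (\<forall>x. x = of_real (re x) - of_real (re (i * x)) * i)"

lemma real_part: "\<exists>(re :: 'k::real_or_complex \<Rightarrow> real) i. is_real_part re i"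
proof -
  obtain \<phi> :: "'k \<Rightarrow> complex" where add: "\<And>x y. \<phi> (x + y) = \<phi> x + \<phi> y"
    and mult: "\<And>x y. \<phi> (x * y) = \<phi> x * \<phi> y" and diff: "\<And>x y. \<phi> (x - y) = \<phi> x - \<phi> y"
    and n: "\<And>x. norm (\<phi> x) = norm x" and real: "\<And>r. \<phi> (of_real r) = of_real r"
    and inj: "inj \<phi>" and ran: "range \<phi> = \<real> \<or> range \<phi> = UNIV"
    using real_or_complex_embedding by blast
  let ?re = "\<lambda>x. Re (\<phi> x)"
  have ex: "\<exists>i. Re (\<phi> i) = 0 \<and> (i = 0 \<or> i * i = - 1) \<and>
      (\<forall>x. x = of_real (?re x) - of_real (?re (i * x)) * i)"
  proof (cases "range \<phi> = \<real>")
    case True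
    have "of_real (?re x) = x" for x
    proof -
      have "\<phi> x \<in> \<real>" using True by blast
      then have "\<phi> (of_real (?re x)) = \<phi> x" by (simp add: real)
      then show ?thesis using inj by (simp only: inj_eq)
    qed
    moreover have "\<phi> 0 = 0" using real[of 0] by simp
    ultimately show ?thesis by (intro exI[of _ 0]) auto
  next
    case False
    then have "\<i> \<in> range \<phi>" using ran by auto
    then obtain i where i: "\<phi> i = \<i>" by (metis rangeE)
    have "\<phi> (i * i) = \<phi> (- 1)" using real[of "- 1"] by (simp add: mult i)
    then have "i * i = - 1" using inj by (simp only: inj_eq)
    moreover have "of_real (?re x) - of_real (?re (i * x)) * i = x" for x
    proof -
      have "\<phi> (of_real (?re x) - of_real (?re (i * x)) * i) = \<phi> x"
        by (simp add: add diff mult real i complex_eq_iff)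
      then show ?thesis using inj by (simp only: inj_eq)
    qed
    ultimately show ?thesis using i by (intro exI[of _ i]) auto
  qed
  have "?re x \<le> norm x" for x using complex_Re_le_cmod[of "\<phi> x"] n by simp
  moreover have "?re 1 = 1" using real[of 1] by simp
  moreover from ex obtain i where "Re (\<phi> i) = 0" "i = 0 \<or> i * i = - 1"
      "\<And>x. x = of_real (?re x) - of_real (?re (i * x)) * i" by blast
  ultimately show ?thesis unfolding is_real_part_def using add mult real by (intro exI[of _ ?re] exI[of _ i]) simp
qed

lemma real_or_complex_Cauchy_convergent:
  fixes s :: "nat \<Rightarrow> 'k::real_or_complex"
  assumes "Cauchy s"
  obtains l where "s \<longlonglongrightarrow> l"
proof -
  obtain \<phi> :: "'k \<Rightarrow> complex" where add: "\<And>x y. \<phi> (x + y) = \<phi> x + \<phi> y"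
    and mult: "\<And>x y. \<phi> (x * y) = \<phi> x * \<phi> y" and diff: "\<And>x y. \<phi> (x - y) = \<phi> x - \<phi> y"
    and n: "\<And>x. norm (\<phi> x) = norm x" and real: "\<And>r. \<phi> (of_real r) = of_real r"
    and inj: "inj \<phi>" and ran: "range \<phi> = \<real> \<or> range \<phi> = UNIV"
    using real_or_complex_embedding by blast
  have d: "dist (\<phi> x) (\<phi> y) = dist x y" for x y
    using n[of "x - y"] diff by (simp add: dist_norm)
  have "Cauchy (\<lambda>n. \<phi> (s n))" using assms by (simp add: Cauchy_def d)
  then obtain z where z: "(\<lambda>n. \<phi> (s n)) \<longlonglongrightarrow> z"
    using Cauchy_convergent convergent_def by blast
  have "closed (range \<phi>)" using ran closed_complex_Reals by auto
  then have "z \<in> range \<phi>" using closed_sequentially[of "range \<phi>" "\<lambda>n. \<phi> (s n)" z] z by simp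
  then obtain l where "z = \<phi> l" by blast
  then have "s \<longlonglongrightarrow> l" using z by (simp add: tendsto_iff d)
  then show ?thesis using that by blast
qed

lemma real_or_complex_finite_net:
  assumes "0 < \<delta>"
  obtains N :: "'k::real_or_complex set"
  where "finite N" "\<And>c. norm c \<le> M \<Longrightarrow> \<exists>d\<in>N. norm (c - d) < \<delta>"
proof -
  obtain \<phi> :: "'k \<Rightarrow> complex" where add: "\<And>x y. \<phi> (x + y) = \<phi> x + \<phi> y"
    and mult: "\<And>x y. \<phi> (x * y) = \<phi> x * \<phi> y" and diff: "\<And>x y. \<phi> (x - y) = \<phi> x - \<phi> y"
    and n: "\<And>x. norm (\<phi> x) = norm x" and real: "\<And>r. \<phi> (of_real r) = of_real r"
    and inj: "inj \<phi>" and ran: "range \<phi> = \<real> \<or> range \<phi> = UNIV"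
    using real_or_complex_embedding by blast
  have "closed (range \<phi>)" using ran closed_complex_Reals by auto
  then have "compact (cball 0 M \<inter> range \<phi>)" by (simp add: compact_Int_closed)
  then obtain K where K: "finite K" "K \<subseteq> cball 0 M \<inter> range \<phi>"
      "cball 0 M \<inter> range \<phi> \<subseteq> (\<Union>z\<in>K. ball z \<delta>)"
    using assms seq_compact_imp_totally_bounded[of "cball 0 M \<inter> range \<phi>"] compact_imp_seq_compact
    by metis
  obtain N where N: "finite N" "K = \<phi> ` N"
    using K(1,2) finite_subset_image[of K \<phi> UNIV] by auto
  have "\<exists>d\<in>N. norm (c - d) < \<delta>" if c: "norm c \<le> M" for c
  proof -
    have "\<phi> c \<in> cball 0 M \<inter> range \<phi>" using c n by simp
    then obtain d where "d \<in> N" "dist (\<phi> d) (\<phi> c) < \<delta>" using K(3) N(2) by auto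
    then show ?thesis using n[of "c - d"] diff by (auto simp: dist_norm norm_minus_commute)
  qed
  then show ?thesis using N(1) that by blast
qed

section \<open>Vector spaces with a carrier\<close>

locale vspace =
  fixes V :: "('k::real_or_complex, 'a) nspace"
  assumes vector_sp: "vector_sp V"
begin

abbreviation vplus (infixl "\<oplus>" 65) where "x \<oplus> y \<equiv> vadd V x y"
abbreviation vtimes (infixr "\<odot>" 75) where "c \<odot> x \<equiv> vscale V c x"
abbreviation vnull ("\<zero>") where "\<zero> \<equiv> vzero V"

lemma zero_closed [simp]: "\<zero> \<in> carr V"
  and add_closed [simp]: "x \<in> carr V \<Longrightarrow> y \<in> carr V \<Longrightarrow> x \<oplus> y \<in> carr V"
  and scale_closed [simp]: "x \<in> carr V \<Longrightarrow> c \<odot> x \<in> carr V"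
  and scale_one [simp]: "x \<in> carr V \<Longrightarrow> 1 \<odot> x = x"
  and scale_add: "x \<in> carr V \<Longrightarrow> y \<in> carr V \<Longrightarrow> c \<odot> (x \<oplus> y) = c \<odot> x \<oplus> c \<odot> y"
  and scale_left: "x \<in> carr V \<Longrightarrow> (b + c) \<odot> x = b \<odot> x \<oplus> c \<odot> x"
  and scale_scale [simp]: "x \<in> carr V \<Longrightarrow> b \<odot> c \<odot> x = (b * c) \<odot> x"
  using vector_sp unfolding vector_sp_def by simp_all

lemma zero_left [simp]: "x \<in> carr V \<Longrightarrow> \<zero> \<oplus> x = x"
  using vector_sp unfolding vector_sp_def by blast

lemma sub_self [simp]: "x \<in> carr V \<Longrightarrow> vsub V x x = \<zero>"
  using vector_sp unfolding vector_sp_def by blast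

lemma sub_closed [simp]: "x \<in> carr V \<Longrightarrow> y \<in> carr V \<Longrightarrow> vsub V x y \<in> carr V"
  by (simp add: vsub_def)

lemma add_comm: "x \<in> carr V \<Longrightarrow> y \<in> carr V \<Longrightarrow> x \<oplus> y = y \<oplus> x"
  using vector_sp unfolding vector_sp_def by blast

lemma add_assoc: "x \<in> carr V \<Longrightarrow> y \<in> carr V \<Longrightarrow> z \<in> carr V \<Longrightarrow> (x \<oplus> y) \<oplus> z = x \<oplus> (y \<oplus> z)"
  using vector_sp unfolding vector_sp_def by blast

lemma add_lcomm: "x \<in> carr V \<Longrightarrow> y \<in> carr V \<Longrightarrow> z \<in> carr V \<Longrightarrow> x \<oplus> (y \<oplus> z) = y \<oplus> (x \<oplus> z)"
  by (metis add_assoc add_comm)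

lemmas add_ac = add_assoc add_comm add_lcomm

lemma zero_right [simp]: "x \<in> carr V \<Longrightarrow> x \<oplus> \<zero> = x"
  using add_comm[of x \<zero>] by simp

lemma scale_zero_left [simp]: "x \<in> carr V \<Longrightarrow> 0 \<odot> x = \<zero>"
  using scale_left[of x 1 "- 1"] sub_self[of x] by (simp add: vsub_def)

lemma scale_zero_right [simp]: "c \<odot> \<zero> = \<zero>"
  using scale_scale[of \<zero> c 0] by simp

lemma add_neg [simp]: "x \<in> carr V \<Longrightarrow> x \<oplus> (- 1) \<odot> x = \<zero>"
  using sub_self[of x] by (simp add: vsub_def)

lemma sub_zero [simp]: "x \<in> carr V \<Longrightarrow> vsub V x \<zero> = x"
  by (simp add: vsub_def)

lemma sub_add_cancel: "x \<in> carr V \<Longrightarrow> y \<in> carr V \<Longrightarrow> vsub V x y \<oplus> y = x"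
  using vsub_split[OF vector_sp, of x y \<zero>] by simp

lemma add_sub_cancel: "x \<in> carr V \<Longrightarrow> y \<in> carr V \<Longrightarrow> vsub V (x \<oplus> y) y = x"
  by (simp add: vsub_def add_assoc)

lemma sub_add_sub: "\<lbrakk>x \<in> carr V; y \<in> carr V; u \<in> carr V; v \<in> carr V\<rbrakk> \<Longrightarrow>
    vsub V (x \<oplus> y) (u \<oplus> v) = vsub V x u \<oplus> vsub V y v"
  by (simp add: vsub_def scale_add add_ac)

lemma scale_sub: "x \<in> carr V \<Longrightarrow> y \<in> carr V \<Longrightarrow> c \<odot> vsub V x y = vsub V (c \<odot> x) (c \<odot> y)"
  by (simp add: vsub_def scale_add mult.commute)

lemma vsubspace_closed:
  assumes "vsubspace V W" and "x \<in> W"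
  shows "x \<in> carr V" "y \<in> W \<Longrightarrow> x \<oplus> y \<in> W" "c \<odot> x \<in> W" "y \<in> W \<Longrightarrow> vsub V x y \<in> W"
  using assms unfolding vsubspace_def vsub_def by auto

lemma subsp_vector_sp:
  assumes "vsubspace V W"
  shows "vector_sp (subsp V W)"
proof -
  note c = vsubspace_closed[OF assms]
  have "\<zero> \<in> W" using assms unfolding vsubspace_def by blast
  then show ?thesis
    unfolding vector_sp_def subsp_def vsub_def using c
    by (auto simp: add_assoc scale_add scale_left intro: add_comm)
qed

end

lemma linear_map_simps:
  assumes "linear_map V W T"
  shows "x \<in> carr V \<Longrightarrow> T x \<in> carr W"
    and "x \<in> carr V \<Longrightarrow> y \<in> carr V \<Longrightarrow> T (vadd V x y) = vadd W (T x) (T y)"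
    and "x \<in> carr V \<Longrightarrow> T (vscale V c x) = vscale W c (T x)"
  using assms unfolding linear_map_def by auto

lemma (in vspace) linear_map_sub:
  assumes "linear_map V W T" "x \<in> carr V" "y \<in> carr V"
  shows "T (vsub V x y) = vsub W (T x) (T y)"
  using assms by (simp add: vsub_def linear_map_simps[OF assms(1)])

lemma (in vspace) linear_map_zero:
  assumes "linear_map V W T" "vector_sp W"
  shows "T \<zero> = vzero W"
proof -
  interpret W: vspace W using assms(2) by unfold_locales
  have "T (0 \<odot> \<zero>) = vscale W 0 (T \<zero>)" by (rule linear_map_simps[OF assms(1)]) simp
  then show ?thesis using linear_map_simps(1)[OF assms(1), of \<zero>] by simp
qed

lemma vector_sp_scalars: "vector_sp scalars"
  unfolding vector_sp_def vsub_def by (auto simp: algebra_simps)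

lemma vsub_scalars [simp]: "vsub scalars x y = x - y"
  by (simp add: vsub_def)

section \<open>The Hahn--Banach theorem\<close>

context vspace
begin

definition sublinear :: "('a \<Rightarrow> real) \<Rightarrow> bool" where
  "sublinear q \<longleftrightarrow> (\<forall>x\<in>carr V. \<forall>y\<in>carr V. q (x \<oplus> y) \<le> q x + q y) \<and>
     (\<forall>r\<ge>0. \<forall>x\<in>carr V. q (of_real r \<odot> x) = r * q x)"

lemma sublinearD:
  assumes "sublinear q" and "x \<in> carr V"
  shows "y \<in> carr V \<Longrightarrow> q (x \<oplus> y) \<le> q x + q y"
    and "0 \<le> r \<Longrightarrow> q (of_real r \<odot> x) = r * q x"
    and "q \<zero> = 0" and "- q ((- 1) \<odot> x) \<le> q x"
proof -
  show a: "y \<in> carr V \<Longrightarrow> q (x \<oplus> y) \<le> q x + q y"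
    and "0 \<le> r \<Longrightarrow> q (of_real r \<odot> x) = r * q x" for y r
    using assms unfolding sublinear_def by blast+
  have "q (of_real 0 \<odot> \<zero>) = 0 * q \<zero>"
    using assms(1) zero_closed unfolding sublinear_def by (meson order_refl)
  then show z: "q \<zero> = 0" by simp
  show "- q ((- 1) \<odot> x) \<le> q x" using a[of "(- 1) \<odot> x"] assms(2) z by simp
qed

text \<open>
  One inequality suffices for positive homogeneity, as it applies to \<open>1/r\<close> too. At the null vector,
  \<open>q 0 \<le> q 0 / 2\<close> and \<open>q 0 \<le> q 0 + q 0\<close>.
\<close>

lemma sublinearI:
  assumes add: "\<And>x y. x \<in> carr V \<Longrightarrow> y \<in> carr V \<Longrightarrow> q (x \<oplus> y) \<le> q x + q y"
    and scale: "\<And>r x. 0 < r \<Longrightarrow> x \<in> carr V \<Longrightarrow> q (of_real r \<odot> x) \<le> r * q x"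
  shows "sublinear q"
  unfolding sublinear_def
proof (intro conjI ballI allI impI)
  fix r :: real and x assume r: "0 \<le> r" and x: "x \<in> carr V"
  show "q (of_real r \<odot> x) = r * q x"
  proof (cases "r = 0")
    case True
    have "q \<zero> = 0" using add[of \<zero> \<zero>] scale[of "1 / 2" \<zero>] by simp
    then show ?thesis using True x by simp
  next
    case False
    then have r: "0 < r" using r by simp
    have "of_real (inverse r) \<odot> of_real r \<odot> x = x" using r x by (simp flip: of_real_mult)
    then have "q x \<le> inverse r * q (of_real r \<odot> x)"
      using scale[of "inverse r" "of_real r \<odot> x"] r x by simp
    then have "r * q x \<le> q (of_real r \<odot> x)" using r by (simp add: field_simps)
    then show ?thesis using scale[OF r x] by simp
  qed
qed (rule add)

text \<open>
  For \<open>y \<in> V\<close> the functional \<open>q\<^sub>y x = inf {q (x + t y) - t q y | t \<ge> 0}\<close> is sublinear and lies below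
  \<open>q\<close>. If \<open>q\<close> is minimal, then \<open>q \<le> q\<^sub>y\<close>, and \<open>t = 1\<close> gives \<open>q x + q y \<le> q (x + y)\<close>: a minimal
  sublinear functional is additive.
\<close>

lemma minimal_sublinear_additive:
  assumes q: "sublinear q"
    and min: "\<And>q'. sublinear q' \<Longrightarrow> (\<And>x. x \<in> carr V \<Longrightarrow> q' x \<le> q x) \<Longrightarrow>
      x \<in> carr V \<Longrightarrow> q x \<le> q' x"
    and x: "x \<in> carr V" and y: "y \<in> carr V"
  shows "q (x \<oplus> y) = q x + q y"
proof -
  define g where "g t z = q (z \<oplus> of_real t \<odot> y) - t * q y" for t z
  define q' where "q' z = (INF t\<in>{0..}. g t z)" for z
  have lower: "- q ((- 1) \<odot> z) \<le> g t z" if "z \<in> carr V" "0 \<le> t" for z t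
  proof -
    have "t * q y = q (((- 1) \<odot> z) \<oplus> (z \<oplus> of_real t \<odot> y))"
      using sublinearD(2)[OF q y that(2)] that y
      by (simp add: add_assoc[symmetric] add_comm[of "(- 1) \<odot> z" z])
    also have "\<dots> \<le> q ((- 1) \<odot> z) + q (z \<oplus> of_real t \<odot> y)"
      using sublinearD(1)[OF q] that y by simp
    finally show ?thesis by (simp add: g_def)
  qed
  have bdd: "bdd_below ((\<lambda>t. g t z) ` {0..})" if "z \<in> carr V" for z
    using lower[OF that] by (intro bdd_belowI2[where m = "- q ((- 1) \<odot> z)"]) auto
  have q'_le: "q' z \<le> g t z" if "z \<in> carr V" "0 \<le> t" for z t
    unfolding q'_def using bdd[OF that(1)] that by (intro cINF_lower) auto
  have q'_ge: "a \<le> q' z" if "\<And>t. 0 \<le> t \<Longrightarrow> a \<le> g t z" for a z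
    unfolding q'_def using that by (intro cINF_greatest) auto
  have "sublinear q'"
  proof (rule sublinearI)
    fix u v assume uv: "u \<in> carr V" "v \<in> carr V"
    have "q' (u \<oplus> v) \<le> g s u + g t v" if st: "0 \<le> s" "0 \<le> t" for s t
    proof -
      have "q' (u \<oplus> v) \<le> g (s + t) (u \<oplus> v)" using q'_le uv st by simp
      moreover have "(u \<oplus> v) \<oplus> of_real (s + t) \<odot> y = (u \<oplus> of_real s \<odot> y) \<oplus> (v \<oplus> of_real t \<odot> y)"
        using uv y by (simp add: scale_left add_ac)
      moreover have "q ((u \<oplus> of_real s \<odot> y) \<oplus> (v \<oplus> of_real t \<odot> y))
          \<le> q (u \<oplus> of_real s \<odot> y) + q (v \<oplus> of_real t \<odot> y)"
        using sublinearD(1)[OF q] uv y by simp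
      ultimately show ?thesis by (simp add: g_def algebra_simps)
    qed
    then have "q' (u \<oplus> v) - g t v \<le> q' u" if "0 \<le> t" for t
      using that by (intro q'_ge) (simp add: algebra_simps)
    then have "q' (u \<oplus> v) - q' u \<le> q' v"
      by (intro q'_ge) (simp add: algebra_simps)
    then show "q' (u \<oplus> v) \<le> q' u + q' v" by simp
  next
    fix r :: real and u assume r: "0 < r" and u: "u \<in> carr V"
    have "q' (of_real r \<odot> u) \<le> r * g t u" if t: "0 \<le> t" for t
    proof -
      have "of_real r \<odot> u \<oplus> of_real (r * t) \<odot> y = of_real r \<odot> (u \<oplus> of_real t \<odot> y)"
        using u y by (simp add: scale_add)
      then have "g (r * t) (of_real r \<odot> u) = r * g t u"
        using sublinearD(2)[OF q, of "u \<oplus> of_real t \<odot> y" r] u y r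
        by (simp add: g_def algebra_simps)
      then show ?thesis using q'_le[of "of_real r \<odot> u" "r * t"] r u t by simp
    qed
    then have "q' (of_real r \<odot> u) / r \<le> q' u"
      by (intro q'_ge) (simp add: pos_divide_le_eq[OF r] mult.commute)
    then show "q' (of_real r \<odot> u) \<le> r * q' u" by (simp add: pos_divide_le_eq[OF r] mult.commute)
  qed
  moreover have "q' z \<le> q z" if "z \<in> carr V" for z
    using q'_le[OF that, of 0] that y by (simp add: g_def)
  ultimately have "q x \<le> q' x" using min x by blast
  also have "\<dots> \<le> q (x \<oplus> y) - q y" using q'_le[OF x, of 1] y by (simp add: g_def)
  finally show ?thesis using sublinearD(1)[OF q x y] by simp
qed

text \<open>
  The infimum is finite because \<open>q x \<ge> - q (- x) \<ge> - p (- x)\<close>. It is subadditive because the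
  smaller one of two members of the chain bounds the infimum at both points at once.
\<close>

lemma chain_inf_sublinear:
  assumes p: "\<And>q. q \<in> C \<Longrightarrow> sublinear q \<and> (\<forall>x\<in>carr V. q x \<le> p x)" and ne: "C \<noteq> {}"
    and chain: "\<And>q q'. q \<in> C \<Longrightarrow> q' \<in> C \<Longrightarrow> (\<forall>x\<in>carr V. q x \<le> q' x) \<or> (\<forall>x\<in>carr V. q' x \<le> q x)"
  shows "sublinear (\<lambda>x. INF q\<in>C. q x)" and "q \<in> C \<Longrightarrow> x \<in> carr V \<Longrightarrow> (INF q\<in>C. q x) \<le> q x"
proof -
  have bdd: "bdd_below ((\<lambda>q. q x) ` C)" if x: "x \<in> carr V" for x
  proof (rule bdd_belowI2[where m = "- p ((- 1) \<odot> x)"])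
    fix q assume "q \<in> C"
    then show "- p ((- 1) \<odot> x) \<le> q x"
      using p[of q] sublinearD(4)[of q x] x by (smt (verit) scale_closed)
  qed
  show le: "(INF q\<in>C. q x) \<le> q x" if "q \<in> C" "x \<in> carr V" for q x
    using bdd[OF that(2)] that(1) by (rule cINF_lower)
  show "sublinear (\<lambda>x. INF q\<in>C. q x)"
  proof (rule sublinearI)
    fix x y assume xy: "x \<in> carr V" "y \<in> carr V"
    have "(INF q\<in>C. q (x \<oplus> y)) \<le> q1 x + q2 y" if q: "q1 \<in> C" "q2 \<in> C" for q1 q2
    proof -
      obtain q3 where q3: "q3 \<in> C" "q3 x \<le> q1 x" "q3 y \<le> q2 y"
        using chain[OF q] q xy by (metis order_refl)
      have "(INF q\<in>C. q (x \<oplus> y)) \<le> q3 (x \<oplus> y)" using le q3 xy by simp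
      also have "\<dots> \<le> q3 x + q3 y" using p[OF q3(1)] sublinearD(1) xy by blast
      finally show ?thesis using q3 by simp
    qed
    then have "(INF q\<in>C. q (x \<oplus> y)) - q2 y \<le> (INF q\<in>C. q x)" if "q2 \<in> C" for q2
      using that by (intro cINF_greatest[OF ne]) (simp add: algebra_simps)
    then have "(INF q\<in>C. q (x \<oplus> y)) - (INF q\<in>C. q x) \<le> (INF q\<in>C. q y)"
      by (intro cINF_greatest[OF ne]) (simp add: algebra_simps)
    then show "(INF q\<in>C. q (x \<oplus> y)) \<le> (INF q\<in>C. q x) + (INF q\<in>C. q y)" by simp
  next
    fix r :: real and x assume r: "0 < r" and x: "x \<in> carr V"
    have "(INF q\<in>C. q (of_real r \<odot> x)) \<le> r * q x" if q: "q \<in> C" for q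
      using le[OF q, of "of_real r \<odot> x"] sublinearD(2)[of q x r] p[OF q] r x by simp
    then have "(INF q\<in>C. q (of_real r \<odot> x)) / r \<le> (INF q\<in>C. q x)"
      by (intro cINF_greatest[OF ne]) (simp add: pos_divide_le_eq[OF r] mult.commute)
    then show "(INF q\<in>C. q (of_real r \<odot> x)) \<le> r * (INF q\<in>C. q x)"
      by (simp add: pos_divide_le_eq[OF r] mult.commute)
  qed
qed

text \<open>By Zorn's lemma there is a minimal sublinear functional below \<open>p\<close>, and it is linear.\<close>

lemma sublinear_dominates_real_linear:
  assumes p: "sublinear p"
  obtains L where "\<And>x y. x \<in> carr V \<Longrightarrow> y \<in> carr V \<Longrightarrow> L (x \<oplus> y) = L x + L y"
    and "\<And>r x. x \<in> carr V \<Longrightarrow> L (of_real r \<odot> x) = r * L x"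
    and "\<And>x. x \<in> carr V \<Longrightarrow> L x \<le> p x"
proof -
  define S where "S = {q \<in> extensional (carr V). sublinear q \<and> (\<forall>x\<in>carr V. q x \<le> p x)}"
  define P where "P q q' \<longleftrightarrow> (\<forall>x\<in>carr V. q' x \<le> q x)" for q q' :: "'a \<Rightarrow> real"
  have restr: "restrict q (carr V) \<in> S" if "sublinear q" "\<And>x. x \<in> carr V \<Longrightarrow> q x \<le> p x" for q
    using that unfolding S_def sublinear_def by auto
  have "\<exists>m\<in>S. \<forall>a\<in>S. P m a \<longrightarrow> a = m"
  proof (rule predicate_Zorn)
    show "partial_order_on S (relation_of P S)"
    proof (rule partial_order_on_relation_ofI)
      show "P a a" for a by (simp add: P_def)
      show "P a c" if "a \<in> S" "b \<in> S" "c \<in> S" "P a b" "P b c" for a b c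
        using that unfolding P_def by (meson order_trans)
      show "a = b" if "a \<in> S" "b \<in> S" "P a b" "P b a" for a b
        using that unfolding P_def S_def
        by (intro extensionalityI[of _ "carr V"]) (auto intro: antisym)
    qed
    fix C assume C: "C \<in> Chains (relation_of P S)"
    then have CS: "C \<subseteq> S" unfolding Chains_def relation_of_def by auto
    show "\<exists>u\<in>S. \<forall>a\<in>C. P a u"
    proof (cases "C = {}")
      case True
      then show ?thesis using restr[OF p] by blast
    next
      case False
      have C1: "sublinear q \<and> (\<forall>x\<in>carr V. q x \<le> p x)" if "q \<in> C" for q
        using CS that unfolding S_def by blast
      have C2: "(\<forall>x\<in>carr V. q x \<le> q' x) \<or> (\<forall>x\<in>carr V. q' x \<le> q x)" if "q \<in> C" "q' \<in> C" for q q'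
        using C that unfolding Chains_def relation_of_def P_def by auto
      obtain q0 where q0: "q0 \<in> C" using False by blast
      let ?u = "\<lambda>x. INF q\<in>C. q x"
      have inf: "sublinear ?u" "q \<in> C \<Longrightarrow> x \<in> carr V \<Longrightarrow> ?u x \<le> q x" for q x
        using chain_inf_sublinear[of C p] C1 C2 False by blast+
      have "?u x \<le> p x" if "x \<in> carr V" for x
        using inf(2)[OF q0 that] C1[OF q0] that by fastforce
      then have "restrict ?u (carr V) \<in> S" using restr[OF inf(1)] by blast
      moreover have "\<forall>a\<in>C. P a (restrict ?u (carr V))" using inf(2) by (simp add: P_def)
      ultimately show ?thesis by blast
    qed
  qed
  then obtain q where q: "q \<in> S" and min: "\<And>a. a \<in> S \<Longrightarrow> P q a \<Longrightarrow> a = q" by blast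
  have sq: "sublinear q" and qp: "\<And>x. x \<in> carr V \<Longrightarrow> q x \<le> p x" using q unfolding S_def by auto
  have "q x \<le> q' x" if "sublinear q'" "\<And>x. x \<in> carr V \<Longrightarrow> q' x \<le> q x" "x \<in> carr V" for q' x
  proof -
    have "restrict q' (carr V) \<in> S" using restr[OF that(1)] that(2) qp order_trans by blast
    moreover have "P q (restrict q' (carr V))" using that(2) by (simp add: P_def)
    ultimately have "restrict q' (carr V) = q" using min by blast
    then show ?thesis using that(3) by (metis order_refl restrict_apply')
  qed
  then have add: "q (x \<oplus> y) = q x + q y" if "x \<in> carr V" "y \<in> carr V" for x y
    using minimal_sublinear_additive[OF sq] that by blast
  have "q (of_real r \<odot> x) = r * q x" if x: "x \<in> carr V" for r x
  proof (cases "0 \<le> r")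
    case True
    then show ?thesis using sublinearD(2)[OF sq x] by blast
  next
    case False
    have "of_real r \<odot> x \<oplus> of_real (- r) \<odot> x = \<zero>" using x by (simp flip: scale_left)
    then have "q (of_real r \<odot> x) + q (of_real (- r) \<odot> x) = 0"
      using add[of "of_real r \<odot> x" "of_real (- r) \<odot> x"] sublinearD(3)[OF sq x] x by simp
    then show ?thesis using sublinearD(2)[OF sq x, of "- r"] False by simp
  qed
  then show ?thesis using that[of q] add qp by blast
qed

text \<open>
  A real-linear functional \<open>L\<close> below the sublinear functional \<open>x \<mapsto> inf {p (x - w) + re (k w) | w \<in> W}\<close>
  lies below \<open>p\<close> and agrees on \<open>W\<close> with the real part of \<open>k\<close>; it is the real part of the linear
  functional \<open>l\<close> with \<open>l x = L x - L (i x) i\<close>.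
\<close>

theorem hahn_banach:
  assumes pt: "\<And>x y. x \<in> carr V \<Longrightarrow> y \<in> carr V \<Longrightarrow> p (x \<oplus> y) \<le> p x + p y"
    and ph: "\<And>c x. x \<in> carr V \<Longrightarrow> p (c \<odot> x) = norm c * p x"
    and W: "vsubspace V W"
    and add0: "\<And>x y. x \<in> W \<Longrightarrow> y \<in> W \<Longrightarrow> k (x \<oplus> y) = k x + k y"
    and scale0: "\<And>c x. x \<in> W \<Longrightarrow> k (c \<odot> x) = c * k x"
    and le0: "\<And>x. x \<in> W \<Longrightarrow> norm (k x) \<le> p x"
  obtains l where "\<And>x y. x \<in> carr V \<Longrightarrow> y \<in> carr V \<Longrightarrow> l (x \<oplus> y) = l x + l y"
    and "\<And>c x. x \<in> carr V \<Longrightarrow> l (c \<odot> x) = c * l x"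
    and "\<And>x. x \<in> W \<Longrightarrow> l x = k x" and "\<And>x. x \<in> carr V \<Longrightarrow> norm (l x) \<le> p x"
proof -
  note Wc = vsubspace_closed[OF W]
  have W0: "\<zero> \<in> W" using W unfolding vsubspace_def by blast
  obtain re :: "'k \<Rightarrow> real" and i where R: "is_real_part re i"
    using real_part by blast
  have re_add: "re (x + y) = re x + re y" and re_scale: "re (of_real r * x) = r * re x"
    and re_le: "re x \<le> norm x" and re1: "re 1 = 1" and rei: "re i = 0"
    and i: "i = 0 \<or> i * i = - 1" and dec: "x = of_real (re x) - of_real (re (i * x)) * i" for r x y
    using R unfolding is_real_part_def by (blast dest: spec)+
  have re_of_real: "re (of_real r) = r" for r using re_scale[of r 1] re1 by simp
  have p0: "p \<zero> = 0" using ph[of \<zero> 0] by simp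
  have pneg: "p ((- 1) \<odot> x) = p x" if "x \<in> carr V" for x using ph[OF that, of "- 1"] by simp
  have l0: "k \<zero> = 0" using scale0[OF W0, of 0] by simp
  define g where "g w x = p (vsub V x w) + re (k w)" for w x
  define q where "q x = (INF w\<in>W. g w x)" for x
  have lower: "- p x \<le> g w x" if "x \<in> carr V" "w \<in> W" for x w
  proof -
    have "- re (k w) = re (k ((- 1) \<odot> w))"
      using re_scale[of "- 1"] scale0[OF that(2)] by simp
    also have "\<dots> \<le> norm (k ((- 1) \<odot> w))" by (rule re_le)
    also have "\<dots> \<le> p w" using le0[OF Wc(3)[OF that(2)], of "- 1"] pneg Wc(1)[OF that(2)] by simp
    also have "p w = p (x \<oplus> (- 1) \<odot> vsub V x w)"
      using that Wc(1)[OF that(2)]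
      by (simp add: vsub_def scale_add add_assoc[symmetric])
    also have "\<dots> \<le> p x + p (vsub V x w)"
      using pt[of x "(- 1) \<odot> vsub V x w"] pneg[of "vsub V x w"] that Wc(1)[OF that(2)] by simp
    finally show ?thesis by (simp add: g_def)
  qed
  have bdd: "bdd_below ((\<lambda>w. g w x) ` W)" if "x \<in> carr V" for x
    using lower[OF that] by (intro bdd_belowI2) auto
  have q_le: "q x \<le> g w x" if "x \<in> carr V" "w \<in> W" for x w
    unfolding q_def using bdd[OF that(1)] that by (intro cINF_lower) auto
  have q_ge: "a \<le> q x" if "\<And>w. w \<in> W \<Longrightarrow> a \<le> g w x" for a x
    unfolding q_def using that W0 by (intro cINF_greatest) auto
  have "sublinear q"
  proof (rule sublinearI)
    fix x y assume xy: "x \<in> carr V" "y \<in> carr V"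
    have "q (x \<oplus> y) \<le> g u x + g v y" if uv: "u \<in> W" "v \<in> W" for u v
    proof -
      have "q (x \<oplus> y) \<le> g (u \<oplus> v) (x \<oplus> y)" using q_le xy uv Wc by simp
      moreover have "p (vsub V (x \<oplus> y) (u \<oplus> v)) \<le> p (vsub V x u) + p (vsub V y v)"
        using pt[of "vsub V x u" "vsub V y v"] xy uv Wc(1) by (simp add: sub_add_sub)
      ultimately show ?thesis using add0[OF uv] re_add by (simp add: g_def)
    qed
    then have "q (x \<oplus> y) - g v y \<le> q x" if "v \<in> W" for v
      using that by (intro q_ge) (simp add: algebra_simps)
    then have "q (x \<oplus> y) - q x \<le> q y" by (intro q_ge) (simp add: algebra_simps)
    then show "q (x \<oplus> y) \<le> q x + q y" by simp
  next
    fix r :: real and x assume r: "0 < r" and x: "x \<in> carr V"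
    have "q (of_real r \<odot> x) \<le> r * g w x" if w: "w \<in> W" for w
    proof -
      have "p (of_real r \<odot> vsub V x w) = r * p (vsub V x w)" using ph r x w Wc(1) by simp
      then have "g (of_real r \<odot> w) (of_real r \<odot> x) = r * g w x"
        using scale0[OF w] x w Wc(1) by (simp add: g_def scale_sub re_scale distrib_left)
      then show ?thesis using q_le[of "of_real r \<odot> x" "of_real r \<odot> w"] x w Wc(3) by simp
    qed
    then have "q (of_real r \<odot> x) / r \<le> q x"
      by (intro q_ge) (simp add: pos_divide_le_eq[OF r] mult.commute)
    then show "q (of_real r \<odot> x) \<le> r * q x" by (simp add: pos_divide_le_eq[OF r] mult.commute)
  qed
  then obtain L where Ladd: "\<And>x y. x \<in> carr V \<Longrightarrow> y \<in> carr V \<Longrightarrow> L (x \<oplus> y) = L x + L y"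
    and Lscale: "\<And>r x. x \<in> carr V \<Longrightarrow> L (of_real r \<odot> x) = r * L x"
    and Lq: "\<And>x. x \<in> carr V \<Longrightarrow> L x \<le> q x"
    using sublinear_dominates_real_linear by blast
  have Lp: "L x \<le> p x" if "x \<in> carr V" for x
    using Lq[OF that] q_le[OF that W0] l0 re_of_real[of 0] that by (simp add: g_def)
  have LW1: "L x \<le> re (k x)" if "x \<in> W" for x
    using Lq[OF Wc(1)[OF that]] q_le[OF Wc(1)[OF that] that] Wc(1)[OF that] p0 by (simp add: g_def)
  have LW: "L x = re (k x)" if x: "x \<in> W" for x
  proof (rule antisym)
    have "L ((- 1) \<odot> x) = - L x" using Lscale[OF Wc(1)[OF x], of "- 1"] by simp
    moreover have "re (k ((- 1) \<odot> x)) = - re (k x)"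
      using scale0[OF x, of "- 1"] re_scale[of "- 1"] by simp
    ultimately show "re (k x) \<le> L x" using LW1[OF Wc(3)[OF x], of "- 1"] by simp
  qed (rule LW1[OF x])
  define l where "l x = of_real (L x) - of_real (L (i \<odot> x)) * i" for x
  have ladd: "l (x \<oplus> y) = l x + l y" if "x \<in> carr V" "y \<in> carr V" for x y
    using that by (simp add: l_def Ladd scale_add algebra_simps)
  have lreal: "l (of_real r \<odot> x) = of_real r * l x" if "x \<in> carr V" for r x
    using Lscale[OF that] Lscale[of "i \<odot> x" r] that
    by (simp add: l_def mult.commute algebra_simps)
  have li: "l (i \<odot> x) = i * l x" if x: "x \<in> carr V" for x
  proof (cases "i = 0")
    case True
    have "L \<zero> = 0" using Lscale[of \<zero> 0] by simp
    then show ?thesis using True x by (simp add: l_def)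
  next
    case False
    then have ii: "i * i = - 1" using i by simp
    then have iiz: "i * (i * z) = - z" for z by (simp flip: mult.assoc)
    have "L ((- 1) \<odot> x) = - L x" using Lscale[OF x, of "- 1"] by simp
    then show ?thesis using x by (simp add: l_def ii iiz algebra_simps)
  qed
  have lscale: "l (c \<odot> x) = c * l x" if x: "x \<in> carr V" for c x
  proof -
    obtain a b where c: "c = of_real a + of_real b * i"
      using dec[of c] by (metis of_real_minus diff_conv_add_uminus mult_minus_left)
    have "c \<odot> x = of_real a \<odot> x \<oplus> of_real b \<odot> (i \<odot> x)" using x by (simp add: c scale_left)
    then have "l (c \<odot> x) = l (of_real a \<odot> x) + l (of_real b \<odot> (i \<odot> x))"
      using ladd x by (simp del: scale_scale)
    then have "l (c \<odot> x) = of_real a * l x + of_real b * (i * l x)"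
      using lreal[OF x] lreal[OF scale_closed[OF x]] li[OF x] by simp
    then show ?thesis by (simp add: c algebra_simps)
  qed
  have lW: "l x = k x" if x: "x \<in> W" for x
    using LW[OF x] LW[OF Wc(3)[OF x], of i] scale0[OF x, of i] dec[of "k x"]
    by (simp add: l_def)
  have rel: "re (l x) = L x" for x
  proof -
    have "l x = of_real (L x) + of_real (- L (i \<odot> x)) * i" by (simp add: l_def)
    then show ?thesis by (simp only: re_add re_scale re_of_real rei mult_zero_right add_0_right)
  qed
  have "norm (l x) \<le> p x" if x: "x \<in> carr V" for x
  proof (cases "l x = 0")
    case True
    have "0 \<le> p x + p ((- 1) \<odot> x)" using pt[of x "(- 1) \<odot> x"] x p0 by simp
    then show ?thesis using True pneg[OF x] by simp
  next
    case False
    \<comment> \<open>rotating \<open>x\<close> makes \<open>l x\<close> real, where it agrees with \<open>L\<close>\<close>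
    define u where "u = of_real (norm (l x)) / l x"
    have "norm u = 1" using False by (simp add: u_def norm_divide)
    have "l (u \<odot> x) = of_real (norm (l x))" using lscale[OF x] False by (simp add: u_def)
    then have "norm (l x) = L (u \<odot> x)" using rel[of "u \<odot> x"] re_of_real by simp
    also have "\<dots> \<le> p x" using Lp[of "u \<odot> x"] ph[OF x, of u] \<open>norm u = 1\<close> x by simp
    finally show ?thesis .
  qed
  then show ?thesis using that[OF ladd lscale lW] by blast
qed

end

section \<open>Normed spaces with a carrier\<close>

locale nvspace = vspace +
  assumes normed_sp: "normed_sp V"

lemma nvspaceI: "normed_sp V \<Longrightarrow> nvspace V"
  by unfold_locales (simp_all add: normed_sp_def)

lemma banach_sp_normed: "banach_sp V \<Longrightarrow> normed_sp V"
  by (simp add: banach_sp_def)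

lemma normed_sp_vector_sp: "normed_sp V \<Longrightarrow> vector_sp V"
  by (simp add: normed_sp_def)

context nvspace
begin

lemma norm_nonneg [simp]: "x \<in> carr V \<Longrightarrow> 0 \<le> vnorm V x"
  and norm_eq_zero: "x \<in> carr V \<Longrightarrow> vnorm V x = 0 \<longleftrightarrow> x = \<zero>"
  and norm_scale: "x \<in> carr V \<Longrightarrow> vnorm V (c \<odot> x) = norm c * vnorm V x"
  and norm_triangle: "x \<in> carr V \<Longrightarrow> y \<in> carr V \<Longrightarrow> vnorm V (x \<oplus> y) \<le> vnorm V x + vnorm V y"
  using normed_sp unfolding normed_sp_def by simp_all

lemma norm_null [simp]: "vnorm V \<zero> = 0"
  using norm_eq_zero[of \<zero>] by simp

lemma norm_sub_comm: "x \<in> carr V \<Longrightarrow> y \<in> carr V \<Longrightarrow> vnorm V (vsub V x y) = vnorm V (vsub V y x)"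
  using vsub_swap[OF vector_sp, of x y] norm_scale[of "vsub V x y" "- 1"] by simp

lemma norm_sub_triangle: "\<lbrakk>x \<in> carr V; y \<in> carr V; z \<in> carr V\<rbrakk> \<Longrightarrow>
    vnorm V (vsub V x z) \<le> vnorm V (vsub V x y) + vnorm V (vsub V y z)"
  using vsub_split[OF vector_sp, of x y z] norm_triangle[of "vsub V x y" "vsub V y z"] by simp

lemma norm_sub_le: "x \<in> carr V \<Longrightarrow> y \<in> carr V \<Longrightarrow> vnorm V (vsub V x y) \<le> vnorm V x + vnorm V y"
  using norm_triangle[of x "(- 1) \<odot> y"] norm_scale[of y "- 1"] by (simp add: vsub_def)

lemma norm_le_sub: "x \<in> carr V \<Longrightarrow> y \<in> carr V \<Longrightarrow> vnorm V x \<le> vnorm V (vsub V x y) + vnorm V y"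
  using norm_triangle[of "vsub V x y" y] by (simp add: sub_add_cancel)

lemma norm_sub_eq_zero: "x \<in> carr V \<Longrightarrow> y \<in> carr V \<Longrightarrow> vnorm V (vsub V x y) = 0 \<longleftrightarrow> x = y"
  using norm_eq_zero[of "vsub V x y"] vsub_self_iff[OF vector_sp, of x y] by auto

lemma abs_norm_sub_le:
  assumes "x \<in> carr V" "y \<in> carr V"
  shows "\<bar>vnorm V x - vnorm V y\<bar> \<le> vnorm V (vsub V x y)"
  using norm_le_sub[OF assms] norm_le_sub[OF assms(2,1)] norm_sub_comm[OF assms] by linarith

definition cauchy :: "(nat \<Rightarrow> 'b) \<Rightarrow> bool" where
  "cauchy s \<longleftrightarrow> (\<forall>n. s n \<in> carr V) \<and>
     (\<forall>e>0. \<exists>N. \<forall>m\<ge>N. \<forall>n\<ge>N. vnorm V (vsub V (s m) (s n)) < e)"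

lemma MCauchy_nmetric:
  "Metric_space.MCauchy (mspace (nmetric V)) (mdist (nmetric V)) s \<longleftrightarrow> cauchy s"
proof (cases "\<forall>n. s n \<in> carr V")
  case True
  then show ?thesis
    unfolding Metric_space.MCauchy_def[OF Metric_space_mspace_mdist] cauchy_def
    by (auto simp: mspace_nmetric[OF normed_sp] mdist_nmetric[OF normed_sp] image_subset_iff)
next
  case False
  then show ?thesis
    unfolding Metric_space.MCauchy_def[OF Metric_space_mspace_mdist] cauchy_def
    by (auto simp: mspace_nmetric[OF normed_sp] image_subset_iff)
qed

lemma banach_spI:
  assumes "\<And>s. cauchy s \<Longrightarrow> \<exists>x\<in>carr V. (\<lambda>n. vnorm V (vsub V (s n) x)) \<longlonglongrightarrow> 0"
  shows "banach_sp V"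
proof -
  interpret M: Metric_space "mspace (nmetric V)" "mdist (nmetric V)" by simp
  have "\<exists>x. limitin M.mtopology s x sequentially" if "M.MCauchy s" for s
  proof -
    have s: "cauchy s" using that by (simp add: MCauchy_nmetric)
    then obtain x where x: "x \<in> carr V" "(\<lambda>n. vnorm V (vsub V (s n) x)) \<longlonglongrightarrow> 0" using assms by blast
    have sn: "s n \<in> carr V" for n using s unfolding cauchy_def by blast
    have "(\<lambda>n. mdist (nmetric V) (s n) x) \<longlonglongrightarrow> 0"
      using x by (simp add: mdist_nmetric[OF normed_sp] sn)
    then have "limitin M.mtopology s x sequentially"
      unfolding M.limitin_metric_dist_null by (simp add: mspace_nmetric[OF normed_sp] x sn)
    then show ?thesis by blast
  qed
  then show ?thesis
    unfolding banach_sp_def mcomplete_of_def M.mcomplete_def using normed_sp by blast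
qed

lemma subsp_normed_sp:
  assumes "vsubspace V W"
  shows "normed_sp (subsp V W)"
  using subsp_vector_sp[OF assms] vsubspace_closed(1)[OF assms]
  unfolding normed_sp_def by (auto simp: subsp_def norm_eq_zero norm_scale norm_triangle)

end

section \<open>Bounded operators\<close>

lemma bounded_opsD:
  assumes "T \<in> bounded_ops V W" and "normed_sp V"
  shows "linear_map V W T" and "T \<in> extensional (carr V)" and "0 \<le> op_norm V W T"
    and "x \<in> carr V \<Longrightarrow> vnorm W (T x) \<le> op_norm V W T * vnorm V x"
    and "x \<in> carr V \<Longrightarrow> T x \<in> carr W"
proof -
  interpret V: nvspace V using nvspaceI[OF assms(2)] .
  show "linear_map V W T" "T \<in> extensional (carr V)" using assms(1) unfolding bounded_ops_def by auto
  then show "x \<in> carr V \<Longrightarrow> T x \<in> carr W" using linear_map_simps(1) by metis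
  show "0 \<le> op_norm V W T" "x \<in> carr V \<Longrightarrow> vnorm W (T x) \<le> op_norm V W T * vnorm V x"
    using op_norm_bound[of V W T] assms(1) V.norm_nonneg unfolding bounded_ops_def by auto
qed

lemma restrict_linear_map:
  assumes "linear_map V W T" and "vector_sp V"
  shows "linear_map V W (restrict T (carr V))"
proof -
  interpret V: vspace V by unfold_locales fact
  show ?thesis using assms(1) unfolding linear_map_def by auto
qed

lemma bounded_opsI:
  assumes "linear_map V W T" and "normed_sp V"
    and "\<And>x. x \<in> carr V \<Longrightarrow> vnorm W (T x) \<le> C * vnorm V x"
  shows "restrict T (carr V) \<in> bounded_ops V W"
  using restrict_linear_map[OF assms(1) normed_sp_vector_sp[OF assms(2)]] assms(3)
  unfolding bounded_ops_def by auto

lemma op_norm_restrict [simp]: "op_norm V W (restrict T (carr V)) = op_norm V W T"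
  unfolding op_norm_def by simp

lemma linear_map_scalars_iff:
  "linear_map V scalars T \<longleftrightarrow> (\<forall>x\<in>carr V. \<forall>y\<in>carr V. T (vadd V x y) = T x + T y) \<and>
     (\<forall>c. \<forall>x\<in>carr V. T (vscale V c x) = c * T x)"
  by (simp add: linear_map_def)

lemma linear_map_comp:
  assumes "linear_map U V S" and "linear_map V W T"
  shows "linear_map U W (\<lambda>x. T (S x))"
  using assms unfolding linear_map_def by (auto simp: Pi_iff)

lemma linear_map_sum:
  assumes "linear_map V W S" "linear_map V W T" and W: "vector_sp W"
  shows "linear_map V W (\<lambda>x. vadd W (S x) (T x))"
proof -
  interpret W: vspace W by unfold_locales fact
  note s = linear_map_simps[OF assms(1)] linear_map_simps[OF assms(2)]
  show ?thesis unfolding linear_map_def by (auto simp: s W.add_ac W.scale_add)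
qed

lemma linear_map_scaled:
  assumes "linear_map V W T" and W: "vector_sp W"
  shows "linear_map V W (\<lambda>x. vscale W c (T x))"
proof -
  interpret W: vspace W by unfold_locales fact
  note s = linear_map_simps[OF assms(1)]
  show ?thesis unfolding linear_map_def by (auto simp: s W.scale_add mult.commute)
qed

lemma bounded_ops_add:
  assumes S: "S \<in> bounded_ops V W" and T: "T \<in> bounded_ops V W" and V: "normed_sp V" and W: "normed_sp W"
  shows "(\<lambda>x\<in>carr V. vadd W (S x) (T x)) \<in> bounded_ops V W"
proof (rule bounded_opsI[OF linear_map_sum V])
  interpret W: nvspace W using nvspaceI[OF W] .
  fix x assume x: "x \<in> carr V"
  show "vnorm W (vadd W (S x) (T x)) \<le> (op_norm V W S + op_norm V W T) * vnorm V x"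
    using bounded_opsD(4)[OF S V x] bounded_opsD(4)[OF T V x]
      W.norm_triangle[OF bounded_opsD(5)[OF S V x] bounded_opsD(5)[OF T V x]]
    by (simp add: distrib_right)
qed (use bounded_opsD[OF S V] bounded_opsD[OF T V] normed_sp_vector_sp[OF W] in auto)

lemma bounded_ops_scale:
  assumes T: "T \<in> bounded_ops V W" and V: "normed_sp V" and W: "normed_sp W"
  shows "(\<lambda>x\<in>carr V. vscale W c (T x)) \<in> bounded_ops V W"
proof (rule bounded_opsI[OF linear_map_scaled V])
  interpret W: nvspace W using nvspaceI[OF W] .
  fix x assume x: "x \<in> carr V"
  show "vnorm W (vscale W c (T x)) \<le> (norm c * op_norm V W T) * vnorm V x"
    using mult_left_mono[OF bounded_opsD(4)[OF T V x], of "norm c"] bounded_opsD(5)[OF T V x]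
    by (simp add: W.norm_scale mult.assoc)
qed (use bounded_opsD[OF T V] normed_sp_vector_sp[OF W] in auto)

lemma bounded_ops_zero:
  assumes "normed_sp V" and W: "normed_sp W"
  shows "(\<lambda>x\<in>carr V. vzero W) \<in> bounded_ops V W"
proof -
  interpret V: nvspace V using nvspaceI[OF assms(1)] .
  interpret W: nvspace W using nvspaceI[OF W] .
  show ?thesis unfolding bounded_ops_def linear_map_def by (auto intro!: exI[of _ 0])
qed

lemma ndual_mem:
  assumes "linear_map V scalars T" and "normed_sp V"
    and "\<And>x. x \<in> carr V \<Longrightarrow> norm (T x) \<le> C * vnorm V x" and "0 \<le> C"
  shows "restrict T (carr V) \<in> bounded_ops V scalars" and "op_norm V scalars T \<le> C"
  using bounded_opsI[OF assms(1,2), of C] assms(3,4) by (auto intro: op_norm_le)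

lemma op_norm_approx:
  assumes V: "normed_sp V" and T: "T \<in> bounded_ops V scalars" and t: "t < op_norm V scalars T"
  obtains e r where "e \<in> carr V" "vnorm V e \<le> 1" "T e = of_real r" "t < r"
proof -
  interpret V: nvspace V using nvspaceI[OF V] .
  note Tl = linear_map_simps[OF bounded_opsD(1)[OF T V]]
  show ?thesis
  proof (cases "t < 0")
    case True
    have "T (vzero V) = of_real 0" using Tl(3)[OF V.zero_closed, of 0] by simp
    then show ?thesis using that[of "vzero V" 0] True by simp
  next
    case False
    have "\<exists>x\<in>carr V. t * vnorm V x < norm (T x)"
    proof (rule ccontr)
      assume "\<not> ?thesis"
      then have "op_norm V scalars T \<le> t" using False by (intro op_norm_le) (auto simp: not_less)
      then show False using t by simp
    qed
    then obtain x where x: "x \<in> carr V" "t * vnorm V x < norm (T x)" by blast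
    have "0 \<le> t * vnorm V x" using False x(1) by simp
    then have T0: "T x \<noteq> 0" using x(2) by auto
    have nx: "0 < vnorm V x"
      using bounded_opsD(4)[OF T V x(1)] V.norm_nonneg[OF x(1)] T0 by (cases "vnorm V x = 0") auto
    let ?c = "of_real (norm (T x) / vnorm V x) / T x"
    have "norm ?c = 1 / vnorm V x" using T0 nx by (simp add: norm_divide norm_mult)
    then have "vnorm V (vscale V ?c x) \<le> 1" using V.norm_scale[OF x(1)] nx by simp
    moreover have "T (vscale V ?c x) = of_real (norm (T x) / vnorm V x)" using Tl(3)[OF x(1)] T0 by simp
    moreover have "t < norm (T x) / vnorm V x" using x(2) nx by (simp add: field_simps)
    ultimately show ?thesis using that V.scale_closed[OF x(1)] by blast
  qed
qed

text \<open>For \<open>x \<noteq> 0\<close>, by Hahn--Banach, \<open>c x \<mapsto> c \<parallel>x\<parallel>\<close> extends to a functional of norm at most 1.\<close>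

lemma norm_le_of_functionals:
  assumes V: "normed_sp V" and x: "x \<in> carr V"
    and le: "\<And>\<psi>. \<psi> \<in> bounded_ops V scalars \<Longrightarrow> norm (\<psi> x) \<le> C * op_norm V scalars \<psi>" and C: "0 \<le> C"
  shows "vnorm V x \<le> C"
proof (cases "x = vzero V")
  case True
  then show ?thesis using C nvspace.norm_null[OF nvspaceI[OF V]] by simp
next
  case False
  interpret V: nvspace V using nvspaceI[OF V] .
  have nx: "0 < vnorm V x" using False V.norm_eq_zero[OF x] V.norm_nonneg[OF x] by linarith
  define W where "W = {vscale V c x | c. True}"
  define k where "k w = (SOME c. w = vscale V c x) * of_real (vnorm V x)" for w
  have k: "k (vscale V c x) = c * of_real (vnorm V x)" for c
  proof -
    have "d = c" if "vscale V c x = vscale V d x" for d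
    proof -
      have "vscale V (c - d) x = vsub V (vscale V c x) (vscale V d x)"
        using V.scale_left[OF x, of c "- d"] x by (simp add: vsub_def)
      then have "norm (c - d) * vnorm V x = 0" using that V.norm_scale[OF x, of "c - d"] x by simp
      then show ?thesis using nx by simp
    qed
    then have "(SOME d. vscale V c x = vscale V d x) = c" by (intro some_equality) auto
    then show ?thesis by (simp add: k_def)
  qed
  have W: "vsubspace V W"
    unfolding vsubspace_def W_def
  proof (intro conjI ballI allI)
    show "vzero V \<in> {vscale V c x |c. True}" using V.scale_zero_left[OF x, symmetric] by blast
  next
    fix y z assume "y \<in> {vscale V c x |c. True}" "z \<in> {vscale V c x |c. True}"
    then obtain b c where "y = vscale V b x" "z = vscale V c x" by blast
    then show "vadd V y z \<in> {vscale V c x |c. True}" using V.scale_left[OF x, of b c, symmetric] by auto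
  next
    fix c y assume "y \<in> {vscale V c x |c. True}"
    then show "vscale V c y \<in> {vscale V c x |c. True}" using V.scale_scale[OF x] by auto
  qed (use x in auto)
  obtain l where l: "\<And>x y. x \<in> carr V \<Longrightarrow> y \<in> carr V \<Longrightarrow> l (vadd V x y) = l x + l y"
    "\<And>c x. x \<in> carr V \<Longrightarrow> l (vscale V c x) = c * l x" "\<And>x. x \<in> W \<Longrightarrow> l x = k x"
    "\<And>x. x \<in> carr V \<Longrightarrow> norm (l x) \<le> vnorm V x"
  proof (rule V.hahn_banach[OF V.norm_triangle V.norm_scale W])
    show "k (vadd V y z) = k y + k z" if "y \<in> W" "z \<in> W" for y z
      using that k V.scale_left[OF x, symmetric] by (auto simp: W_def distrib_right)
    show "k (vscale V c y) = c * k y" if "y \<in> W" for c y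
      using that k x by (auto simp: W_def)
    show "norm (k y) \<le> vnorm V y" if "y \<in> W" for y
      using that k nx x V.norm_scale by (auto simp: W_def norm_mult)
  qed auto
  have "linear_map V scalars l" using l by (simp add: linear_map_scalars_iff)
  note m = ndual_mem[OF this V, of 1]
  have "x \<in> W" using V.scale_one[OF x, symmetric] unfolding W_def by blast
  then have "l x = of_real (vnorm V x)" using l(3) k[of 1] x by simp
  then have "vnorm V x \<le> C * op_norm V scalars l"
    using le[OF m(1)] l(4) nx x by simp
  also have "\<dots> \<le> C * 1" using C m(2) l(4) by (intro mult_left_mono) auto
  finally show ?thesis by simp
qed

section \<open>Quotients\<close>

context vspace
begin

context
  fixes L assumes L: "vsubspace V L"
begin

lemma coset_eq_iff:
  assumes x: "x \<in> carr V" and y: "y \<in> carr V"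
  shows "vcoset V L x = vcoset V L y \<longleftrightarrow> vsub V x y \<in> L"
proof
  note Lc = vsubspace_closed[OF L]
  have L0: "\<zero> \<in> L" using L unfolding vsubspace_def by blast
  assume "vcoset V L x = vcoset V L y"
  moreover have "x \<in> vcoset V L x" using L0 x unfolding vcoset_def by force
  ultimately obtain l where l: "x = y \<oplus> l" "l \<in> L" unfolding vcoset_def by auto
  then have "vsub V x y = l" using y Lc(1) by (simp add: add_comm[of y l] add_sub_cancel)
  then show "vsub V x y \<in> L" using l by simp
next
  note Lc = vsubspace_closed[OF L]
  have sub: "vcoset V L u \<subseteq> vcoset V L v"
    if u: "u \<in> carr V" and v: "v \<in> carr V" and d: "vsub V u v \<in> L" for u v
  proof
    fix z assume "z \<in> vcoset V L u"
    then obtain l where l: "z = u \<oplus> l" "l \<in> L" unfolding vcoset_def by auto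
    then have "z = (vsub V u v \<oplus> v) \<oplus> l" using u v by (simp add: sub_add_cancel)
    then have "z = v \<oplus> (vsub V u v \<oplus> l)" using u v l Lc(1) by (simp add: add_ac)
    moreover have "vsub V u v \<oplus> l \<in> L" using Lc(2) d l by blast
    ultimately show "z \<in> vcoset V L v" unfolding vcoset_def by blast
  qed
  assume d: "vsub V x y \<in> L"
  then have "vsub V y x \<in> L" using vsub_swap[OF vector_sp x y] Lc(3) by simp
  then show "vcoset V L x = vcoset V L y" using sub x y d by blast
qed

lemma coset_zero: "vcoset V L \<zero> = L"
  unfolding vcoset_def using vsubspace_closed(1)[OF L] by force

lemma coset_add:
  assumes x: "x \<in> carr V" and y: "y \<in> carr V"
  shows "vadd (quotient V L) (vcoset V L x) (vcoset V L y) = vcoset V L (x \<oplus> y)"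
proof -
  note Lc = vsubspace_closed[OF L]
  have L0: "\<zero> \<in> L" using L unfolding vsubspace_def by blast
  have 1: "\<exists>l. (x \<oplus> a) \<oplus> (y \<oplus> b) = (x \<oplus> y) \<oplus> l \<and> l \<in> L" if "a \<in> L" "b \<in> L" for a b
    using that Lc(1) x y Lc(2)[OF that] by (intro exI[of _ "a \<oplus> b"]) (simp add: add_ac)
  have "(x \<oplus> y) \<oplus> l = (x \<oplus> \<zero>) \<oplus> (y \<oplus> l)" if "l \<in> L" for l
    using that Lc(1) x y by (simp add: add_assoc)
  then have 2: "\<exists>a b. (x \<oplus> y) \<oplus> l = a \<oplus> b \<and> (\<exists>l. a = x \<oplus> l \<and> l \<in> L) \<and> (\<exists>l. b = y \<oplus> l \<and> l \<in> L)"
    if "l \<in> L" for l using that L0 by blast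
  show ?thesis
    unfolding quotient_def vcoset_def by (auto dest: 1 2)
qed

lemma coset_scale:
  assumes x: "x \<in> carr V"
  shows "vscale (quotient V L) c (vcoset V L x) = vcoset V L (c \<odot> x)"
proof -
  note Lc = vsubspace_closed[OF L]
  have L0: "\<zero> \<in> L" using L unfolding vsubspace_def by blast
  have 1: "\<exists>l'. c \<odot> (x \<oplus> a) \<oplus> l = c \<odot> x \<oplus> l' \<and> l' \<in> L" if "a \<in> L" "l \<in> L" for a l
    using that Lc(1) x Lc(2)[OF Lc(3)[OF that(1)] that(2)]
    by (intro exI[of _ "c \<odot> a \<oplus> l"]) (simp add: scale_add add_assoc)
  have "c \<odot> x \<oplus> l = c \<odot> (x \<oplus> \<zero>) \<oplus> l" if "l \<in> L" for l
    using that Lc(1) x by simp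
  then have 2: "\<exists>a l'. c \<odot> x \<oplus> l = c \<odot> a \<oplus> l' \<and> (\<exists>l. a = x \<oplus> l \<and> l \<in> L) \<and> l' \<in> L"
    if "l \<in> L" for l using that L0 by blast
  show ?thesis
    unfolding quotient_def vcoset_def by (auto dest: 1 2)
qed

lemma quotient_carr: "carr (quotient V L) = vcoset V L ` carr V"
  and quotient_zero: "vzero (quotient V L) = vcoset V L \<zero>"
  by (simp_all add: quotient_def coset_zero)

lemma quotient_linear_map: "linear_map V (quotient V L) (vcoset V L)"
  unfolding linear_map_def by (auto simp: quotient_carr coset_add coset_scale)

lemma quotient_vector_sp: "vector_sp (quotient V L)"
  unfolding vector_sp_def vsub_def
  by (auto simp: quotient_carr quotient_zero coset_add coset_scale add_assoc scale_add scale_left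
      intro!: arg_cong[of _ _ "vcoset V L"] intro: add_comm)

end

end

lemma (in nvspace) quotient_norm_le:
  assumes L: "vsubspace V L" and x: "x \<in> carr V"
  shows "vnorm (quotient V L) (vcoset V L x) \<le> vnorm V x"
    and "0 \<le> vnorm (quotient V L) (vcoset V L x)"
proof -
  note Lc = vsubspace_closed[OF L]
  have L0: "\<zero> \<in> L" using L unfolding vsubspace_def by blast
  have m: "x \<in> vcoset V L x" using L0 x unfolding vcoset_def by force
  have p: "0 \<le> vnorm V z" if "z \<in> vcoset V L x" for z
    using that x Lc(1) unfolding vcoset_def by auto
  show "vnorm (quotient V L) (vcoset V L x) \<le> vnorm V x"
    unfolding quotient_def using m p by (auto intro!: cInf_lower bdd_belowI2[where m = 0])
  show "0 \<le> vnorm (quotient V L) (vcoset V L x)"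
    unfolding quotient_def using m p by (auto intro!: cInf_greatest)
qed

section \<open>Finite-dimensional spaces\<close>

primrec lincomb :: "('k::real_or_complex, 'a) nspace \<Rightarrow> (nat \<Rightarrow> 'a) \<Rightarrow> (nat \<Rightarrow> 'k) \<Rightarrow> nat \<Rightarrow> 'a" where
  "lincomb V b a 0 = vzero V"
| "lincomb V b a (Suc n) = vadd V (lincomb V b a n) (vscale V (a n) (b n))"

text \<open>
  Independence in triangular form: adjoining a vector outside the span of the earlier ones keeps it,
  and it is what the induction for the coordinate bound uses.
\<close>

definition indep :: "('k::real_or_complex, 'a) nspace \<Rightarrow> (nat \<Rightarrow> 'a) \<Rightarrow> nat \<Rightarrow> bool" where
  "indep V b n \<longleftrightarrow> (\<forall>i<n. b i \<in> carr V) \<and> (\<forall>i<n. \<forall>a. b i \<noteq> lincomb V b a i)"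

definition basis :: "('k::real_or_complex, 'a) nspace \<Rightarrow> (nat \<Rightarrow> 'a) \<Rightarrow> nat \<Rightarrow> bool" where
  "basis V b n \<longleftrightarrow> indep V b n \<and> (\<forall>x\<in>carr V. \<exists>a. x = lincomb V b a n)"

lemma lincomb_cong:
  "(\<And>i. i < n \<Longrightarrow> a i = a' i) \<Longrightarrow> (\<And>i. i < n \<Longrightarrow> b i = b' i) \<Longrightarrow> lincomb V b a n = lincomb V b' a' n"
  by (induction n) auto

lemma lincomb_scalars: "lincomb scalars c a n = (\<Sum>i<n. a i * c i)"
  by (induction n) auto

context vspace
begin

lemma lincomb_closed [simp]: "(\<And>i. i < n \<Longrightarrow> b i \<in> carr V) \<Longrightarrow> lincomb V b a n \<in> carr V"
  by (induction n) auto

lemma lincomb_add: "(\<And>i. i < n \<Longrightarrow> b i \<in> carr V) \<Longrightarrow>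
    lincomb V b (\<lambda>i. a i + a' i) n = lincomb V b a n \<oplus> lincomb V b a' n"
  by (induction n) (auto simp: scale_left add_ac)

lemma lincomb_scale: "(\<And>i. i < n \<Longrightarrow> b i \<in> carr V) \<Longrightarrow>
    lincomb V b (\<lambda>i. c * a i) n = c \<odot> lincomb V b a n"
  by (induction n) (auto simp: scale_add)

lemma lincomb_sub: "(\<And>i. i < n \<Longrightarrow> b i \<in> carr V) \<Longrightarrow>
    lincomb V b (\<lambda>i. a i - a' i) n = vsub V (lincomb V b a n) (lincomb V b a' n)"
  using lincomb_add[of n b a "\<lambda>i. - 1 * a' i"] lincomb_scale[of n b "- 1" a'] by (simp add: vsub_def)

lemma lincomb_null: "(\<And>i. i < n \<Longrightarrow> b i \<in> carr V) \<Longrightarrow> (\<And>i. i < n \<Longrightarrow> a i = 0) \<Longrightarrow> lincomb V b a n = \<zero>"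
  by (induction n) auto

lemma lincomb_unit: "(\<And>i. i < n \<Longrightarrow> b i \<in> carr V) \<Longrightarrow> j < n \<Longrightarrow>
    lincomb V b (\<lambda>i. if i = j then 1 else 0) n = b j"
proof (induction n)
  case (Suc n)
  show ?case
  proof (cases "j = n")
    case True
    then have "lincomb V b (\<lambda>i. if i = j then 1 else 0) n = \<zero>" using Suc.prems by (intro lincomb_null) auto
    then show ?thesis using True Suc.prems by simp
  next
    case False
    then show ?thesis using Suc by auto
  qed
qed simp

lemma linear_map_lincomb:
  assumes T: "linear_map V W T" and W: "vector_sp W" and b: "\<And>i. i < n \<Longrightarrow> b i \<in> carr V"
  shows "T (lincomb V b a n) = lincomb W (\<lambda>i. T (b i)) a n"
  using b by (induction n) (auto simp: linear_map_zero[OF T W] linear_map_simps[OF T])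

lemma linear_functional_lincomb:
  assumes T: "linear_map V scalars T" and b: "\<And>i. i < n \<Longrightarrow> b i \<in> carr V"
  shows "T (lincomb V b a n) = (\<Sum>i<n. a i * T (b i))"
  using linear_map_lincomb[OF T vector_sp_scalars b] by (simp add: lincomb_scalars)

lemma vsubspace_lincomb:
  assumes "\<And>i. i < n \<Longrightarrow> b i \<in> carr V"
  shows "vsubspace V (range (\<lambda>a. lincomb V b a n))"
  unfolding vsubspace_def
proof (intro conjI ballI allI)
  show "\<zero> \<in> range (\<lambda>a. lincomb V b a n)"
    using lincomb_null[of n b "\<lambda>_. 0"] assms by (metis rangeI)
next
  fix x y assume "x \<in> range (\<lambda>a. lincomb V b a n)" "y \<in> range (\<lambda>a. lincomb V b a n)"
  then show "x \<oplus> y \<in> range (\<lambda>a. lincomb V b a n)"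
    using lincomb_add[of n b] assms by (auto intro: range_eqI[OF sym])
next
  fix c x assume "x \<in> range (\<lambda>a. lincomb V b a n)"
  then show "c \<odot> x \<in> range (\<lambda>a. lincomb V b a n)"
    using lincomb_scale[of n b c] assms by (auto intro: range_eqI[OF sym])
qed (use assms in auto)

lemma vspan_least: "vsubspace V W \<Longrightarrow> S \<subseteq> W \<Longrightarrow> vspan V S \<subseteq> W"
  unfolding vspan_def by (rule hull_minimal)

lemma vspan_superset: "S \<subseteq> vspan V S"
  unfolding vspan_def by (rule hull_subset)

lemma vsubspace_vspan:
  assumes "S \<subseteq> carr V"
  shows "vsubspace V (vspan V S)"
proof -
  have "vsubspace V (carr V)" unfolding vsubspace_def by simp
  then have "vsubspace V (\<Inter> {W. vsubspace V W \<and> S \<subseteq> W})"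
    using assms unfolding vsubspace_def by blast
  then show ?thesis by (simp add: vspan_def hull_def)
qed

lemma ex_indep_superset:
  assumes "finite B" and "B \<subseteq> carr V"
  shows "\<exists>b n. indep V b n \<and> B \<subseteq> range (\<lambda>a. lincomb V b a n)"
  using assms
proof induction
  case empty
  then show ?case by (intro exI[of _ "\<lambda>_. \<zero>"] exI[of _ 0]) (simp add: indep_def)
next
  case (insert x B)
  then obtain b n where b: "indep V b n" and B: "B \<subseteq> range (\<lambda>a. lincomb V b a n)" by auto
  show ?case
  proof (cases "x \<in> range (\<lambda>a. lincomb V b a n)")
    case True
    then show ?thesis using b B by blast
  next
    case False
    define b' where "b' = b(n := x)"
    have eq: "lincomb V b' a i = lincomb V b a i" if "i \<le> n" for a i
      using that by (intro lincomb_cong) (auto simp: b'_def)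
    have bc: "\<And>i. i < Suc n \<Longrightarrow> b' i \<in> carr V"
      using b insert.prems by (auto simp: b'_def indep_def less_Suc_eq)
    have "indep V b' (Suc n)"
      unfolding indep_def
    proof (intro conjI allI impI)
      fix i a assume i: "i < Suc n"
      show "b' i \<noteq> lincomb V b' a i"
      proof (cases "i = n")
        case True
        then show ?thesis using False eq[of n a] by (auto simp: b'_def)
      next
        case False
        then show ?thesis using b eq[of i a] i by (auto simp: b'_def indep_def)
      qed
    qed (use bc in auto)
    moreover have "x = lincomb V b' (\<lambda>i. if i = n then 1 else 0) (Suc n)"
      using lincomb_unit[of "Suc n" b' n] bc by (simp add: b'_def)
    moreover have "lincomb V b a n = lincomb V b' (a(n := 0)) (Suc n)" for a
    proof -
      have "lincomb V b' (a(n := 0)) n = lincomb V b a n"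
        by (intro lincomb_cong) (auto simp: b'_def)
      then show ?thesis using bc[of n] lincomb_closed[of n b' "a(n := 0)"] bc by simp
    qed
    ultimately have "insert x B \<subseteq> range (\<lambda>a. lincomb V b' a (Suc n))" using B by blast
    then show ?thesis using \<open>indep V b' (Suc n)\<close> by blast
  qed
qed

lemma ex_basis:
  assumes "fin_dim V"
  obtains b n where "basis V b n"
proof -
  obtain B where B: "finite B" "B \<subseteq> carr V" "vspan V B = carr V" using assms unfolding fin_dim_def by blast
  obtain b n where b: "indep V b n" "B \<subseteq> range (\<lambda>a. lincomb V b a n)"
    using ex_indep_superset[OF B(1,2)] by blast
  have "carr V \<subseteq> range (\<lambda>a. lincomb V b a n)"
    using vspan_least[OF vsubspace_lincomb b(2)] b(1) B(3) by (simp add: indep_def)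
  then have "basis V b n" using b(1) unfolding basis_def by blast
  then show ?thesis using that by blast
qed

lemma fin_dim_linear_image:
  assumes "fin_dim V" and T: "linear_map V W T" and W: "vector_sp W" and surj: "T ` carr V = carr W"
  shows "fin_dim W"
proof -
  interpret W: vspace W by unfold_locales fact
  obtain B where B: "finite B" "B \<subseteq> carr V" "vspan V B = carr V" using assms(1) unfolding fin_dim_def by blast
  have TB: "T ` B \<subseteq> carr W" using B(2) surj by blast
  note S = W.vsubspace_vspan[OF TB]
  have "vsubspace V {x \<in> carr V. T x \<in> vspan W (T ` B)}"
    using S unfolding vsubspace_def
    by (auto simp: linear_map_simps[OF T] linear_map_zero[OF T W])
  moreover have "B \<subseteq> {x \<in> carr V. T x \<in> vspan W (T ` B)}" using B(2) W.vspan_superset by blast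
  ultimately have "vspan V B \<subseteq> {x \<in> carr V. T x \<in> vspan W (T ` B)}" by (rule vspan_least)
  then have "carr V \<subseteq> {x \<in> carr V. T x \<in> vspan W (T ` B)}" unfolding B(3) .
  then have "T ` carr V \<subseteq> vspan W (T ` B)" by blast
  then have "carr W \<subseteq> vspan W (T ` B)" unfolding surj .
  moreover have "vspan W (T ` B) \<subseteq> carr W" using S unfolding vsubspace_def by blast
  ultimately show ?thesis unfolding fin_dim_def using B(1) TB by blast
qed

end

context nvspace
begin

lemma norm_lincomb_le: "(\<And>i. i < n \<Longrightarrow> b i \<in> carr V) \<Longrightarrow>
    vnorm V (lincomb V b a n) \<le> (\<Sum>i<n. norm (a i) * vnorm V (b i))"
proof (induction n)
  case (Suc n)
  then have "vnorm V (lincomb V b a n \<oplus> a n \<odot> b n) \<le> vnorm V (lincomb V b a n) + vnorm V (a n \<odot> b n)"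
    by (intro norm_triangle) auto
  then show ?case using Suc by (simp add: norm_scale)
qed simp

text \<open>Coordinates that are bounded by the norm inherit Cauchy sequences, hence limits.\<close>

lemma lincomb_Cauchy_convergent:
  assumes b: "\<And>i. i < n \<Longrightarrow> b i \<in> carr V"
    and M: "\<And>a. (\<Sum>i<n. norm (a i)) \<le> M * vnorm V (lincomb V b a n)" and M0: "0 \<le> M"
    and c: "cauchy (\<lambda>k. lincomb V b (A k) n)"
  obtains a where "(\<lambda>k. vnorm V (vsub V (lincomb V b (A k) n) (lincomb V b a n))) \<longlonglongrightarrow> 0"
proof -
  have "Cauchy (\<lambda>k. A k i)" if i: "i < n" for i
  proof (rule metric_CauchyI)
    fix e :: real assume e: "0 < e"
    then obtain N where N: "\<And>k l. k \<ge> N \<Longrightarrow> l \<ge> N \<Longrightarrow>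
        vnorm V (vsub V (lincomb V b (A k) n) (lincomb V b (A l) n)) < e / (M + 1)"
      using c M0 unfolding cauchy_def by (metis add_nonneg_pos divide_pos_pos zero_less_one)
    have "dist (A k i) (A l i) < e" if kl: "k \<ge> N" "l \<ge> N" for k l
    proof -
      let ?v = "vnorm V (vsub V (lincomb V b (A k) n) (lincomb V b (A l) n))"
      have "dist (A k i) (A l i) \<le> (\<Sum>i<n. norm (A k i - A l i))"
        unfolding dist_norm using i by (intro member_le_sum) auto
      also have "\<dots> \<le> M * ?v" using M[of "\<lambda>i. A k i - A l i"] lincomb_sub[of n b "A k" "A l"] b by simp
      also have "\<dots> \<le> M * (e / (M + 1))" using N[OF kl] M0 by (intro mult_left_mono) auto
      also have "\<dots> < e" using e M0 by (simp add: field_simps)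
      finally show ?thesis .
    qed
    then show "\<exists>N. \<forall>k\<ge>N. \<forall>l\<ge>N. dist (A k i) (A l i) < e" by blast
  qed
  then have "\<forall>i. \<exists>l. i < n \<longrightarrow> (\<lambda>k. A k i) \<longlonglongrightarrow> l"
    using real_or_complex_Cauchy_convergent by metis
  then obtain a where a: "\<And>i. i < n \<Longrightarrow> (\<lambda>k. A k i) \<longlonglongrightarrow> a i" by metis
  have "(\<lambda>k. \<Sum>i<n. norm (A k i - a i) * vnorm V (b i)) \<longlonglongrightarrow> (\<Sum>i<n. 0 * vnorm V (b i))"
    using a by (intro tendsto_sum tendsto_mult tendsto_const) (simp add: LIM_zero_iff tendsto_norm_zero_iff)
  then have lim: "(\<lambda>k. \<Sum>i<n. norm (A k i - a i) * vnorm V (b i)) \<longlonglongrightarrow> 0" by simp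
  have "(\<lambda>k. vnorm V (vsub V (lincomb V b (A k) n) (lincomb V b a n))) \<longlonglongrightarrow> 0"
  proof (rule tendsto_sandwich[OF _ _ tendsto_const lim]; intro always_eventually allI)
    fix k
    show "0 \<le> vnorm V (vsub V (lincomb V b (A k) n) (lincomb V b a n))" using b by simp
    show "vnorm V (vsub V (lincomb V b (A k) n) (lincomb V b a n))
        \<le> (\<Sum>i<n. norm (A k i - a i) * vnorm V (b i))"
      using norm_lincomb_le[of n b "\<lambda>i. A k i - a i"] lincomb_sub[of n b "A k" a] b by simp
  qed
  then show ?thesis using that by blast
qed

text \<open>
  The span of the first \<open>n\<close> vectors is complete by the induction hypothesis, so the next vector has
  a positive distance from it, and this bounds its coefficient.
\<close>

lemma coordinates_bounded:
  assumes "indep V b n"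
  obtains M where "0 \<le> M" and "\<And>a. (\<Sum>i<n. norm (a i)) \<le> M * vnorm V (lincomb V b a n)"
  using assms
proof (induction n arbitrary: thesis)
  case 0
  show ?case by (rule 0(1)[of 0]) auto
next
  case (Suc n)
  have b: "b i \<in> carr V" if "i < Suc n" for i using Suc.prems(2) that unfolding indep_def by blast
  then have bn: "b i \<in> carr V" if "i < n" for i using that by simp
  have "indep V b n" using Suc.prems(2) unfolding indep_def by simp
  then obtain M where M0: "0 \<le> M" and M: "\<And>a. (\<Sum>i<n. norm (a i)) \<le> M * vnorm V (lincomb V b a n)"
    using Suc.IH by blast
  have lc: "lincomb V b a n \<in> carr V" for a using bn by simp
  have "\<exists>d>0. \<forall>a. d \<le> vnorm V (vsub V (b n) (lincomb V b a n))"
  proof (rule ccontr)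
    assume "\<not> ?thesis"
    then have "\<exists>a. vnorm V (vsub V (b n) (lincomb V b a n)) < inverse (real (Suc k))" for k
      by (metis not_le inverse_positive_iff_positive of_nat_0_less_iff zero_less_Suc)
    then obtain A where A: "\<And>k. vnorm V (vsub V (b n) (lincomb V b (A k) n)) < inverse (real (Suc k))"
      by metis
    have A0: "(\<lambda>k. vnorm V (vsub V (b n) (lincomb V b (A k) n))) \<longlonglongrightarrow> 0"
      by (rule tendsto_sandwich[OF _ _ tendsto_const LIMSEQ_inverse_real_of_nat])
        (use A b lc in \<open>auto intro!: always_eventually less_imp_le\<close>)
    have "cauchy (\<lambda>k. lincomb V b (A k) n)"
      unfolding cauchy_def
    proof (intro conjI allI impI)
      fix e :: real assume "0 < e"
      then have "eventually (\<lambda>k. vnorm V (vsub V (b n) (lincomb V b (A k) n)) < e / 2) sequentially"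
        using A0 by (intro order_tendstoD) auto
      then obtain N where N: "\<And>k. k \<ge> N \<Longrightarrow> vnorm V (vsub V (b n) (lincomb V b (A k) n)) < e / 2"
        unfolding eventually_sequentially by blast
      have "vnorm V (vsub V (lincomb V b (A k) n) (lincomb V b (A l) n)) < e" if "k \<ge> N" "l \<ge> N" for k l
        using N[OF that(1)] N[OF that(2)] norm_sub_triangle[OF lc[of "A k"] b[of n] lc[of "A l"]]
          norm_sub_comm[OF lc[of "A k"] b[of n]] by simp
      then show "\<exists>N. \<forall>k\<ge>N. \<forall>l\<ge>N. vnorm V (vsub V (lincomb V b (A k) n) (lincomb V b (A l) n)) < e"
        by blast
    qed (rule lc)
    then obtain a where a: "(\<lambda>k. vnorm V (vsub V (lincomb V b (A k) n) (lincomb V b a n))) \<longlonglongrightarrow> 0"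
      using lincomb_Cauchy_convergent[OF bn M M0] by blast
    have "(\<lambda>k. vnorm V (vsub V (b n) (lincomb V b (A k) n))
        + vnorm V (vsub V (lincomb V b (A k) n) (lincomb V b a n))) \<longlonglongrightarrow> 0"
      using tendsto_add[OF A0 a] by simp
    moreover have "vnorm V (vsub V (b n) (lincomb V b a n)) \<le> vnorm V (vsub V (b n) (lincomb V b (A k) n))
        + vnorm V (vsub V (lincomb V b (A k) n) (lincomb V b a n))" for k
      by (rule norm_sub_triangle) (use b lc in auto)
    ultimately have "vnorm V (vsub V (b n) (lincomb V b a n)) \<le> 0"
      by (intro LIMSEQ_le_const) auto
    then have "vnorm V (vsub V (b n) (lincomb V b a n)) = 0" using b[of n] lc by (intro antisym) auto
    then have "b n = lincomb V b a n" using norm_sub_eq_zero[of "b n" "lincomb V b a n"] b[of n] lc by blast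
    then show False using Suc.prems(2) unfolding indep_def by blast
  qed
  then obtain d where d0: "0 < d" and d: "\<And>a. d \<le> vnorm V (vsub V (b n) (lincomb V b a n))" by blast
  define M' where "M' = M + (M * vnorm V (b n) + 1) / d"
  have bnn: "0 \<le> vnorm V (b n)" using b by simp
  have "(\<Sum>i<Suc n. norm (a i)) \<le> M' * vnorm V (lincomb V b a (Suc n))" for a
  proof -
    let ?x = "lincomb V b a (Suc n)" and ?w = "lincomb V b a n"
    have xc: "?x \<in> carr V" by (rule lincomb_closed) (rule b)
    have last: "norm (a n) * d \<le> vnorm V ?x"
    proof (cases "a n = 0")
      case True
      then show ?thesis using norm_nonneg[OF xc] by simp
    next
      case False
      have "lincomb V b (\<lambda>i. (- 1 / a n) * a i) n = (- 1 / a n) \<odot> ?w"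
        by (rule lincomb_scale) (rule bn)
      then have "a n \<odot> vsub V (b n) (lincomb V b (\<lambda>i. (- 1 / a n) * a i) n) = ?x"
        using False b lc by (simp add: vsub_def scale_add add_comm)
      then have "vnorm V ?x = norm (a n) * vnorm V (vsub V (b n) (lincomb V b (\<lambda>i. (- 1 / a n) * a i) n))"
        using norm_scale[of "vsub V (b n) (lincomb V b (\<lambda>i. (- 1 / a n) * a i) n)" "a n"] b lc by simp
      then show ?thesis using d by (simp add: mult_left_mono)
    qed
    have "?w = vsub V ?x (a n \<odot> b n)" using b lc by (simp add: add_sub_cancel)
    then have "vnorm V ?w \<le> vnorm V ?x + norm (a n) * vnorm V (b n)"
      using norm_sub_le[of ?x "a n \<odot> b n"] norm_scale[of "b n" "a n"] b xc by (simp del: lincomb.simps)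
    then have "(\<Sum>i<n. norm (a i)) \<le> M * (vnorm V ?x + norm (a n) * vnorm V (b n))"
      using M[of a] M0 by (meson mult_left_mono order_trans)
    then have "(\<Sum>i<Suc n. norm (a i)) \<le> M * vnorm V ?x + norm (a n) * (M * vnorm V (b n) + 1)"
      by (simp add: algebra_simps)
    also have "norm (a n) \<le> vnorm V ?x / d" using last d0 by (simp add: field_simps)
    then have "norm (a n) * (M * vnorm V (b n) + 1) \<le> vnorm V ?x / d * (M * vnorm V (b n) + 1)"
      using M0 bnn by (intro mult_right_mono) auto
    finally show ?thesis by (simp add: M'_def algebra_simps)
  qed
  moreover have "0 \<le> M'" using M0 d0 bnn by (simp add: M'_def)
  ultimately show ?case using Suc.prems(1) by blast
qed

lemma fin_dim_banach_sp:
  assumes "fin_dim V"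
  shows "banach_sp V"
proof (rule banach_spI)
  fix s assume s: "cauchy s"
  obtain b n where b: "basis V b n" using ex_basis[OF assms] by blast
  then have bc: "b i \<in> carr V" if "i < n" for i using that unfolding basis_def indep_def by blast
  obtain M where M: "0 \<le> M" "\<And>a. (\<Sum>i<n. norm (a i)) \<le> M * vnorm V (lincomb V b a n)"
    using coordinates_bounded b unfolding basis_def by blast
  have "\<forall>k. \<exists>a. s k = lincomb V b a n" using s b unfolding cauchy_def basis_def by blast
  then obtain A where A: "s = (\<lambda>k. lincomb V b (A k) n)" by metis
  then obtain a where "(\<lambda>k. vnorm V (vsub V (s k) (lincomb V b a n))) \<longlonglongrightarrow> 0"
    using lincomb_Cauchy_convergent[OF bc M(2,1)] s by blast
  then show "\<exists>x\<in>carr V. (\<lambda>k. vnorm V (vsub V (s k) x)) \<longlonglongrightarrow> 0" using bc by (intro bexI) auto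
qed

end

definition coord :: "('k::real_or_complex, 'a) nspace \<Rightarrow> (nat \<Rightarrow> 'a) \<Rightarrow> nat \<Rightarrow> 'a \<Rightarrow> nat \<Rightarrow> 'k" where
  "coord V b n x = (SOME a. x = lincomb V b a n)"

locale fin_dim_nvspace = nvspace +
  fixes b :: "nat \<Rightarrow> 'b" and n :: nat
  assumes basis: "basis V b n"
begin

lemma basis_closed [simp]: "i < n \<Longrightarrow> b i \<in> carr V"
  using basis unfolding basis_def indep_def by blast

lemma lincomb_coord: "x \<in> carr V \<Longrightarrow> lincomb V b (coord V b n x) n = x"
  using basis unfolding basis_def coord_def by (metis (mono_tags, lifting) someI_ex)

lemma coord_bound:
  obtains M where "0 \<le> M" and "\<And>x i. x \<in> carr V \<Longrightarrow> i < n \<Longrightarrow> norm (coord V b n x i) \<le> M * vnorm V x"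
proof -
  obtain M where M: "0 \<le> M" "\<And>a. (\<Sum>i<n. norm (a i)) \<le> M * vnorm V (lincomb V b a n)"
    using coordinates_bounded basis unfolding basis_def by blast
  have "norm (coord V b n x i) \<le> M * vnorm V x" if "x \<in> carr V" "i < n" for x i
  proof -
    have "norm (coord V b n x i) \<le> (\<Sum>i<n. norm (coord V b n x i))"
      using that(2) by (intro member_le_sum) auto
    then show ?thesis using M(2)[of "coord V b n x"] lincomb_coord[OF that(1)] by simp
  qed
  then show ?thesis using that M(1) by blast
qed

lemma coord_lincomb:
  assumes "i < n"
  shows "coord V b n (lincomb V b a n) i = a i"
proof -
  obtain M where M: "\<And>a. (\<Sum>i<n. norm (a i)) \<le> M * vnorm V (lincomb V b a n)"
    using coordinates_bounded basis unfolding basis_def by blast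
  let ?x = "lincomb V b a n"
  have "norm (coord V b n ?x i - a i) \<le> (\<Sum>i<n. norm (coord V b n ?x i - a i))"
    using assms by (intro member_le_sum) auto
  also have "\<dots> \<le> M * vnorm V (vsub V (lincomb V b (coord V b n ?x) n) ?x)"
    using M[of "\<lambda>i. coord V b n ?x i - a i"] lincomb_sub[of n b "coord V b n ?x" a] by simp
  also have "\<dots> = 0" using lincomb_coord[of ?x] by simp
  finally show ?thesis by simp
qed

lemma coord_basis: "i < n \<Longrightarrow> j < n \<Longrightarrow> coord V b n (b j) i = (if i = j then 1 else 0)"
  using coord_lincomb[of i "\<lambda>i. if i = j then 1 else 0"] lincomb_unit[of n b j] by simp

lemma coord_add: "x \<in> carr V \<Longrightarrow> y \<in> carr V \<Longrightarrow> i < n \<Longrightarrow>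
    coord V b n (x \<oplus> y) i = coord V b n x i + coord V b n y i"
  using coord_lincomb[of i "\<lambda>i. coord V b n x i + coord V b n y i"]
    lincomb_add[of n b "coord V b n x" "coord V b n y"] by (simp add: lincomb_coord)

lemma coord_scale: "x \<in> carr V \<Longrightarrow> i < n \<Longrightarrow> coord V b n (c \<odot> x) i = c * coord V b n x i"
  using coord_lincomb[of i "\<lambda>i. c * coord V b n x i"]
    lincomb_scale[of n b c "coord V b n x"] by (simp add: lincomb_coord)

lemma functional_coord:
  assumes "linear_map V scalars T" and "x \<in> carr V"
  shows "T x = (\<Sum>i<n. coord V b n x i * T (b i))"
  using linear_functional_lincomb[OF assms(1), of n b "coord V b n x"] lincomb_coord[OF assms(2)] by simp

lemma functional_bounded:
  assumes T: "linear_map V scalars T"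
  shows "restrict T (carr V) \<in> bounded_ops V scalars"
proof -
  obtain M where M: "0 \<le> M" "\<And>x i. x \<in> carr V \<Longrightarrow> i < n \<Longrightarrow> norm (coord V b n x i) \<le> M * vnorm V x"
    using coord_bound by blast
  have "norm (T x) \<le> (M * (\<Sum>i<n. norm (T (b i)))) * vnorm V x" if x: "x \<in> carr V" for x
  proof -
    have "norm (T x) \<le> (\<Sum>i<n. norm (coord V b n x i * T (b i)))"
      using functional_coord[OF T x] by (simp add: norm_sum)
    also have "\<dots> \<le> (\<Sum>i<n. M * vnorm V x * norm (T (b i)))"
      using M(2)[OF x] by (intro sum_mono) (simp add: norm_mult mult_right_mono)
    finally show ?thesis by (simp add: sum_distrib_left sum_distrib_right mult_ac)
  qed
  then show ?thesis using bounded_opsI[OF T normed_sp, of "M * (\<Sum>i<n. norm (T (b i)))"] by simp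
qed

text \<open>
  The basis turns \<open>V\<close> into its own algebraic dual, through a symmetric form: the functional of \<open>x\<close> is
  \<open>y \<mapsto> \<Sum>\<^sub>i x\<^sub>i y\<^sub>i\<close>. With the norm pulled back from the dual, \<open>V\<close> becomes a copy of its dual carried by
  the same set.
\<close>

definition form :: "'b \<Rightarrow> 'b \<Rightarrow> 'a" where
  "form x = (\<lambda>y\<in>carr V. \<Sum>i<n. coord V b n x i * coord V b n y i)"

definition dual_copy :: "('a, 'b) nspace" where
  "dual_copy = V\<lparr>vnorm := \<lambda>x. op_norm V scalars (form x)\<rparr>"

lemma dual_copy_simps [simp]:
  "carr dual_copy = carr V" "vadd dual_copy = vadd V" "vzero dual_copy = vzero V"
  "vscale dual_copy = vscale V" "vnorm dual_copy x = op_norm V scalars (form x)"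
  by (simp_all add: dual_copy_def)

lemma vsub_dual_copy [simp]: "vsub dual_copy = vsub V"
  by (simp add: vsub_def fun_eq_iff)

lemma form_sym: "x \<in> carr V \<Longrightarrow> y \<in> carr V \<Longrightarrow> form x y = form y x"
  by (simp add: form_def mult.commute)

lemma form_linear: "linear_map V scalars (form x)"
  unfolding linear_map_scalars_iff form_def
  by (auto simp: coord_add coord_scale algebra_simps sum.distrib sum_distrib_left)

lemma form_mem: "form x \<in> bounded_ops V scalars"
  using functional_bounded[OF form_linear, of x] by (simp add: form_def)

lemma form_basis: "j < n \<Longrightarrow> form x (b j) = coord V b n x j"
  by (simp add: form_def coord_basis if_distrib cong: if_cong)

lemma form_add: "x \<in> carr V \<Longrightarrow> y \<in> carr V \<Longrightarrow> form (x \<oplus> y) = (\<lambda>z\<in>carr V. form x z + form y z)"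
  and form_scale: "x \<in> carr V \<Longrightarrow> form (c \<odot> x) = (\<lambda>z\<in>carr V. c * form x z)"
  by (auto simp: form_def fun_eq_iff coord_add coord_scale algebra_simps sum.distrib sum_distrib_left)

lemma form_bij: "bij_betw form (carr V) (bounded_ops V scalars)"
proof (rule bij_betwI')
  fix x y assume xy: "x \<in> carr V" "y \<in> carr V"
  have "x = y" if "form x = form y"
  proof -
    have "lincomb V b (coord V b n x) n = lincomb V b (coord V b n y) n"
      using that form_basis[of _ x] form_basis[of _ y] by (intro lincomb_cong) auto
    then show ?thesis using xy by (simp add: lincomb_coord)
  qed
  then show "form x = form y \<longleftrightarrow> x = y" by blast
next
  show "form x \<in> bounded_ops V scalars" for x by (rule form_mem)
next
  fix \<psi> assume p: "\<psi> \<in> bounded_ops V scalars"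
  let ?x = "lincomb V b (\<lambda>i. \<psi> (b i)) n"
  note pD = bounded_opsD[OF p normed_sp]
  have "form ?x y = \<psi> y" if "y \<in> carr V" for y
    using functional_coord[OF pD(1) that] that
    by (simp add: form_def coord_lincomb mult.commute)
  then have "\<psi> = form ?x"
    using pD(2) bounded_opsD(2)[OF form_mem normed_sp] by (intro extensionalityI[of _ "carr V"]) auto
  then show "\<exists>x\<in>carr V. \<psi> = form x" by (intro bexI[of _ ?x]) auto
qed

lemma form_iso: "isometric_iso dual_copy (ndual V) form"
  unfolding isometric_iso_def linear_map_def
  by (auto simp: form_bij form_mem form_add form_scale)

lemma dual_copy_normed_sp: "normed_sp dual_copy"
proof -
  interpret D: nvspace "ndual V" using nvspaceI[OF normed_sp_ndual[OF normed_sp]] .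
  have "vector_sp dual_copy" using vector_sp unfolding vector_sp_def dual_copy_simps vsub_dual_copy .
  moreover have "vnorm (ndual V) (form x) = 0 \<longleftrightarrow> x = \<zero>" if x: "x \<in> carr V" for x
  proof -
    have "vzero (ndual V) = form \<zero>"
      using form_scale[OF zero_closed, of 0] by (simp add: fun_eq_iff)
    then have "form x = vzero (ndual V) \<longleftrightarrow> x = \<zero>"
      using form_bij x by (metis bij_betw_imp_inj_on inj_on_eq_iff zero_closed)
    then show ?thesis using D.norm_eq_zero[of "form x"] form_mem by simp
  qed
  moreover have "0 \<le> vnorm (ndual V) (form x)" for x
    using D.norm_nonneg[of "form x"] form_mem by simp
  moreover have "vnorm (ndual V) (form (c \<odot> x)) = norm c * vnorm (ndual V) (form x)" if "x \<in> carr V" for c x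
    using D.norm_scale[of "form x" c] form_mem that by (simp add: form_scale)
  moreover have "vnorm (ndual V) (form (x \<oplus> y)) \<le> vnorm (ndual V) (form x) + vnorm (ndual V) (form y)"
    if "x \<in> carr V" "y \<in> carr V" for x y
    using D.norm_triangle[of "form x" "form y"] form_mem that by (simp add: form_add)
  ultimately show ?thesis unfolding normed_sp_def by simp
qed

lemma dual_copy_basis: "basis dual_copy b n"
proof -
  have "lincomb dual_copy b a i = lincomb V b a i" for a i by (induction i) auto
  then show ?thesis using basis by (simp add: basis_def indep_def)
qed

lemma dual_copy_fin_dim: "fin_dim V \<Longrightarrow> fin_dim dual_copy"
  unfolding fin_dim_def vspan_def vsubspace_def hull_def by simp

text \<open>As the form is symmetric, it also identifies \<open>V\<close> with the dual of its dual.\<close>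

lemma form_predual_iso: "isometric_iso V (ndual dual_copy) form"
proof -
  interpret D: fin_dim_nvspace dual_copy b n
    by (intro fin_dim_nvspace.intro nvspaceI dual_copy_normed_sp fin_dim_nvspace_axioms.intro dual_copy_basis)
  have dl: "linear_map dual_copy scalars T \<longleftrightarrow> linear_map V scalars T" for T
    by (simp add: linear_map_scalars_iff)
  have eq: "bounded_ops dual_copy scalars = bounded_ops V scalars"
  proof (intro set_eqI iffI)
    fix T
    show "T \<in> bounded_ops V scalars" if "T \<in> bounded_ops dual_copy scalars"
      using functional_bounded[of T] bounded_opsD(1,2)[OF that dual_copy_normed_sp]
      by (simp add: dl extensional_restrict)
    show "T \<in> bounded_ops dual_copy scalars" if "T \<in> bounded_ops V scalars"
      using D.functional_bounded[of T] bounded_opsD(1,2)[OF that normed_sp]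
      by (simp add: dl extensional_restrict)
  qed
  have "op_norm dual_copy scalars (form x) = vnorm V x" if x: "x \<in> carr V" for x
  proof (rule antisym)
    show "op_norm dual_copy scalars (form x) \<le> vnorm V x"
    proof (rule op_norm_le)
      fix d assume "d \<in> carr dual_copy"
      then have d: "d \<in> carr V" by simp
      have "norm (form d x) \<le> op_norm V scalars (form d) * vnorm V x"
        using bounded_opsD(4)[OF form_mem normed_sp x] by simp
      then show "vnorm scalars (form x d) \<le> vnorm V x * vnorm dual_copy d"
        using form_sym[OF x d] by (simp add: mult.commute)
    qed (use x in simp)
    have fx: "form x \<in> bounded_ops dual_copy scalars" using form_mem eq by simp
    note fD = bounded_opsD[OF fx dual_copy_normed_sp]
    show "vnorm V x \<le> op_norm dual_copy scalars (form x)"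
    proof (rule norm_le_of_functionals[OF normed_sp x _ fD(3)])
      fix \<psi> assume "\<psi> \<in> bounded_ops V scalars"
      then obtain d where d: "d \<in> carr V" "\<psi> = form d" using form_bij unfolding bij_betw_def by blast
      then show "norm (\<psi> x) \<le> op_norm dual_copy scalars (form x) * op_norm V scalars \<psi>"
        using fD(4)[of d] form_sym[OF x d(1)] by simp
    qed
  qed
  then show ?thesis
    unfolding isometric_iso_def linear_map_def
    using form_bij by (auto simp: eq form_mem form_add form_scale)
qed

end

text \<open>
  The association relates an ideal and a norm only if a space and its dual are both carried by the
  same type. This lemma provides the dual of a given space as well as the predual.
\<close>

theorem fin_dim_dual_pair:
  fixes E :: "('k::real_or_complex, 'a) nspace"
  assumes E: "normed_sp E" and fd: "fin_dim E"
  obtains D :: "('k, 'a) nspace" and J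
  where "banach_sp D" "fin_dim D" "isometric_iso D (ndual E) J"
    "isometric_iso E (ndual D) (\<lambda>e. \<lambda>d\<in>carr D. J d e)"
proof -
  interpret E: nvspace E using nvspaceI[OF E] .
  obtain b n where b: "basis E b n" using E.ex_basis[OF fd] by blast
  interpret E: fin_dim_nvspace E b n by unfold_locales fact
  have fdD: "fin_dim E.dual_copy" using E.dual_copy_fin_dim[OF fd] .
  interpret D: nvspace E.dual_copy using nvspaceI[OF E.dual_copy_normed_sp] .
  have "(\<lambda>d\<in>carr E.dual_copy. E.form d e) = E.form e" if "e \<in> carr E" for e
  proof (rule extensionalityI[of _ "carr E"])
    show "E.form e \<in> extensional (carr E)" by (simp add: E.form_def)
  qed (use E.form_sym that in auto)
  moreover have "linear_map E (ndual E.dual_copy) E.form" "bij_betw E.form (carr E) (carr (ndual E.dual_copy))"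
    "\<And>x. x \<in> carr E \<Longrightarrow> vnorm (ndual E.dual_copy) (E.form x) = vnorm E x"
    using E.form_predual_iso unfolding isometric_iso_def by auto
  ultimately have "isometric_iso E (ndual E.dual_copy) (\<lambda>e. \<lambda>d\<in>carr E.dual_copy. E.form d e)"
    unfolding isometric_iso_def linear_map_def
    by (auto cong: bij_betw_cong)
  then show ?thesis using that[OF D.fin_dim_banach_sp[OF fdD] fdD E.form_iso] by blast
qed

text \<open>A net in coordinates gives points near the unit ball; points of the ball near them form the net.\<close>

lemma (in nvspace) unit_ball_finite_net:
  assumes fd: "fin_dim V" and \<delta>: "0 < \<delta>"
  obtains N where "finite N" "N \<subseteq> carr V" "\<And>m. m \<in> N \<Longrightarrow> vnorm V m \<le> 1"
    "\<And>x. x \<in> carr V \<Longrightarrow> vnorm V x \<le> 1 \<Longrightarrow> \<exists>m\<in>N. vnorm V (vsub V x m) \<le> \<delta>"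
proof -
  obtain b n where "basis V b n" using ex_basis[OF fd] by blast
  then interpret F: fin_dim_nvspace V b n by unfold_locales
  obtain M where M: "0 \<le> M" "\<And>x i. x \<in> carr V \<Longrightarrow> i < n \<Longrightarrow> norm (coord V b n x i) \<le> M * vnorm V x"
    using F.coord_bound by blast
  \<comment> \<open>the summand 1 keeps \<open>c\<close> positive in dimension 0\<close>
  define c where "c = (\<Sum>i<n. vnorm V (b i)) + 1"
  have c: "0 < c" unfolding c_def by (intro add_nonneg_pos sum_nonneg) auto
  obtain K where K: "finite (K :: 'a set)" "\<And>z. norm z \<le> M \<Longrightarrow> \<exists>d\<in>K. norm (z - d) < \<delta> / (2 * c)"
    using real_or_complex_finite_net[of "\<delta> / (2 * c)" M] \<delta> c by auto
  define P where "P a x \<longleftrightarrow> x \<in> carr V \<and> vnorm V x \<le> 1 \<and> vnorm V (vsub V x (lincomb V b a n)) \<le> \<delta> / 2" for a x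
  define G where "G = {a \<in> {..<n} \<rightarrow>\<^sub>E K. \<exists>x. P a x}"
  define N where "N = (\<lambda>a. SOME x. P a x) ` G"
  have pick: "P a (SOME x. P a x)" if "a \<in> G" for a
    using that unfolding G_def by (auto intro: someI_ex)
  have "finite G" unfolding G_def using K(1) by (intro finite_subset[OF _ finite_PiE[of "{..<n}" "\<lambda>_. K"]]) auto
  moreover have "\<exists>m\<in>N. vnorm V (vsub V x m) \<le> \<delta>" if x: "x \<in> carr V" "vnorm V x \<le> 1" for x
  proof -
    have "\<exists>d\<in>K. norm (coord V b n x i - d) < \<delta> / (2 * c)" if "i < n" for i
    proof (rule K(2))
      have "M * vnorm V x \<le> M * 1" using x(2) M(1) by (intro mult_left_mono)
      then show "norm (coord V b n x i) \<le> M" using M(2)[OF x(1) that] by simp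
    qed
    then obtain a0 where a0: "\<And>i. i < n \<Longrightarrow> a0 i \<in> K \<and> norm (coord V b n x i - a0 i) < \<delta> / (2 * c)" by metis
    define a where "a = restrict a0 {..<n}"
    have a: "a \<in> {..<n} \<rightarrow>\<^sub>E K" "\<And>i. i < n \<Longrightarrow> norm (coord V b n x i - a i) \<le> \<delta> / (2 * c)"
      using a0 by (auto simp: a_def intro: less_imp_le)
    let ?y = "lincomb V b a n"
    have "vnorm V (vsub V x ?y) \<le> (\<Sum>i<n. norm (coord V b n x i - a i) * vnorm V (b i))"
      using norm_lincomb_le[of n b "\<lambda>i. coord V b n x i - a i"] lincomb_sub[of n b "coord V b n x" a]
        F.lincomb_coord[OF x(1)] by simp
    also have "\<dots> \<le> (\<Sum>i<n. \<delta> / (2 * c) * vnorm V (b i))"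
      using a(2) by (intro sum_mono mult_right_mono) auto
    also have "\<dots> = \<delta> / (2 * c) * (c - 1)" by (simp add: sum_distrib_left c_def)
    also have "\<dots> \<le> \<delta> / (2 * c) * c" using \<delta> c by (intro mult_left_mono) auto
    also have "\<dots> = \<delta> / 2" using c by simp
    finally have xy: "vnorm V (vsub V x ?y) \<le> \<delta> / 2" .
    then have aG: "a \<in> G" using a(1) x unfolding G_def P_def by blast
    define m where "m = (SOME x. P a x)"
    have m: "P a m" using pick[OF aG] by (simp add: m_def)
    have "vnorm V (vsub V x m) \<le> vnorm V (vsub V x ?y) + vnorm V (vsub V ?y m)"
      using m x(1) by (intro norm_sub_triangle) (auto simp: P_def)
    then have "vnorm V (vsub V x m) \<le> \<delta>"
      using m xy norm_sub_comm[of m ?y] by (simp add: P_def)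
    moreover have "m \<in> N" using aG by (simp add: N_def m_def)
    ultimately show ?thesis by blast
  qed
  ultimately show ?thesis using that[of N] pick unfolding N_def P_def by blast
qed

section \<open>Local reflexivity\<close>

lemma fspace_simps [simp]:
  "carr (fspace S V C N) = C" "vadd (fspace S V C N) f g = (\<lambda>x\<in>S. vadd V (f x) (g x))"
  "vzero (fspace S V C N) = (\<lambda>x\<in>S. vzero V)" "vscale (fspace S V C N) c f = (\<lambda>x\<in>S. vscale V c (f x))"
  "vnorm (fspace S V C N) = N"
  by (simp_all add: fspace_def)

lemma fspace_vector_sp:
  assumes "vector_sp V"
  shows "vector_sp (fspace S V (S \<rightarrow>\<^sub>E carr V) N)"
proof -
  interpret V: vspace V by unfold_locales fact
  have m: "f x \<in> carr V" if "f \<in> S \<rightarrow>\<^sub>E carr V" "x \<in> S" for f x using that by auto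
  have e: "f = g" if "f \<in> S \<rightarrow>\<^sub>E carr V" "g \<in> S \<rightarrow>\<^sub>E carr V" "\<And>x. x \<in> S \<Longrightarrow> f x = g x" for f g
    using that by (rule PiE_ext)
  show ?thesis
    unfolding vector_sp_def vsub_def fspace_simps
    by (intro conjI allI ballI; (rule e)?)
      (auto simp: m V.scale_add V.scale_left V.add_assoc intro: V.add_comm m)
qed

lemma functional_sum:
  assumes "finite I" and \<phi>: "\<And>i. i \<in> I \<Longrightarrow> \<phi> i \<in> bounded_ops E scalars"
    and E: "normed_sp E" and \<Lambda>: "linear_map (ndual E) scalars \<Lambda>"
  shows "(\<Sum>i\<in>I. c i * \<Lambda> (\<phi> i)) = \<Lambda> (\<lambda>e\<in>carr E. \<Sum>i\<in>I. c i * \<phi> i e)"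
proof -
  interpret D: nvspace "ndual E" using nvspaceI[OF normed_sp_ndual[OF E]] .
  have "(\<lambda>e\<in>carr E. \<Sum>i\<in>I. c i * \<phi> i e) \<in> bounded_ops E scalars \<and>
      (\<Sum>i\<in>I. c i * \<Lambda> (\<phi> i)) = \<Lambda> (\<lambda>e\<in>carr E. \<Sum>i\<in>I. c i * \<phi> i e)"
    using assms(1) \<phi>
  proof induction
    case empty
    have "(\<lambda>e\<in>carr E. 0) \<in> bounded_ops E scalars" "\<Lambda> (\<lambda>e\<in>carr E. 0) = 0"
      using D.zero_closed D.linear_map_zero[OF \<Lambda> vector_sp_scalars] by simp_all
    then show ?case by (simp only: sum.empty simp_thms)
  next
    case (insert i I)
    let ?f = "\<lambda>e\<in>carr E. \<Sum>i\<in>I. c i * \<phi> i e" and ?g = "\<lambda>e\<in>carr E. c i * \<phi> i e"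
    have IH: "?f \<in> bounded_ops E scalars \<and> (\<Sum>i\<in>I. c i * \<Lambda> (\<phi> i)) = \<Lambda> ?f"
      using insert.prems by (intro insert.IH) blast
    then have f: "?f \<in> carr (ndual E)" and \<phi>i: "\<phi> i \<in> carr (ndual E)"
      using insert.prems[OF insertI1] by (simp_all only: ndual_simps)
    then have g: "?g \<in> carr (ndual E)" using D.scale_closed[OF \<phi>i, of "c i"] by simp
    have eq: "(\<lambda>e\<in>carr E. \<Sum>i\<in>insert i I. c i * \<phi> i e) = vadd (ndual E) ?g ?f"
      using insert.hyps by (auto simp: fun_eq_iff)
    have "\<Lambda> ?g = c i * \<Lambda> (\<phi> i)" using linear_map_simps(3)[OF \<Lambda> \<phi>i, of "c i"] by simp
    then show ?case
      using IH insert.hyps D.add_closed[OF g f] linear_map_simps(2)[OF \<Lambda> g f] unfolding eq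
      by (simp only: sum.insert ndual_simps scalars_simps simp_thms)
  qed
  then show ?thesis by blast
qed

text \<open>
  The values on a net \<open>N\<close> determine the norm of an operator up to the factor \<open>z\<close>: approximating a unit vector by \<open>m \<in> N\<close> gives \<open>\<parallel>T\<parallel> \<le> max \<parallel>T m\<parallel> + (1 - z) \<parallel>T\<parallel>\<close>.
\<close>

lemma op_norm_net:
  fixes H :: "('k::real_or_complex, 'h) nspace"
  assumes H: "normed_sp H" and E: "normed_sp E" and T: "T \<in> bounded_ops H E" and N: "N \<subseteq> carr H"
    and net: "\<And>x. x \<in> carr H \<Longrightarrow> vnorm H x \<le> 1 \<Longrightarrow> \<exists>m\<in>N. vnorm H (vsub H x m) \<le> 1 - z"
    and c: "\<And>m. m \<in> N \<Longrightarrow> vnorm E (T m) \<le> c"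
  shows "z * op_norm H E T \<le> c"
proof -
  interpret H: nvspace H using nvspaceI[OF H] .
  interpret E: nvspace E using nvspaceI[OF E] .
  note TD = bounded_opsD[OF T H]
  let ?t = "op_norm H E T"
  have unit: "vnorm E (T x) \<le> c + (1 - z) * ?t" if x: "x \<in> carr H" "vnorm H x \<le> 1" for x
  proof -
    obtain m where m: "m \<in> N" "vnorm H (vsub H x m) \<le> 1 - z" using net[OF x] by blast
    then have mc: "m \<in> carr H" using N by blast
    have "vnorm E (T x) \<le> vnorm E (vsub E (T x) (T m)) + vnorm E (T m)"
      using E.norm_le_sub TD(5) x mc by simp
    also have "vsub E (T x) (T m) = T (vsub H x m)" using H.linear_map_sub[OF TD(1) x(1) mc] by simp
    also have "vnorm E (T (vsub H x m)) \<le> ?t * vnorm H (vsub H x m)" using TD(4) x mc by simp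
    also have "\<dots> \<le> ?t * (1 - z)" using m(2) TD(3) by (rule mult_left_mono)
    finally show ?thesis using c[OF m(1)] by (simp add: mult.commute)
  qed
  have "?t \<le> c + (1 - z) * ?t"
  proof (rule op_norm_le)
    show c0: "0 \<le> c + (1 - z) * ?t"
      using unit[of "vzero H"] E.norm_nonneg[OF TD(5)[OF H.zero_closed]] by simp
    fix x assume x: "x \<in> carr H"
    show "vnorm E (T x) \<le> (c + (1 - z) * ?t) * vnorm H x"
    proof (cases "vnorm H x = 0")
      case True
      then show ?thesis using TD(4)[OF x] by simp
    next
      case False
      then have n: "0 < vnorm H x" using H.norm_nonneg[OF x] by simp
      let ?c = "of_real (1 / vnorm H x) :: 'k"
      have nc: "norm ?c = 1 / vnorm H x" using n by (simp only: norm_of_real) simp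
      have "vnorm H (vscale H ?c x) \<le> 1" using H.norm_scale[OF x, of ?c] n nc by simp
      then have "vnorm E (T (vscale H ?c x)) \<le> c + (1 - z) * ?t" using unit x by simp
      moreover have "vnorm E (T (vscale H ?c x)) = (1 / vnorm H x) * vnorm E (T x)"
        using linear_map_simps(3)[OF TD(1) x, of ?c] E.norm_scale[OF TD(5)[OF x], of ?c] nc by simp
      ultimately have "vnorm E (T x) / vnorm H x \<le> c + (1 - z) * ?t" by simp
      then show ?thesis by (simp only: pos_divide_le_eq[OF n])
    qed
  qed
  then show ?thesis by (simp add: algebra_simps)
qed

text \<open>
  Weak form of the principle of local reflexivity: in the weak topology given by finitely many
  functionals, an operator \<open>S : H \<rightarrow> E\<^sup>*\<^sup>*\<close> of norm at most 1 cannot be separated from the operators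
  \<open>H \<rightarrow> E\<close> of norm at most 1. Put \<open>G T = \<Sum>\<^sub>i \<phi>\<^sub>i (T h\<^sub>i)\<close> and let \<open>N\<close> be a net of the ball of \<open>H\<close>
  with mesh \<open>1 - z\<close>, where \<open>z\<close> tends to 1. Then
  \<open>T \<mapsto> (T m)\<^sub>m\<close> is nearly isometric into \<open>E\<^sup>N\<close> with the maximum norm, so that by Hahn--Banach
  \<open>G T = \<Sum>\<^sub>m \<psi>\<^sub>m (T m)\<close> with \<open>\<Sum>\<^sub>m \<parallel>\<psi>\<^sub>m\<parallel> \<le> K / z\<close>. Operators of rank one show that the tensors
  \<open>\<Sum>\<^sub>i h\<^sub>i \<otimes> \<phi>\<^sub>i\<close> and \<open>\<Sum>\<^sub>m m \<otimes> \<psi>\<^sub>m\<close> coincide, hence \<open>S\<close> takes the same value on both, and on the second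
  one this value is at most \<open>\<Sum>\<^sub>m \<parallel>\<psi>\<^sub>m\<parallel>\<close>.
\<close>

theorem local_reflexivity:
  fixes H :: "('k::real_or_complex, 'h) nspace" and E :: "('k, 'e) nspace"
  assumes H: "normed_sp H" and fd: "fin_dim H" and E: "normed_sp E" and I: "finite I"
    and h: "\<And>i. i \<in> I \<Longrightarrow> h i \<in> carr H" and \<phi>: "\<And>i. i \<in> I \<Longrightarrow> \<phi> i \<in> bounded_ops E scalars"
    and K: "0 \<le> K"
    and bound: "\<And>T. T \<in> bounded_ops H E \<Longrightarrow> norm (\<Sum>i\<in>I. \<phi> i (T (h i))) \<le> K * op_norm H E T"
    and S: "linear_map H (ndual (ndual E)) S"
    and S1: "\<And>x. x \<in> carr H \<Longrightarrow> op_norm (ndual E) scalars (S x) \<le> vnorm H x"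
  shows "norm (\<Sum>i\<in>I. S (h i) (\<phi> i)) \<le> K"
proof (rule field_le_mult_one_interval)
  fix z :: real assume z: "0 < z" "z < 1"
  interpret H: nvspace H using nvspaceI[OF H] .
  interpret E: nvspace E using nvspaceI[OF E] .
  note dE = normed_sp_ndual[OF E]
  obtain N where fN: "finite N" and NH: "N \<subseteq> carr H" and N1: "\<And>m. m \<in> N \<Longrightarrow> vnorm H m \<le> 1"
    and net: "\<And>x. x \<in> carr H \<Longrightarrow> vnorm H x \<le> 1 \<Longrightarrow> \<exists>m\<in>N. vnorm H (vsub H x m) \<le> 1 - z"
    using H.unit_ball_finite_net[OF fd, of "1 - z"] z by auto
  obtain b n where "basis H b n" using H.ex_basis[OF fd] by blast
  then interpret H: fin_dim_nvspace H b n by unfold_locales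
  define P where "P = fspace N E (N \<rightarrow>\<^sub>E carr E) (\<lambda>_. 0)"
  interpret P: vspace P unfolding P_def using fspace_vector_sp[OF E.vector_sp] by unfold_locales
  have P_simps: "carr P = N \<rightarrow>\<^sub>E carr E" "vadd P f g = (\<lambda>m\<in>N. vadd E (f m) (g m))"
    "vscale P c f = (\<lambda>m\<in>N. vscale E c (f m))" "vzero P = (\<lambda>m\<in>N. vzero E)" for f g c
    by (simp_all add: P_def)
  define mx where "mx y = Max (insert 0 ((\<lambda>m. vnorm E (y m)) ` N))" for y
  have mx_ge: "vnorm E (y m) \<le> mx y" if "m \<in> N" for y m
    unfolding mx_def using fN that by (intro Max_ge) auto
  have mx_le: "mx y \<le> c" if "0 \<le> c" "\<And>m. m \<in> N \<Longrightarrow> vnorm E (y m) \<le> c" for y c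
    unfolding mx_def using fN that by (intro Max.boundedI) auto
  have mx0: "0 \<le> mx y" for y unfolding mx_def using fN by (intro Max_ge) auto
  have mx_cong: "mx y = mx y'" if "\<And>m. m \<in> N \<Longrightarrow> y m = y' m" for y y'
    unfolding mx_def using that by (simp cong: image_cong)
  have Pm: "y m \<in> carr E" if "y \<in> carr P" "m \<in> N" for y m using that by (auto simp: P_simps)
  have mx_add: "mx (vadd P y y') \<le> mx y + mx y'" if y: "y \<in> carr P" "y' \<in> carr P" for y y'
  proof (rule mx_le)
    fix m assume m: "m \<in> N"
    show "vnorm E (vadd P y y' m) \<le> mx y + mx y'"
      using E.norm_triangle[of "y m" "y' m"] Pm y m mx_ge[OF m, of y] mx_ge[OF m, of y']
      by (simp add: P_simps)
  qed (use mx0 in simp)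
  have mx_scale_le: "mx (vscale P c y) \<le> norm c * mx y" if y: "y \<in> carr P" for c y
  proof (rule mx_le)
    fix m assume m: "m \<in> N"
    show "vnorm E (vscale P c y m) \<le> norm c * mx y"
      using E.norm_scale[OF Pm[OF y m]] m mx_ge[OF m, of y] by (simp add: P_simps mult_left_mono)
  qed (use mx0 in simp)
  have mx_scale: "mx (vscale P c y) = norm c * mx y" if y: "y \<in> carr P" for c y
  proof (cases "c = 0")
    case True
    then show ?thesis using mx_scale_le[OF y, of c] mx0[of "vscale P c y"] by simp
  next
    case False
    have "mx y = mx (vscale P (inverse c) (vscale P c y))" using y False by simp
    also have "\<dots> \<le> norm (inverse c) * mx (vscale P c y)" by (rule mx_scale_le) (use y in simp)
    finally have "norm c * mx y \<le> mx (vscale P c y)" using False by (simp add: norm_divide field_simps)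
    then show ?thesis using mx_scale_le[OF y, of c] by simp
  qed
  \<comment> \<open>\<open>G T\<close> depends on the restriction of \<open>T\<close> to \<open>N\<close> only, and is bounded by its maximum norm\<close>
  define G where "G T = (\<Sum>i\<in>I. \<phi> i (T (h i)))" for T
  define p where "p y = K / z * mx y" for y
  have \<phi>l: "linear_map E scalars (\<phi> i)" if "i \<in> I" for i using bounded_opsD(1)[OF \<phi>[OF that] E] .
  have TE: "T x \<in> carr E" if "T \<in> bounded_ops H E" "x \<in> carr H" for T x
    using bounded_opsD(5)[OF that(1) H that(2)] .
  have Gp: "norm (G T) \<le> p T" if T: "T \<in> bounded_ops H E" for T
  proof -
    have "z * op_norm H E T \<le> mx T" using op_norm_net[OF H E T NH net mx_ge] by blast
    then have "K * op_norm H E T \<le> K * (mx T / z)"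
      using K z by (intro mult_left_mono) (simp_all add: field_simps)
    then show ?thesis using bound[OF T] by (simp add: G_def p_def)
  qed
  have Gadd: "G (\<lambda>x\<in>carr H. vadd E (T x) (T' x)) = G T + G T'"
    if "T \<in> bounded_ops H E" "T' \<in> bounded_ops H E" for T T'
    using that TE h linear_map_simps(2)[OF \<phi>l] by (simp add: G_def sum.distrib)
  have Gscale: "G (\<lambda>x\<in>carr H. vscale E c (T x)) = c * G T" if "T \<in> bounded_ops H E" for T c
    using that TE h linear_map_simps(3)[OF \<phi>l] by (simp add: G_def sum_distrib_left)
  have Gcong: "G T = G T'"
    if T: "T \<in> bounded_ops H E" "T' \<in> bounded_ops H E" and eq: "restrict T N = restrict T' N" for T T'
  proof -
    define T'' where "T'' = (\<lambda>x\<in>carr H. vscale E (- 1) (T' x))"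
    define R where "R = (\<lambda>x\<in>carr H. vadd E (T x) (T'' x))"
    have T'': "T'' \<in> bounded_ops H E" unfolding T''_def by (rule bounded_ops_scale[OF T(2) H E])
    have R: "R \<in> bounded_ops H E" unfolding R_def by (rule bounded_ops_add[OF T(1) T'' H E])
    have "R m = vzero E" if m: "m \<in> N" for m
    proof -
      have "T m = T' m" using eq m by (metis restrict_apply')
      then show ?thesis using m NH TE[OF T(2)] by (auto simp: R_def T''_def)
    qed
    then have "mx R \<le> 0" by (intro mx_le) auto
    then have "p R \<le> 0" unfolding p_def using K z by (intro mult_nonneg_nonpos) auto
    then have "G R = 0" using Gp[OF R] by (meson norm_le_zero_iff order_trans)
    moreover have "G R = G T + - 1 * G T'"
      using Gadd[OF T(1) T''] Gscale[OF T(2), of "- 1"] by (simp add: R_def T''_def)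
    ultimately show ?thesis by simp
  qed
  define W where "W = (\<lambda>T. restrict T N) ` bounded_ops H E"
  define k where "k w = G (SOME T. T \<in> bounded_ops H E \<and> w = restrict T N)" for w
  have k: "k (restrict T N) = G T" if T: "T \<in> bounded_ops H E" for T
  proof -
    let ?T = "SOME T'. T' \<in> bounded_ops H E \<and> restrict T N = restrict T' N"
    have "?T \<in> bounded_ops H E \<and> restrict T N = restrict ?T N" by (rule someI[of _ T]) (use T in simp)
    then have "G T = G ?T" using Gcong[OF T] by blast
    then show ?thesis unfolding k_def by (rule sym)
  qed
  have W_add: "vadd P (restrict T N) (restrict T' N) = restrict (\<lambda>x\<in>carr H. vadd E (T x) (T' x)) N" for T T'
    using NH by (auto simp: P_simps fun_eq_iff)
  have W_scale: "vscale P c (restrict T N) = restrict (\<lambda>x\<in>carr H. vscale E c (T x)) N" for c T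
    using NH by (auto simp: P_simps fun_eq_iff)
  have W: "vsubspace P W"
    unfolding vsubspace_def
  proof (intro conjI ballI allI)
    show "W \<subseteq> carr P" using NH TE by (auto simp: W_def P_simps)
    have "vzero P = restrict (\<lambda>x\<in>carr H. vzero E) N" using NH by (auto simp: P_simps fun_eq_iff)
    then show "vzero P \<in> W" using bounded_ops_zero[OF H E] unfolding W_def by blast
  next
    fix x y assume "x \<in> W" "y \<in> W"
    then show "vadd P x y \<in> W" using bounded_ops_add[OF _ _ H E] W_add unfolding W_def by blast
  next
    fix c x assume "x \<in> W"
    then show "vscale P c x \<in> W" using bounded_ops_scale[OF _ H E] W_scale unfolding W_def by blast
  qed
  obtain l where ladd: "\<And>x y. x \<in> carr P \<Longrightarrow> y \<in> carr P \<Longrightarrow> l (vadd P x y) = l x + l y"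
    and lscale: "\<And>c x. x \<in> carr P \<Longrightarrow> l (vscale P c x) = c * l x"
    and lW: "\<And>x. x \<in> W \<Longrightarrow> l x = k x" and lp: "\<And>x. x \<in> carr P \<Longrightarrow> norm (l x) \<le> p x"
  proof (rule P.hahn_banach[of p W k])
    show "p (vadd P x y) \<le> p x + p y" if "x \<in> carr P" "y \<in> carr P" for x y
      using mult_left_mono[OF mx_add[OF that], of "K / z"] K z by (simp add: p_def distrib_left)
    show "p (vscale P c x) = norm c * p x" if "x \<in> carr P" for c x
      using mx_scale[OF that] by (simp add: p_def)
    show "vsubspace P W" by (rule W)
    show "k (vadd P x y) = k x + k y" if xy: "x \<in> W" "y \<in> W" for x y
    proof -
      obtain T T' where "T \<in> bounded_ops H E" "x = restrict T N" "T' \<in> bounded_ops H E" "y = restrict T' N"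
        using xy unfolding W_def by blast
      then show ?thesis using k Gadd bounded_ops_add[OF _ _ H E] by (simp add: W_add del: restrict_restrict)
    qed
    show "k (vscale P c x) = c * k x" if x: "x \<in> W" for c x
    proof -
      obtain T where "T \<in> bounded_ops H E" "x = restrict T N" using x unfolding W_def by blast
      then show ?thesis using k Gscale bounded_ops_scale[OF _ H E] by (simp add: W_scale del: restrict_restrict)
    qed
    show "norm (k x) \<le> p x" if x: "x \<in> W" for x
    proof -
      obtain T where T: "T \<in> bounded_ops H E" "x = restrict T N" using x unfolding W_def by blast
      moreover have "mx x = mx T" using T by (intro mx_cong) auto
      ultimately show ?thesis using k Gp[of T] by (simp add: p_def)
    qed
  qed blast
  define single where "single m e = (\<lambda>m'\<in>N. if m' = m then e else vzero E)" for m e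
  define \<psi> where "\<psi> m = (\<lambda>e\<in>carr E. l (single m e))" for m
  have single: "single m e \<in> carr P" if "e \<in> carr E" for m e using that by (auto simp: single_def P_simps)
  have \<psi>: "\<psi> m \<in> bounded_ops E scalars" if m: "m \<in> N" for m
    unfolding \<psi>_def
  proof (rule bounded_opsI[OF _ E])
    have "single m (vadd E e f) = vadd P (single m e) (single m f)" if "e \<in> carr E" "f \<in> carr E" for e f
      using that by (auto simp: single_def P_simps fun_eq_iff)
    moreover have "single m (vscale E c e) = vscale P c (single m e)" if "e \<in> carr E" for c e
      using that by (auto simp: single_def P_simps fun_eq_iff)
    ultimately show "linear_map E scalars (\<lambda>e. l (single m e))"
      by (simp add: linear_map_scalars_iff ladd lscale single)
    fix e assume e: "e \<in> carr E"
    have "mx (single m e) \<le> vnorm E e" using e by (intro mx_le) (auto simp: single_def)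
    then have "p (single m e) \<le> K / z * vnorm E e" unfolding p_def using K z by (intro mult_left_mono) auto
    then show "vnorm scalars (l (single m e)) \<le> K / z * vnorm E e" using lp[OF single[OF e], of m] by simp
  qed
  have l_sum: "l y = (\<Sum>m\<in>N. \<psi> m (y m))" if y: "y \<in> carr P" for y
  proof -
    define u where "u F = (\<lambda>m\<in>N. if m \<in> F then y m else vzero E)" for F
    have uP: "u F \<in> carr P" for F using Pm[OF y] by (auto simp: P_simps u_def)
    have "l (u F) = (\<Sum>m\<in>F. \<psi> m (y m))" if "finite F" "F \<subseteq> N" for F
      using that
    proof induction
      case empty
      have "u {} = vzero P" by (simp only: u_def P_simps empty_iff if_False)
      moreover have "l (vzero P) = 0" using lscale[OF P.zero_closed, of 0] by simp
      ultimately show ?case by simp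
    next
      case (insert m F)
      have ym: "y m \<in> carr E" using Pm[OF y] insert.prems by blast
      have "u (insert m F) = vadd P (single m (y m)) (u F)"
        using insert.hyps Pm[OF y] by (auto simp: u_def single_def P_simps fun_eq_iff)
      then show ?case using insert ladd[OF single[OF ym] uP] ym by (simp add: \<psi>_def)
    qed
    moreover have "u N = y" using y by (auto simp: u_def P_simps intro: PiE_ext)
    ultimately show ?thesis using fN by (metis order_refl)
  qed
  have \<psi>_sum: "(\<Sum>m\<in>N. op_norm E scalars (\<psi> m)) \<le> K / z"
  proof (rule field_le_epsilon)
    fix \<eta> :: real assume \<eta>: "0 < \<eta>"
    define \<eta>' where "\<eta>' = \<eta> / (real (card N) + 1)"
    have \<eta>': "0 < \<eta>'" "real (card N) * \<eta>' \<le> \<eta>" using \<eta> by (auto simp: \<eta>'_def field_simps)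
    have "\<exists>e r. e \<in> carr E \<and> vnorm E e \<le> 1 \<and> \<psi> m e = of_real r \<and> op_norm E scalars (\<psi> m) - \<eta>' < r"
      if "m \<in> N" for m
      using op_norm_approx[OF E \<psi>[OF that], of "op_norm E scalars (\<psi> m) - \<eta>'"] \<eta>'(1) by force
    then obtain e r where er: "\<And>m. m \<in> N \<Longrightarrow> e m \<in> carr E \<and> vnorm E (e m) \<le> 1 \<and>
        \<psi> m (e m) = of_real (r m) \<and> op_norm E scalars (\<psi> m) - \<eta>' < r m" by metis
    have eP: "restrict e N \<in> carr P" using er by (auto simp: P_simps)
    have "(\<Sum>m\<in>N. op_norm E scalars (\<psi> m) - \<eta>') \<le> (\<Sum>m\<in>N. r m)"
      using er by (intro sum_mono) (auto intro: less_imp_le)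
    also have "\<dots> \<le> norm (of_real (\<Sum>m\<in>N. r m) :: 'k)" by (simp only: norm_of_real abs_ge_self)
    also have "of_real (\<Sum>m\<in>N. r m) = l (restrict e N)"
      using l_sum[OF eP] er by simp
    also have "norm (l (restrict e N)) \<le> K / z * 1"
      using lp[OF eP] mx_le[of 1 "restrict e N"] er K z
        mult_left_mono[of "mx (restrict e N)" 1 "K / z"] by (simp add: p_def)
    finally show "(\<Sum>m\<in>N. op_norm E scalars (\<psi> m)) \<le> K / z + \<eta>"
      using \<eta>'(2) by (simp add: sum_subtractf)
  qed
  have tensor_eq: "(\<lambda>e\<in>carr E. \<Sum>i\<in>I. coord H b n (h i) j * \<phi> i e)
      = (\<lambda>e\<in>carr E. \<Sum>m\<in>N. coord H b n m j * \<psi> m e)" if j: "j < n" for j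
  proof (rule restrict_ext)
    fix e assume e: "e \<in> carr E"
    obtain M where M: "0 \<le> M" "\<And>x i. x \<in> carr H \<Longrightarrow> i < n \<Longrightarrow> norm (coord H b n x i) \<le> M * vnorm H x"
      using H.coord_bound by blast
    \<comment> \<open>an operator of rank one detects the coefficient of \<open>b j\<close> in both tensors\<close>
    define T where "T = (\<lambda>x\<in>carr H. vscale E (coord H b n x j) e)"
    have T: "T \<in> bounded_ops H E"
      unfolding T_def
    proof (rule bounded_opsI[OF _ H])
      show "linear_map H E (\<lambda>x. vscale E (coord H b n x j) e)"
        unfolding linear_map_def using e j by (auto simp: H.coord_add H.coord_scale E.scale_left)
      show "vnorm E (vscale E (coord H b n x j) e) \<le> M * vnorm E e * vnorm H x" if "x \<in> carr H" for x
        using E.norm_scale[OF e] mult_right_mono[OF M(2)[OF that j] E.norm_nonneg[OF e]]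
        by (simp add: mult_ac)
    qed
    have rT: "restrict T N \<in> W" "restrict T N \<in> carr P" using T W unfolding W_def vsubspace_def by auto
    have "G T = l (restrict T N)" using k[OF T] lW[OF rT(1)] by simp
    also have "\<dots> = (\<Sum>m\<in>N. \<psi> m (vscale E (coord H b n m j) e))"
      using l_sum[OF rT(2)] NH by (auto simp: T_def intro!: sum.cong)
    also have "\<dots> = (\<Sum>m\<in>N. coord H b n m j * \<psi> m e)"
      using linear_map_simps(3)[OF bounded_opsD(1)[OF \<psi> E] e] by simp
    finally show "(\<Sum>i\<in>I. coord H b n (h i) j * \<phi> i e) = (\<Sum>m\<in>N. coord H b n m j * \<psi> m e)"
      using linear_map_simps(3)[OF \<phi>l e] h by (simp add: G_def T_def)
  qed
  have Sl: "linear_map (ndual E) scalars (S x)" if "x \<in> carr H" for x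
    using linear_map_simps(1)[OF S that] by (simp add: bounded_ops_def)
  have expand: "(\<Sum>i\<in>I'. S (x i) (f i))
      = (\<Sum>j<n. S (b j) (\<lambda>e\<in>carr E. \<Sum>i\<in>I'. coord H b n (x i) j * f i e))"
    if I': "finite I'" and x: "\<And>i. i \<in> I' \<Longrightarrow> x i \<in> carr H"
      and f: "\<And>i. i \<in> I' \<Longrightarrow> f i \<in> bounded_ops E scalars"
    for I' :: "'i set" and x f
  proof -
    have "S (x i) (f i) = (\<Sum>j<n. coord H b n (x i) j * S (b j) (f i))" if i: "i \<in> I'" for i
    proof (rule H.functional_coord[OF _ x[OF i]])
      show "linear_map H scalars (\<lambda>y. S y (f i))"
        unfolding linear_map_scalars_iff using linear_map_simps[OF S] f[OF i] by simp
    qed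
    then have "(\<Sum>i\<in>I'. S (x i) (f i)) = (\<Sum>j<n. \<Sum>i\<in>I'. coord H b n (x i) j * S (b j) (f i))"
      by (simp add: sum.swap[of _ _ I'])
    then show ?thesis using functional_sum[OF I' f E Sl] by simp
  qed
  have "(\<Sum>i\<in>I. S (h i) (\<phi> i)) = (\<Sum>j<n. S (b j) (\<lambda>e\<in>carr E. \<Sum>i\<in>I. coord H b n (h i) j * \<phi> i e))"
    by (rule expand[OF I h \<phi>])
  also have "\<dots> = (\<Sum>j<n. S (b j) (\<lambda>e\<in>carr E. \<Sum>m\<in>N. coord H b n m j * \<psi> m e))"
    using tensor_eq by simp
  also have "\<dots> = (\<Sum>m\<in>N. S m (\<psi> m))"
    by (rule expand[symmetric]) (use fN NH \<psi> in auto)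
  finally have "norm (\<Sum>i\<in>I. S (h i) (\<phi> i)) \<le> (\<Sum>m\<in>N. norm (S m (\<psi> m)))" by (simp add: norm_sum)
  also have "\<dots> \<le> (\<Sum>m\<in>N. op_norm E scalars (\<psi> m))"
  proof (rule sum_mono)
    fix m assume m: "m \<in> N"
    then have mc: "m \<in> carr H" using NH by blast
    have "S m \<in> bounded_ops (ndual E) scalars" using linear_map_simps(1)[OF S mc] by simp
    note SD = bounded_opsD[OF this dE]
    have "norm (S m (\<psi> m)) \<le> op_norm (ndual E) scalars (S m) * op_norm E scalars (\<psi> m)"
      using SD(4)[of "\<psi> m"] \<psi>[OF m] by simp
    also have "\<dots> \<le> 1 * op_norm E scalars (\<psi> m)"
      using S1[OF mc] N1[OF m] bounded_opsD(3)[OF \<psi>[OF m] E] by (intro mult_right_mono) auto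
    finally show "norm (S m (\<psi> m)) \<le> op_norm E scalars (\<psi> m)" by simp
  qed
  also have "\<dots> \<le> K / z" by (rule \<psi>_sum)
  finally show "z * norm (\<Sum>i\<in>I. S (h i) (\<phi> i)) \<le> K" using z by (simp add: field_simps)
qed

section \<open>Functionals on the completion\<close>

context nvspace
begin

abbreviation null_seqs :: "(nat \<Rightarrow> 'b) set" where
  "null_seqs \<equiv> {s \<in> carr (cauchy_seqs V). (\<lambda>n. vnorm V (s n)) \<longlonglongrightarrow> 0}"

lemma cauchyD: "cauchy s \<Longrightarrow> s n \<in> carr V"
  by (simp add: cauchy_def)

lemma cauchy_seqs_simps [simp]:
  "carr (cauchy_seqs V) = {s. cauchy s}" "vadd (cauchy_seqs V) s t = (\<lambda>n. s n \<oplus> t n)"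
  "vzero (cauchy_seqs V) = (\<lambda>n. \<zero>)" "vscale (cauchy_seqs V) c s = (\<lambda>n. c \<odot> s n)"
  "vnorm (cauchy_seqs V) s = lim (\<lambda>n. vnorm V (s n))"
  by (simp_all add: cauchy_seqs_def MCauchy_nmetric restrict_def)

lemma cauchy_const: "v \<in> carr V \<Longrightarrow> cauchy (\<lambda>n. v)"
  by (simp add: cauchy_def)

lemma cauchy_add:
  assumes s: "cauchy s" and t: "cauchy t"
  shows "cauchy (\<lambda>n. s n \<oplus> t n)"
  unfolding cauchy_def
proof (intro conjI allI impI)
  fix e :: real assume "0 < e"
  then have e: "0 < e / 2" by simp
  obtain N where N: "\<And>m n. m \<ge> N \<Longrightarrow> n \<ge> N \<Longrightarrow> vnorm V (vsub V (s m) (s n)) < e / 2"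
    using s e unfolding cauchy_def by meson
  obtain M where M: "\<And>m n. m \<ge> M \<Longrightarrow> n \<ge> M \<Longrightarrow> vnorm V (vsub V (t m) (t n)) < e / 2"
    using t e unfolding cauchy_def by meson
  have "vnorm V (vsub V (s m \<oplus> t m) (s n \<oplus> t n)) < e" if mn: "m \<ge> max N M" "n \<ge> max N M" for m n
  proof -
    have "vnorm V (vsub V (s m \<oplus> t m) (s n \<oplus> t n)) \<le> vnorm V (vsub V (s m) (s n)) + vnorm V (vsub V (t m) (t n))"
      using norm_triangle[of "vsub V (s m) (s n)" "vsub V (t m) (t n)"] cauchyD[OF s] cauchyD[OF t]
      by (simp add: sub_add_sub)
    then show ?thesis using N[of m n] M[of m n] mn by simp
  qed
  then show "\<exists>N. \<forall>m\<ge>N. \<forall>n\<ge>N. vnorm V (vsub V (s m \<oplus> t m) (s n \<oplus> t n)) < e" by blast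
qed (use cauchyD[OF s] cauchyD[OF t] in simp)

lemma cauchy_scale:
  assumes s: "cauchy s"
  shows "cauchy (\<lambda>n. c \<odot> s n)"
  unfolding cauchy_def
proof (intro conjI allI impI)
  fix e :: real assume e0: "0 < e"
  have c1: "0 < norm c + 1" by (simp add: add_nonneg_pos)
  then have "0 < e / (norm c + 1)" using e0 by simp
  then obtain N where N: "\<And>m n. m \<ge> N \<Longrightarrow> n \<ge> N \<Longrightarrow> vnorm V (vsub V (s m) (s n)) < e / (norm c + 1)"
    using s unfolding cauchy_def by meson
  have "vnorm V (vsub V (c \<odot> s m) (c \<odot> s n)) < e" if mn: "m \<ge> N" "n \<ge> N" for m n
  proof -
    have "vnorm V (vsub V (c \<odot> s m) (c \<odot> s n)) = norm c * vnorm V (vsub V (s m) (s n))"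
      using norm_scale[of "vsub V (s m) (s n)" c] cauchyD[OF s] by (simp add: scale_sub)
    also have "\<dots> \<le> norm c * (e / (norm c + 1))" using N[OF mn] by (intro mult_left_mono) auto
    also have "\<dots> < e" using e0 c1 by (simp add: field_simps)
    finally show ?thesis .
  qed
  then show "\<exists>N. \<forall>m\<ge>N. \<forall>n\<ge>N. vnorm V (vsub V (c \<odot> s m) (c \<odot> s n)) < e" by blast
qed (use cauchyD[OF s] in simp)

lemma cauchy_seqs_vector_sp: "vector_sp (cauchy_seqs V)"
  unfolding vector_sp_def vsub_def cauchy_seqs_simps mem_Collect_eq
  using cauchy_const[OF zero_closed] cauchy_add cauchy_scale
  by (auto simp: fun_eq_iff cauchyD add_assoc scale_add scale_left intro: add_comm cauchyD)

lemma vsub_cauchy_seqs: "vsub (cauchy_seqs V) s t = (\<lambda>n. vsub V (s n) (t n))"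
  by (simp add: vsub_def)

lemma cauchy_norm_tendsto:
  assumes s: "cauchy s"
  shows "(\<lambda>n. vnorm V (s n)) \<longlonglongrightarrow> vnorm (cauchy_seqs V) s"
proof -
  have "Cauchy (\<lambda>n. vnorm V (s n))"
  proof (rule metric_CauchyI)
    fix e :: real assume "0 < e"
    then obtain N where N: "\<And>m n. m \<ge> N \<Longrightarrow> n \<ge> N \<Longrightarrow> vnorm V (vsub V (s m) (s n)) < e"
      using s unfolding cauchy_def by meson
    have "dist (vnorm V (s m)) (vnorm V (s n)) < e" if "m \<ge> N" "n \<ge> N" for m n
      using N[OF that] abs_norm_sub_le[OF cauchyD[OF s] cauchyD[OF s], of m n] by (simp add: dist_real_def)
    then show "\<exists>N. \<forall>m\<ge>N. \<forall>n\<ge>N. dist (vnorm V (s m)) (vnorm V (s n)) < e" by blast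
  qed
  then show ?thesis by (simp add: Cauchy_convergent_iff convergent_LIMSEQ_iff)
qed

lemma null_seqs_subspace: "vsubspace (cauchy_seqs V) null_seqs"
  unfolding vsubspace_def
proof (intro conjI ballI allI)
  fix s t assume s: "s \<in> null_seqs" and t: "t \<in> null_seqs"
  then have c: "cauchy s" "cauchy t" by simp_all
  have lim: "(\<lambda>n. vnorm V (s n) + vnorm V (t n)) \<longlonglongrightarrow> 0"
    using tendsto_add[of "\<lambda>n. vnorm V (s n)" 0 sequentially "\<lambda>n. vnorm V (t n)" 0] s t by simp
  have "(\<lambda>n. vnorm V (s n \<oplus> t n)) \<longlonglongrightarrow> 0"
    by (rule tendsto_sandwich[OF _ _ tendsto_const lim])
      (use cauchyD[OF c(1)] cauchyD[OF c(2)] in \<open>auto intro!: always_eventually norm_triangle\<close>)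
  then show "vadd (cauchy_seqs V) s t \<in> null_seqs" using c cauchy_add by simp
next
  fix c :: 'a and s assume s: "s \<in> null_seqs"
  have "(\<lambda>n. norm c * vnorm V (s n)) \<longlonglongrightarrow> norm c * 0" using s by (intro tendsto_mult tendsto_const) simp
  then show "vscale (cauchy_seqs V) c s \<in> null_seqs"
    using s cauchy_scale by (simp add: norm_scale cauchyD)
qed (use cauchy_const[OF zero_closed] in auto)

sublocale cauchy_seqs: vspace "cauchy_seqs V"
  by unfold_locales (rule cauchy_seqs_vector_sp)

abbreviation limit_class :: "(nat \<Rightarrow> 'b) \<Rightarrow> (nat \<Rightarrow> 'b) set" where
  "limit_class \<equiv> vcoset (cauchy_seqs V) null_seqs"

lemma into_completion_eq: "into_completion V v = limit_class (\<lambda>n. v)"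
  by (simp add: into_completion_def)

lemma completion_vector_sp: "vector_sp (ncompletion V)"
  unfolding ncompletion_def by (rule cauchy_seqs.quotient_vector_sp[OF null_seqs_subspace])

lemma completion_carr: "carr (ncompletion V) = limit_class ` {s. cauchy s}"
  unfolding ncompletion_def cauchy_seqs.quotient_carr[OF null_seqs_subspace] by simp

lemma completion_linear: "linear_map (cauchy_seqs V) (ncompletion V) limit_class"
  unfolding ncompletion_def by (rule cauchy_seqs.quotient_linear_map[OF null_seqs_subspace])

lemma into_completion_linear: "linear_map V (ncompletion V) (into_completion V)"
  using linear_map_simps[OF completion_linear] cauchy_const
  unfolding linear_map_def into_completion_eq by auto

lemma limit_class_mem:
  assumes s: "cauchy s"
  shows "s \<in> limit_class s"
    and "t \<in> limit_class s \<Longrightarrow> cauchy t"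
    and "t \<in> limit_class s \<Longrightarrow> limit_class t = limit_class s"
proof -
  have "s = vadd (cauchy_seqs V) s (vzero (cauchy_seqs V))" using cauchyD[OF s] by simp
  moreover have "vzero (cauchy_seqs V) \<in> null_seqs" using null_seqs_subspace unfolding vsubspace_def by blast
  ultimately show "s \<in> limit_class s" unfolding vcoset_def by blast
  assume "t \<in> limit_class s"
  then obtain l where l: "t = vadd (cauchy_seqs V) s l" "l \<in> null_seqs" unfolding vcoset_def by blast
  then have lc: "cauchy l" by simp
  show t: "cauchy t" using cauchy_add[OF s lc] l(1) by simp
  have "vsub (cauchy_seqs V) t s = l"
    using cauchy_seqs.add_sub_cancel[of l s] cauchy_seqs.add_comm[of l s] s lc l(1)
    by (simp del: cauchy_seqs_simps(2))
  then show "limit_class t = limit_class s"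
    using cauchy_seqs.coset_eq_iff[OF null_seqs_subspace, of t s] s t l(2) by simp
qed

lemma completion_norm:
  assumes s: "cauchy s"
  shows "0 \<le> vnorm (ncompletion V) (limit_class s)"
    and "vnorm (ncompletion V) (limit_class s) \<le> vnorm (cauchy_seqs V) s"
proof -
  have nn: "0 \<le> vnorm (cauchy_seqs V) t" if "cauchy t" for t
    using cauchy_norm_tendsto[OF that] cauchyD[OF that] by (intro LIMSEQ_le_const) auto
  have eq: "vnorm (ncompletion V) (limit_class s) = Inf (vnorm (cauchy_seqs V) ` limit_class s)"
    by (simp add: ncompletion_def quotient_def)
  show "0 \<le> vnorm (ncompletion V) (limit_class s)"
    unfolding eq using limit_class_mem[OF s] nn by (intro cINF_greatest) blast+
  show "vnorm (ncompletion V) (limit_class s) \<le> vnorm (cauchy_seqs V) s"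
    unfolding eq using limit_class_mem[OF s] nn by (intro cINF_lower bdd_belowI2[where m = 0]) blast+
qed

lemma into_completion_norm_le:
  assumes "v \<in> carr V"
  shows "vnorm (ncompletion V) (into_completion V v) \<le> vnorm V v"
  using completion_norm(2)[OF cauchy_const[OF assms]] by (simp add: into_completion_eq)

text \<open>
  The norm of a class is an infimum over its members, so the limit has to be the same along all of
  them.
\<close>

lemma functional_limit_le:
  assumes \<phi>: "\<phi> \<in> bounded_ops V scalars" and s: "cauchy s"
    and lim: "\<And>t. t \<in> limit_class s \<Longrightarrow> (\<lambda>n. \<phi> (t n)) \<longlonglongrightarrow> z"
  shows "norm z \<le> op_norm V scalars \<phi> * vnorm (ncompletion V) (limit_class s)"
proof -
  note \<phi>D = bounded_opsD[OF \<phi> normed_sp]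
  let ?o = "op_norm V scalars \<phi>"
  have le: "norm z \<le> ?o * vnorm (cauchy_seqs V) t" if t: "t \<in> limit_class s" for t
  proof (rule LIMSEQ_le)
    have tc: "cauchy t" using limit_class_mem(2)[OF s t] .
    show "(\<lambda>n. norm (\<phi> (t n))) \<longlonglongrightarrow> norm z" using lim[OF t] by (rule tendsto_norm)
    show "(\<lambda>n. ?o * vnorm V (t n)) \<longlonglongrightarrow> ?o * vnorm (cauchy_seqs V) t"
      using cauchy_norm_tendsto[OF tc] by (rule tendsto_mult_left)
    show "\<exists>N. \<forall>n\<ge>N. norm (\<phi> (t n)) \<le> ?o * vnorm V (t n)" using \<phi>D(4) cauchyD[OF tc] by simp
  qed
  have eq: "vnorm (ncompletion V) (limit_class s) = (INF t\<in>limit_class s. vnorm (cauchy_seqs V) t)"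
    by (simp add: ncompletion_def quotient_def)
  show ?thesis
  proof (cases "?o = 0")
    case True
    then show ?thesis using le[OF limit_class_mem(1)[OF s]] by simp
  next
    case False
    then have o: "0 < ?o" using \<phi>D(3) by simp
    have "norm z / ?o \<le> vnorm (ncompletion V) (limit_class s)"
      unfolding eq using limit_class_mem(1)[OF s] le o
      by (intro cINF_greatest) (auto simp: pos_divide_le_eq[OF o] mult.commute simp del: cauchy_seqs_simps)
    then show ?thesis using o by (simp add: pos_divide_le_eq mult.commute)
  qed
qed

lemma completion_functional_bound:
  assumes "\<Phi> \<in> bounded_ops (ncompletion V) scalars"
  shows "0 \<le> op_norm (ncompletion V) scalars \<Phi>"
    and "cauchy s \<Longrightarrow> norm (\<Phi> (limit_class s)) \<le>
      op_norm (ncompletion V) scalars \<Phi> * vnorm (ncompletion V) (limit_class s)"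
proof -
  have nn: "0 \<le> vnorm (ncompletion V) x" if "x \<in> carr (ncompletion V)" for x
    using that completion_norm(1) by (auto simp: completion_carr)
  have ex: "\<exists>C. \<forall>x\<in>carr (ncompletion V). vnorm scalars (\<Phi> x) \<le> C * vnorm (ncompletion V) x"
    using assms unfolding bounded_ops_def by blast
  show "0 \<le> op_norm (ncompletion V) scalars \<Phi>" using op_norm_bound(1)[OF ex nn] .
  show "norm (\<Phi> (limit_class s)) \<le> op_norm (ncompletion V) scalars \<Phi> * vnorm (ncompletion V) (limit_class s)"
    if "cauchy s"
    using op_norm_bound(2)[OF ex nn, of "limit_class s"] that by (simp add: completion_carr)
qed

text \<open>The constant sequences of the terms of \<open>s\<close> converge to the class of \<open>s\<close>, as \<open>s\<close> is Cauchy.\<close>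

lemma completion_functional_tendsto:
  assumes \<Phi>: "\<Phi> \<in> bounded_ops (ncompletion V) scalars" and s: "cauchy s"
  shows "(\<lambda>n. \<Phi> (into_completion V (s n))) \<longlonglongrightarrow> \<Phi> (limit_class s)"
proof (rule metric_LIMSEQ_I)
  let ?o = "op_norm (ncompletion V) scalars \<Phi>"
  have \<Phi>l: "linear_map (ncompletion V) scalars \<Phi>" using \<Phi> unfolding bounded_ops_def by blast
  note lin = linear_map_comp[OF completion_linear \<Phi>l]
  have o: "0 \<le> ?o" by (rule completion_functional_bound[OF \<Phi>])
  fix e :: real assume e: "0 < e"
  then have "0 < e / (2 * (?o + 1))" using o by simp
  then obtain N where N: "\<And>m n. m \<ge> N \<Longrightarrow> n \<ge> N \<Longrightarrow> vnorm V (vsub V (s m) (s n)) < e / (2 * (?o + 1))"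
    using s unfolding cauchy_def by meson
  have "dist (\<Phi> (into_completion V (s n))) (\<Phi> (limit_class s)) < e" if n: "n \<ge> N" for n
  proof -
    let ?d = "vsub (cauchy_seqs V) s (\<lambda>_. s n)"
    have sc: "cauchy (\<lambda>_. s n)" using cauchy_const cauchyD[OF s] by blast
    have d: "cauchy ?d" using cauchy_seqs.sub_closed[of s "\<lambda>_. s n"] s sc by simp
    have "\<Phi> (limit_class ?d) = \<Phi> (limit_class s) - \<Phi> (into_completion V (s n))"
      using cauchy_seqs.linear_map_sub[OF lin, of s "\<lambda>_. s n"] s sc by (simp add: into_completion_eq)
    then have "dist (\<Phi> (into_completion V (s n))) (\<Phi> (limit_class s)) = norm (\<Phi> (limit_class ?d))"
      by (simp add: dist_norm norm_minus_commute)
    also have "\<dots> \<le> ?o * vnorm (ncompletion V) (limit_class ?d)"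
      by (rule completion_functional_bound(2)[OF \<Phi> d])
    also have "\<dots> \<le> ?o * (e / (2 * (?o + 1)))"
    proof (rule mult_left_mono[OF _ o])
      have "vnorm (cauchy_seqs V) ?d \<le> e / (2 * (?o + 1))"
        using cauchy_norm_tendsto[OF d] N[OF _ n]
        by (intro LIMSEQ_le_const2) (auto simp: vsub_cauchy_seqs intro: less_imp_le)
      then show "vnorm (ncompletion V) (limit_class ?d) \<le> e / (2 * (?o + 1))"
        using completion_norm(2)[OF d] by linarith
    qed
    also have "\<dots> < e"
    proof -
      have "0 < e * 2 + e * ?o" using e o by (intro add_pos_nonneg) auto
      then show ?thesis using o by (simp add: field_simps)
    qed
    finally show ?thesis .
  qed
  then show "\<exists>N. \<forall>n\<ge>N. dist (\<Phi> (into_completion V (s n))) (\<Phi> (limit_class s)) < e" by blast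
qed

lemma functional_cauchy_convergent:
  assumes \<phi>: "\<phi> \<in> bounded_ops V scalars" and s: "cauchy s"
  obtains z where "(\<lambda>n. \<phi> (s n)) \<longlonglongrightarrow> z"
proof -
  note \<phi>D = bounded_opsD[OF \<phi> normed_sp]
  let ?o = "op_norm V scalars \<phi>"
  have "Cauchy (\<lambda>n. \<phi> (s n))"
  proof (rule metric_CauchyI)
    fix e :: real assume e: "0 < e"
    then have "0 < e / (?o + 1)" using \<phi>D(3) by simp
    then obtain N where N: "\<And>m n. m \<ge> N \<Longrightarrow> n \<ge> N \<Longrightarrow> vnorm V (vsub V (s m) (s n)) < e / (?o + 1)"
      using s unfolding cauchy_def by meson
    have "dist (\<phi> (s m)) (\<phi> (s n)) < e" if mn: "m \<ge> N" "n \<ge> N" for m n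
    proof -
      have "dist (\<phi> (s m)) (\<phi> (s n)) = norm (\<phi> (vsub V (s m) (s n)))"
        using linear_map_sub[OF \<phi>D(1) cauchyD[OF s] cauchyD[OF s]] by (simp add: dist_norm)
      also have "\<dots> \<le> ?o * vnorm V (vsub V (s m) (s n))" using \<phi>D(4) cauchyD[OF s] by simp
      also have "\<dots> \<le> ?o * (e / (?o + 1))" using N[OF mn] \<phi>D(3) by (intro mult_left_mono) auto
      also have "\<dots> < e" using e \<phi>D(3) by (simp add: field_simps)
      finally show ?thesis .
    qed
    then show "\<exists>N. \<forall>m\<ge>N. \<forall>n\<ge>N. dist (\<phi> (s m)) (\<phi> (s n)) < e" by blast
  qed
  then show ?thesis using real_or_complex_Cauchy_convergent that by blast
qed

lemma functional_extension:
  assumes \<phi>: "\<phi> \<in> bounded_ops V scalars"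
  obtains \<Phi> where "\<Phi> \<in> bounded_ops (ncompletion V) scalars"
    and "\<And>v. v \<in> carr V \<Longrightarrow> \<Phi> (into_completion V v) = \<phi> v"
proof -
  note \<phi>D = bounded_opsD[OF \<phi> normed_sp]
  define \<Phi> where "\<Phi> A = lim (\<lambda>n. \<phi> ((SOME s. s \<in> A) n))" for A
  have lim: "(\<lambda>n. \<phi> (s n)) \<longlonglongrightarrow> \<Phi> (limit_class s)" if s: "cauchy s" for s
  proof -
    define t where "t = (SOME t. t \<in> limit_class s)"
    have t: "t \<in> limit_class s" unfolding t_def
      by (rule someI[where P = "\<lambda>t. t \<in> limit_class s"], rule limit_class_mem(1)[OF s])
    have tc: "cauchy t" using limit_class_mem(2)[OF s t] .
    obtain z where z: "(\<lambda>n. \<phi> (t n)) \<longlonglongrightarrow> z" using functional_cauchy_convergent[OF \<phi> tc] .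
    have "vsub (cauchy_seqs V) s t \<in> null_seqs"
      using cauchy_seqs.coset_eq_iff[OF null_seqs_subspace, of s t] limit_class_mem(3)[OF s t] s tc by simp
    then have 0: "(\<lambda>n. op_norm V scalars \<phi> * vnorm V (vsub V (s n) (t n))) \<longlonglongrightarrow> 0"
      using tendsto_mult_left[of "\<lambda>n. vnorm V (vsub V (s n) (t n))" 0 sequentially "op_norm V scalars \<phi>"]
      by (simp add: vsub_cauchy_seqs)
    have "(\<lambda>n. \<phi> (vsub V (s n) (t n))) \<longlonglongrightarrow> 0"
      by (rule Lim_null_comparison[OF _ 0]) (use \<phi>D(4) cauchyD[OF s] cauchyD[OF tc] in auto)
    then have "(\<lambda>n. \<phi> (vsub V (s n) (t n)) + \<phi> (t n)) \<longlonglongrightarrow> 0 + z" using z by (rule tendsto_add)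
    moreover have "\<phi> (vsub V (s n) (t n)) + \<phi> (t n) = \<phi> (s n)" for n
      using linear_map_sub[OF \<phi>D(1) cauchyD[OF s] cauchyD[OF tc]] by simp
    moreover have "\<Phi> (limit_class s) = z" using limI[OF z] by (simp add: \<Phi>_def t_def)
    ultimately show ?thesis by simp
  qed
  have "linear_map (ncompletion V) scalars \<Phi>"
    unfolding linear_map_scalars_iff
  proof (intro conjI ballI allI)
    fix x y assume "x \<in> carr (ncompletion V)" "y \<in> carr (ncompletion V)"
    then obtain s t where st: "x = limit_class s" "cauchy s" "y = limit_class t" "cauchy t"
      by (auto simp: completion_carr)
    have "vadd (ncompletion V) x y = limit_class (\<lambda>n. s n \<oplus> t n)"
      using linear_map_simps(2)[OF completion_linear, of s t] st by simp
    moreover have "(\<lambda>n. \<phi> (s n \<oplus> t n)) \<longlonglongrightarrow> \<Phi> x + \<Phi> y"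
      using tendsto_add[OF lim[OF st(2)] lim[OF st(4)]] linear_map_simps(2)[OF \<phi>D(1)] st cauchyD by simp
    ultimately show "\<Phi> (vadd (ncompletion V) x y) = \<Phi> x + \<Phi> y"
      using LIMSEQ_unique[OF lim[OF cauchy_add[OF st(2,4)]]] by simp
  next
    fix c x assume "x \<in> carr (ncompletion V)"
    then obtain s where s: "x = limit_class s" "cauchy s" by (auto simp: completion_carr)
    have "vscale (ncompletion V) c x = limit_class (\<lambda>n. c \<odot> s n)"
      using linear_map_simps(3)[OF completion_linear, of s c] s by simp
    moreover have "(\<lambda>n. \<phi> (c \<odot> s n)) \<longlonglongrightarrow> c * \<Phi> x"
      using tendsto_mult_left[OF lim[OF s(2)], of c] linear_map_simps(3)[OF \<phi>D(1)] s cauchyD by simp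
    ultimately show "\<Phi> (vscale (ncompletion V) c x) = c * \<Phi> x"
      using LIMSEQ_unique[OF lim[OF cauchy_scale[OF s(2)]]] by simp
  qed
  then have lin: "linear_map (ncompletion V) scalars (restrict \<Phi> (carr (ncompletion V)))"
    by (rule restrict_linear_map) (rule completion_vector_sp)
  have "norm (\<Phi> x) \<le> op_norm V scalars \<phi> * vnorm (ncompletion V) x" if x: "x \<in> carr (ncompletion V)" for x
  proof -
    obtain s where s: "x = limit_class s" "cauchy s" using x by (auto simp: completion_carr)
    have "(\<lambda>n. \<phi> (t n)) \<longlonglongrightarrow> \<Phi> (limit_class s)" if t: "t \<in> limit_class s" for t
      using lim[OF limit_class_mem(2)[OF s(2) t]] unfolding limit_class_mem(3)[OF s(2) t] .
    then show ?thesis unfolding s(1) by (rule functional_limit_le[OF \<phi> s(2)])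
  qed
  then have "restrict \<Phi> (carr (ncompletion V)) \<in> bounded_ops (ncompletion V) scalars"
    unfolding bounded_ops_def using lin by auto
  moreover have "restrict \<Phi> (carr (ncompletion V)) (into_completion V v) = \<phi> v" if v: "v \<in> carr V" for v
    using LIMSEQ_unique[OF lim[OF cauchy_const[OF v]] tendsto_const] cauchy_const[OF v]
    by (auto simp: into_completion_eq completion_carr)
  ultimately show ?thesis using that by blast
qed

theorem completion_dual:
  shows "bij_betw (\<lambda>\<Phi>. \<lambda>v\<in>carr V. \<Phi> (into_completion V v))
      (bounded_ops (ncompletion V) scalars) (bounded_ops V scalars)" (is "bij_betw ?R _ _")
    and "\<Phi> \<in> bounded_ops (ncompletion V) scalars \<Longrightarrow>
      op_norm V scalars (\<lambda>v\<in>carr V. \<Phi> (into_completion V v)) = op_norm (ncompletion V) scalars \<Phi>"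
proof -
  have R: "?R \<Phi> \<in> bounded_ops V scalars"
    and Rle: "op_norm V scalars (?R \<Phi>) \<le> op_norm (ncompletion V) scalars \<Phi>"
    if \<Phi>: "\<Phi> \<in> bounded_ops (ncompletion V) scalars" for \<Phi>
  proof -
    have "linear_map (ncompletion V) scalars \<Phi>" using \<Phi> unfolding bounded_ops_def by blast
    then have "linear_map V scalars (\<lambda>v. \<Phi> (into_completion V v))"
      by (rule linear_map_comp[OF into_completion_linear])
    note m = ndual_mem[OF this normed_sp _ completion_functional_bound(1)[OF \<Phi>]]
    have "norm (\<Phi> (into_completion V v)) \<le> op_norm (ncompletion V) scalars \<Phi> * vnorm V v"
      if v: "v \<in> carr V" for v
      using completion_functional_bound(2)[OF \<Phi> cauchy_const[OF v]]
        mult_left_mono[OF into_completion_norm_le[OF v] completion_functional_bound(1)[OF \<Phi>]]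
      by (simp add: into_completion_eq)
    then show "?R \<Phi> \<in> bounded_ops V scalars"
      "op_norm V scalars (?R \<Phi>) \<le> op_norm (ncompletion V) scalars \<Phi>"
      using m by simp_all
  qed
  have lim: "(\<lambda>n. ?R \<Phi> (s n)) \<longlonglongrightarrow> \<Phi> (limit_class s)"
    if "\<Phi> \<in> bounded_ops (ncompletion V) scalars" "cauchy s" for \<Phi> s
    using completion_functional_tendsto[OF that] cauchyD[OF that(2)] by simp
  show "op_norm V scalars (?R \<Phi>) = op_norm (ncompletion V) scalars \<Phi>"
    if \<Phi>: "\<Phi> \<in> bounded_ops (ncompletion V) scalars" for \<Phi>
  proof (rule antisym[OF Rle[OF \<Phi>]])
    show "op_norm (ncompletion V) scalars \<Phi> \<le> op_norm V scalars (?R \<Phi>)"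
    proof (rule op_norm_le)
      show "0 \<le> op_norm V scalars (?R \<Phi>)" using bounded_opsD(3)[OF R[OF \<Phi>] normed_sp] .
      fix x assume "x \<in> carr (ncompletion V)"
      then obtain s where s: "x = limit_class s" "cauchy s" by (auto simp: completion_carr)
      have "(\<lambda>n. ?R \<Phi> (t n)) \<longlonglongrightarrow> \<Phi> x" if "t \<in> limit_class s" for t
        using lim[OF \<Phi> limit_class_mem(2)[OF s(2) that]] limit_class_mem(3)[OF s(2) that] s(1) by simp
      then show "vnorm scalars (\<Phi> x) \<le> op_norm V scalars (?R \<Phi>) * vnorm (ncompletion V) x"
        using functional_limit_le[OF R[OF \<Phi>] s(2)] s(1) by simp
    qed
  qed
  show "bij_betw ?R (bounded_ops (ncompletion V) scalars) (bounded_ops V scalars)"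
  proof (rule bij_betwI')
    fix \<Phi> \<Psi> assume m: "\<Phi> \<in> bounded_ops (ncompletion V) scalars" "\<Psi> \<in> bounded_ops (ncompletion V) scalars"
    have "\<Phi> = \<Psi>" if eq: "?R \<Phi> = ?R \<Psi>"
    proof (rule extensionalityI[of _ "carr (ncompletion V)"])
      fix x assume "x \<in> carr (ncompletion V)"
      then obtain s where s: "x = limit_class s" "cauchy s" by (auto simp: completion_carr)
      show "\<Phi> x = \<Psi> x"
        using LIMSEQ_unique[OF lim[OF m(1) s(2)]] lim[OF m(2) s(2)] eq s(1) by metis
    qed (use m in \<open>auto simp: bounded_ops_def\<close>)
    then show "?R \<Phi> = ?R \<Psi> \<longleftrightarrow> \<Phi> = \<Psi>" by blast
  next
    fix \<phi> assume \<phi>: "\<phi> \<in> bounded_ops V scalars"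
    obtain \<Phi> where \<Phi>: "\<Phi> \<in> bounded_ops (ncompletion V) scalars"
      "\<And>v. v \<in> carr V \<Longrightarrow> \<Phi> (into_completion V v) = \<phi> v"
      using functional_extension[OF \<phi>] by blast
    have "\<phi> = ?R \<Phi>"
      using \<Phi>(2) bounded_opsD(2)[OF \<phi> normed_sp] by (intro extensionalityI[of _ "carr V"]) auto
    then show "\<exists>\<Phi>\<in>bounded_ops (ncompletion V) scalars. \<phi> = ?R \<Phi>" using \<Phi>(1) by blast
  qed (rule R)
qed

end

section \<open>Lipschitz maps and tensors\<close>

lemma isometric_isoD:
  assumes "isometric_iso V W J"
  shows "linear_map V W J" and "bij_betw J (carr V) (carr W)" and "x \<in> carr V \<Longrightarrow> J x \<in> carr W"
    and "x \<in> carr V \<Longrightarrow> vnorm W (J x) = vnorm V x"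
  using assms unfolding isometric_iso_def linear_map_def by auto

lemma isometric_iso_inverse:
  assumes J: "isometric_iso V W J" and V: "vector_sp V"
  obtains K where "linear_map W V K" "\<And>y. y \<in> carr W \<Longrightarrow> J (K y) = y"
    "\<And>y. y \<in> carr W \<Longrightarrow> vnorm V (K y) = vnorm W y" "\<And>x. x \<in> carr V \<Longrightarrow> K (J x) = x"
proof -
  interpret V: vspace V by unfold_locales fact
  note D = isometric_isoD[OF J]
  define K where "K = inv_into (carr V) J"
  have Kc: "K y \<in> carr V" and JK: "J (K y) = y" if "y \<in> carr W" for y
    using that D(2) unfolding K_def bij_betw_def by (metis inv_into_into, metis f_inv_into_f)
  have KJ: "K (J x) = x" if "x \<in> carr V" for x
    using that D(2) unfolding K_def by (simp add: bij_betw_def)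
  have "K (vadd W x y) = vadd V (K x) (K y)" if "x \<in> carr W" "y \<in> carr W" for x y
    using KJ[of "vadd V (K x) (K y)"] linear_map_simps(2)[OF D(1), of "K x" "K y"] Kc JK that by simp
  moreover have "K (vscale W c x) = vscale V c (K x)" if "x \<in> carr W" for c x
    using KJ[of "vscale V c (K x)"] linear_map_simps(3)[OF D(1), of "K x"] Kc JK that by simp
  ultimately have "linear_map W V K" using Kc unfolding linear_map_def by auto
  moreover have "vnorm V (K y) = vnorm W y" if "y \<in> carr W" for y
    using D(4)[OF Kc[OF that]] JK[OF that] by simp
  ultimately show ?thesis using that JK KJ by blast
qed

lemma lipvD:
  assumes f: "f \<in> lipv X V" and V: "normed_sp V"
  shows "f \<in> extensional (pts X)" and "x \<in> pts X \<Longrightarrow> f x \<in> carr V" and "f (base X) = vzero V"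
    and "\<exists>C\<ge>0. \<forall>x\<in>pts X. \<forall>y\<in>pts X. vnorm V (vsub V (f x) (f y)) \<le> C * pdist X x y"
proof -
  have L: "Lipschitz_continuous_map (fst X) (nmetric V) f"
    using f unfolding lip0_def of_normed_def by simp
  show "f \<in> extensional (pts X)" "f (base X) = vzero V" using f unfolding lip0_def of_normed_def by auto
  show m: "f x \<in> carr V" if "x \<in> pts X" for x
    using L that mspace_nmetric[OF V] unfolding Lipschitz_continuous_map_def by auto
  obtain B where "0 < B" "\<And>x y. x \<in> pts X \<Longrightarrow> y \<in> pts X \<Longrightarrow> mdist (nmetric V) (f x) (f y) \<le> B * pdist X x y"
    using L unfolding Lipschitz_continuous_map_pos by auto
  then show "\<exists>C\<ge>0. \<forall>x\<in>pts X. \<forall>y\<in>pts X. vnorm V (vsub V (f x) (f y)) \<le> C * pdist X x y"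
    using mdist_nmetric[OF V] m by (intro exI[of _ B]) auto
qed

lemma lipvI:
  assumes V: "normed_sp V" and "f \<in> extensional (pts X)" and m: "\<And>x. x \<in> pts X \<Longrightarrow> f x \<in> carr V"
    and "f (base X) = vzero V"
    and "\<And>x y. x \<in> pts X \<Longrightarrow> y \<in> pts X \<Longrightarrow> vnorm V (vsub V (f x) (f y)) \<le> C * pdist X x y"
  shows "f \<in> lipv X V"
  unfolding lip0_def of_normed_def Lipschitz_continuous_map_def
  using assms by (auto simp: mspace_nmetric mdist_nmetric)

lemma lipv_compose:
  assumes f: "f \<in> lipv X V" and V: "normed_sp V" and W: "normed_sp W" and X: "pointed X"
    and T: "linear_map V W T" and T1: "\<And>x. x \<in> carr V \<Longrightarrow> vnorm W (T x) \<le> vnorm V x"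
  shows "(\<lambda>x\<in>pts X. T (f x)) \<in> lipv X W"
proof -
  interpret V: nvspace V using nvspaceI[OF V] .
  note fD = lipvD[OF f V]
  obtain C where C: "\<And>x y. x \<in> pts X \<Longrightarrow> y \<in> pts X \<Longrightarrow> vnorm V (vsub V (f x) (f y)) \<le> C * pdist X x y"
    using fD(4) by blast
  show ?thesis
  proof (rule lipvI[OF W, of _ _ C])
    fix x y assume xy: "x \<in> pts X" "y \<in> pts X"
    have "vsub W (T (f x)) (T (f y)) = T (vsub V (f x) (f y))"
      using V.linear_map_sub[OF T] fD(2) xy by simp
    then show "vnorm W (vsub W ((\<lambda>x\<in>pts X. T (f x)) x) ((\<lambda>x\<in>pts X. T (f x)) y)) \<le> C * pdist X x y"
      using T1[of "vsub V (f x) (f y)"] C[OF xy] fD(2) xy by simp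
  qed (use fD linear_map_simps(1)[OF T] V.linear_map_zero[OF T normed_sp_vector_sp[OF W]] X in
        \<open>auto simp: pointed_def\<close>)
qed

lemma subpm_simps [simp]:
  "Y \<subseteq> pts X \<Longrightarrow> pts (subpm X Y) = Y" "pdist (subpm X Y) = pdist X" "base (subpm X Y) = base X"
  by (auto simp: subpm_def mspace_submetric mdist_submetric)

lemma inclusion_lip0:
  assumes "Y \<subseteq> pts X" and "base X \<in> Y"
  shows "(\<lambda>x\<in>Y. x) \<in> lip0 (subpm X Y) X"
  unfolding lip0_def Lipschitz_continuous_map_def
  using assms subpm_simps(1)[OF assms(1)] by (auto intro!: exI[of _ 1])

lemma inclusion_Lip:
  assumes "Y \<subseteq> pts X"
  shows "Lip (subpm X Y) X (\<lambda>x\<in>Y. x) \<le> 1" and "0 \<le> Lip (subpm X Y) X (\<lambda>x\<in>Y. x)"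
proof -
  have 1: "1 \<in> {C. 0 \<le> C \<and> (\<forall>x\<in>pts (subpm X Y). \<forall>y\<in>pts (subpm X Y).
      pdist X ((\<lambda>x\<in>Y. x) x) ((\<lambda>x\<in>Y. x) y) \<le> C * pdist (subpm X Y) x y)}"
    using subpm_simps(1)[OF assms] by simp
  show "Lip (subpm X Y) X (\<lambda>x\<in>Y. x) \<le> 1"
    unfolding Lip_def using 1 by (rule cInf_lower) (auto intro!: bdd_belowI[of _ 0])
  show "0 \<le> Lip (subpm X Y) X (\<lambda>x\<in>Y. x)"
    unfolding Lip_def using 1 by (intro cInf_greatest) blast+
qed

lemma lipv_subpm:
  assumes f: "f \<in> lipv X V" and V: "normed_sp V" and Y: "Y \<subseteq> pts X" "base X \<in> Y"
  shows "restrict f Y \<in> lipv (subpm X Y) V"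
proof -
  note fD = lipvD[OF f V]
  obtain C where "\<And>x y. x \<in> pts X \<Longrightarrow> y \<in> pts X \<Longrightarrow> vnorm V (vsub V (f x) (f y)) \<le> C * pdist X x y"
    using fD(4) by blast
  then show ?thesis using fD Y by (intro lipvI[OF V, of _ _ C]) (auto simp: subset_iff)
qed

lemma is_rep_apply:
  assumes "is_rep X E l u" and "f \<in> lipv X (ndual E)"
  shows "u f = (\<Sum>(x, y, e)\<leftarrow>l. f x e - f y e)"
  using assms unfolding is_rep_def elem_def by (simp add: case_prod_unfold)

lemma is_rep_mem: "is_rep X E l u \<Longrightarrow> (x, y, e) \<in> set l \<Longrightarrow> x \<in> pts X \<and> y \<in> pts X \<and> e \<in> carr E"
  unfolding is_rep_def by auto

lemma extensional_eq_PiE: "extensional S = S \<rightarrow>\<^sub>E carr scalars"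
  by (auto simp: PiE_def)

lemma elem_add_scale:
  assumes E: "normed_sp E" and f: "f \<in> lipv X (ndual E)" and xy: "x \<in> pts X" "y \<in> pts X"
  shows "e \<in> carr E \<Longrightarrow> e' \<in> carr E \<Longrightarrow> elem X E x y (vadd E e e') f = elem X E x y e f + elem X E x y e' f"
    and "e \<in> carr E \<Longrightarrow> elem X E x y (vscale E c e) f = c * elem X E x y e f"
proof -
  have "linear_map E scalars (f z)" if "z \<in> pts X" for z
    using lipvD(2)[OF f normed_sp_ndual[OF E] that] bounded_opsD(1)[OF _ E] by simp
  note l = linear_map_simps[OF this]
  show "e \<in> carr E \<Longrightarrow> e' \<in> carr E \<Longrightarrow> elem X E x y (vadd E e e') f = elem X E x y e f + elem X E x y e' f"
    and "e \<in> carr E \<Longrightarrow> elem X E x y (vscale E c e) f = c * elem X E x y e f"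
    using f xy l by (simp_all add: elem_def algebra_simps)
qed

lemma tensors_iff:
  fixes X :: "'m pmetric" and E :: "('k::real_or_complex, 'u) nspace"
  assumes E: "normed_sp E"
  shows "u \<in> tensors X E \<longleftrightarrow> (\<exists>l. is_rep X E l u)"
proof -
  interpret E: nvspace E using nvspaceI[OF E] .
  let ?L = "lipv X (ndual E)"
  define FS :: "('k, ('m, 'u, 'k) tensor) nspace" where "FS = fspace ?L scalars (extensional ?L) (\<lambda>_. 0)"
  let ?S = "{elem X E x y e | x y e. x \<in> pts X \<and> y \<in> pts X \<and> e \<in> carr E}"
  interpret FS: vspace FS
    unfolding FS_def extensional_eq_PiE using fspace_vector_sp[OF vector_sp_scalars] by unfold_locales
  have FS_simps: "carr FS = extensional ?L" "vadd FS u v = (\<lambda>f\<in>?L. u f + v f)"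
    "vscale FS c u = (\<lambda>f\<in>?L. c * u f)" "vzero FS = (\<lambda>f\<in>?L. 0)" for u v c
    by (simp_all add: FS_def)
  have S: "?S \<subseteq> carr FS" by (auto simp: FS_simps elem_def)
  note sp = FS.vsubspace_vspan[OF S]
  have t: "tensors X E = vspan FS ?S" unfolding tensors_def FS_def ..
  have "u \<in> vspan FS ?S" if "is_rep X E l u" for l u
    using that
  proof (induction l arbitrary: u)
    case Nil
    then have "u = vzero FS" by (simp add: is_rep_def FS_simps)
    then show ?case using sp unfolding vsubspace_def by blast
  next
    case (Cons t l)
    obtain x y e where xye: "t = (x, y, e)" by (cases t)
    define v where "v = (\<lambda>f\<in>?L. \<Sum>(x, y, e)\<leftarrow>l. elem X E x y e f)"
    have "is_rep X E l v" using Cons.prems by (simp add: is_rep_def v_def)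
    then have v: "v \<in> vspan FS ?S" by (rule Cons.IH)
    have "elem X E x y e \<in> ?S" using Cons.prems xye by (auto simp: is_rep_def)
    then have "elem X E x y e \<in> vspan FS ?S" by (rule subsetD[OF FS.vspan_superset])
    moreover have "u = vadd FS (elem X E x y e) v"
      using Cons.prems xye by (auto simp: is_rep_def v_def FS_simps fun_eq_iff)
    ultimately show ?case using FS.vsubspace_closed(2)[OF sp _ v] by blast
  qed
  moreover have "vspan FS ?S \<subseteq> {u. \<exists>l. is_rep X E l u}"
  proof (rule FS.vspan_least)
    show "vsubspace FS {u. \<exists>l. is_rep X E l u}"
      unfolding vsubspace_def
    proof (intro conjI ballI allI)
      show "{u. \<exists>l. is_rep X E l u} \<subseteq> carr FS" by (auto simp: is_rep_def FS_simps)
      have "is_rep X E [] (vzero FS)" by (simp add: is_rep_def FS_simps)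
      then show "vzero FS \<in> {u. \<exists>l. is_rep X E l u}" by blast
    next
      fix u v assume "u \<in> {u. \<exists>l. is_rep X E l u}" "v \<in> {u. \<exists>l. is_rep X E l u}"
      then obtain l k where "is_rep X E l u" "is_rep X E k v" by blast
      then have "is_rep X E (l @ k) (vadd FS u v)" by (auto simp: is_rep_def FS_simps fun_eq_iff)
      then show "vadd FS u v \<in> {u. \<exists>l. is_rep X E l u}" by blast
    next
      fix c u assume "u \<in> {u. \<exists>l. is_rep X E l u}"
      then obtain l where l: "is_rep X E l u" by blast
      have "(\<Sum>(x, y, e)\<leftarrow>map (\<lambda>(x, y, e). (x, y, vscale E c e)) k. elem X E x y e f)
          = c * (\<Sum>(x, y, e)\<leftarrow>k. elem X E x y e f)"
        if "f \<in> ?L" "set k \<subseteq> pts X \<times> pts X \<times> carr E" for f k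
        using that(2) by (induction k) (auto simp: elem_add_scale[OF E that(1)] distrib_left)
      then have "is_rep X E (map (\<lambda>(x, y, e). (x, y, vscale E c e)) l) (vscale FS c u)"
        using l by (auto simp: is_rep_def FS_simps fun_eq_iff)
      then show "vscale FS c u \<in> {u. \<exists>l. is_rep X E l u}" by blast
    qed
    have "is_rep X E [(x, y, e)] (elem X E x y e)" if "x \<in> pts X" "y \<in> pts X" "e \<in> carr E" for x y e
      using that by (auto simp: is_rep_def elem_def fun_eq_iff)
    then show "?S \<subseteq> {u. \<exists>l. is_rep X E l u}" by blast
  qed
  ultimately show ?thesis unfolding t by blast
qed

lemma elem_tensor:
  assumes "normed_sp E" "x \<in> pts X" "y \<in> pts X" "e \<in> carr E"
  shows "elem X E x y e \<in> tensors X E"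
proof -
  have "is_rep X E [(x, y, e)] (elem X E x y e)"
    using assms by (auto simp: is_rep_def elem_def fun_eq_iff)
  then show ?thesis using tensors_iff[OF assms(1)] by blast
qed

lemma tensors_separate:
  assumes E: "normed_sp E" and X: "pointed X" and f: "f \<in> lipv X (ndual E)" "g \<in> lipv X (ndual E)"
    and eq: "\<And>u. u \<in> tensors X E \<Longrightarrow> u f = u g"
  shows "f = g"
proof (rule extensionalityI[of _ "pts X"])
  note fD = lipvD[OF f(1) normed_sp_ndual[OF E]] and gD = lipvD[OF f(2) normed_sp_ndual[OF E]]
  show "f \<in> extensional (pts X)" "g \<in> extensional (pts X)" using fD gD by blast+
  fix x assume x: "x \<in> pts X"
  show "f x = g x"
  proof (rule extensionalityI[of _ "carr E"])
    show "f x \<in> extensional (carr E)" "g x \<in> extensional (carr E)"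
      using fD(2)[OF x] gD(2)[OF x] bounded_opsD(2)[OF _ E] by simp_all
    fix e assume e: "e \<in> carr E"
    have "elem X E x (base X) e f = elem X E x (base X) e g"
      using eq elem_tensor[OF E x _ e] X by (simp add: pointed_def)
    then show "f x e = g x e" using f fD(3) gD(3) e by (simp add: elem_def)
  qed
qed

lemma tensor_sp_simps [simp]:
  "carr (tensor_sp \<alpha> X E) = tensors X E"
  "vadd (tensor_sp \<alpha> X E) u v = (\<lambda>f\<in>lipv X (ndual E). u f + v f)"
  "vscale (tensor_sp \<alpha> X E) c u = (\<lambda>f\<in>lipv X (ndual E). c * u f)"
  "vzero (tensor_sp \<alpha> X E) = (\<lambda>f\<in>lipv X (ndual E). 0)"
  "vnorm (tensor_sp \<alpha> X E) = \<alpha> X E"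
  by (simp_all add: tensor_sp_def)

lemma evaluation_linear:
  "f \<in> lipv X (ndual E) \<Longrightarrow> linear_map (tensor_sp \<alpha> X E) scalars (\<lambda>u. u f)"
  by (simp add: linear_map_scalars_iff)

lemma tensor_sp_normed:
  assumes "generic_cross_norm \<alpha>" "pointed X" "banach_sp E"
  shows "normed_sp (tensor_sp \<alpha> X E)"
  using assms unfolding generic_cross_norm_def lipschitz_cross_norm_def by blast

text \<open>
  Every bounded functional on \<open>X \<boxtimes>\<^sub>\<alpha> E\<close> is the evaluation at a Lipschitz map, namely at
  \<open>x \<mapsto> (e \<mapsto> \<phi> (\<delta>(x, 0) \<boxtimes> e))\<close>. It is Lipschitz because \<open>\<alpha>\<close> is a cross-norm.
\<close>

lemma functional_is_evaluation:
  assumes \<alpha>: "generic_cross_norm \<alpha>" and X: "pointed X" and E: "banach_sp E"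
    and \<phi>: "\<phi> \<in> bounded_ops (tensor_sp \<alpha> X E) scalars"
  obtains f where "f \<in> lipv X (ndual E)" and "\<And>u. u \<in> tensors X E \<Longrightarrow> \<phi> u = u f"
proof -
  note nE = banach_sp_normed[OF E] and nT = tensor_sp_normed[OF \<alpha> X E]
  interpret T: nvspace "tensor_sp \<alpha> X E" using nvspaceI[OF nT] .
  note dE = normed_sp_ndual[OF nE]
  note \<phi>D = bounded_opsD[OF \<phi> nT]
  note \<phi>l = linear_map_simps[OF \<phi>D(1)]
  have b: "base X \<in> pts X" using X by (simp add: pointed_def)
  let ?o = "op_norm (tensor_sp \<alpha> X E) scalars \<phi>"
  have \<alpha>e: "\<alpha> X E (elem X E x y e) = pdist X x y * vnorm E e" if "x \<in> pts X" "y \<in> pts X" "e \<in> carr E" for x y e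
    using that \<alpha> X E unfolding generic_cross_norm_def lipschitz_cross_norm_def by blast
  note et = elem_tensor[OF nE]
  have \<phi>e: "norm (\<phi> (elem X E x y e)) \<le> (?o * pdist X x y) * vnorm E e"
    if "x \<in> pts X" "y \<in> pts X" "e \<in> carr E" for x y e
    using \<phi>D(4)[of "elem X E x y e"] et[OF that] \<alpha>e[OF that] by (simp add: mult.assoc)
  define g where "g x y e = \<phi> (elem X E x y e)" for x y e
  have glin: "linear_map E scalars (g x y)" if xy: "x \<in> pts X" "y \<in> pts X" for x y
    unfolding linear_map_scalars_iff
  proof (intro conjI ballI allI)
    fix e e' assume e: "e \<in> carr E" "e' \<in> carr E"
    have "elem X E x y (vadd E e e') = vadd (tensor_sp \<alpha> X E) (elem X E x y e) (elem X E x y e')"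
      using elem_add_scale(1)[OF nE _ xy e] by (auto simp: fun_eq_iff elem_def)
    then show "g x y (vadd E e e') = g x y e + g x y e'"
      using \<phi>l(2)[of "elem X E x y e" "elem X E x y e'"] et[OF xy e(1)] et[OF xy e(2)]
      by (simp add: g_def del: tensor_sp_simps(2))
  next
    fix c e assume e: "e \<in> carr E"
    have "elem X E x y (vscale E c e) = vscale (tensor_sp \<alpha> X E) c (elem X E x y e)"
      using elem_add_scale(2)[OF nE _ xy e] by (auto simp: fun_eq_iff elem_def)
    then show "g x y (vscale E c e) = c * g x y e"
      using \<phi>l(3)[of "elem X E x y e" c] et[OF xy e] by (simp add: g_def del: tensor_sp_simps(3))
  qed
  have gsub: "g x y e = g x (base X) e - g y (base X) e" if "x \<in> pts X" "y \<in> pts X" "e \<in> carr E" for x y e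
  proof -
    have "elem X E x (base X) e = vadd (tensor_sp \<alpha> X E) (elem X E x y e) (elem X E y (base X) e)"
      by (auto simp: fun_eq_iff elem_def)
    moreover have "elem X E x y e \<in> carr (tensor_sp \<alpha> X E)" "elem X E y (base X) e \<in> carr (tensor_sp \<alpha> X E)"
      using et that b by simp_all
    ultimately have "g x (base X) e = g x y e + g y (base X) e"
      using \<phi>l(2)[of "elem X E x y e" "elem X E y (base X) e"]
      by (simp add: g_def del: tensor_sp_simps)
    then show ?thesis by simp
  qed
  define f where "f = (\<lambda>x\<in>pts X. \<lambda>e\<in>carr E. g x (base X) e)"
  have o: "0 \<le> ?o * pdist X x y" for x y using \<phi>D(3) by simp
  have gm: "restrict (g x y) (carr E) \<in> bounded_ops E scalars"
    "op_norm E scalars (g x y) \<le> ?o * pdist X x y" if "x \<in> pts X" "y \<in> pts X" for x y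
    using ndual_mem[OF glin[OF that] nE _ o, of x y] \<phi>e[OF that] by (simp_all add: g_def)
  have f: "f \<in> lipv X (ndual E)"
  proof (rule lipvI[OF dE, of _ _ ?o])
    show "f \<in> extensional (pts X)" by (simp add: f_def)
    show "f x \<in> carr (ndual E)" if "x \<in> pts X" for x using gm(1)[OF that b] that by (simp add: f_def)
    show "f (base X) = vzero (ndual E)"
      using gsub[OF b b] b by (simp add: f_def fun_eq_iff restrict_def)
    fix x y assume xy: "x \<in> pts X" "y \<in> pts X"
    have "vsub (ndual E) (f x) (f y) = restrict (g x y) (carr E)"
      using gsub[OF xy] xy by (auto simp: vsub_def f_def fun_eq_iff)
    then show "vnorm (ndual E) (vsub (ndual E) (f x) (f y)) \<le> ?o * pdist X x y"
      using gm(2)[OF xy] by simp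
  qed
  have rep: "u \<in> tensors X E \<and> \<phi> u = u f" if "is_rep X E l u" for l u
    using that
  proof (induction l arbitrary: u)
    case Nil
    then have u: "u = vzero (tensor_sp \<alpha> X E)" by (simp add: is_rep_def)
    have "\<phi> u = 0" unfolding u using T.linear_map_zero[OF \<phi>D(1) vector_sp_scalars] by simp
    moreover have "u \<in> tensors X E" using T.zero_closed unfolding u by (simp only: tensor_sp_simps)
    moreover have "u f = 0" using u f by simp
    ultimately show ?case by simp
  next
    case (Cons t l)
    obtain x y e where xye: "t = (x, y, e)" by (cases t)
    then have m: "x \<in> pts X" "y \<in> pts X" "e \<in> carr E" using is_rep_mem[OF Cons.prems] by auto
    define v where "v = (\<lambda>f\<in>lipv X (ndual E). \<Sum>(x, y, e)\<leftarrow>l. elem X E x y e f)"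
    have "is_rep X E l v" using Cons.prems by (simp add: is_rep_def v_def)
    then have v: "v \<in> tensors X E" "\<phi> v = v f" using Cons.IH by blast+
    have u: "u = vadd (tensor_sp \<alpha> X E) (elem X E x y e) v"
      using Cons.prems xye by (auto simp: is_rep_def v_def fun_eq_iff)
    have "\<phi> u = \<phi> (elem X E x y e) + \<phi> v"
      unfolding u using \<phi>l(2)[of "elem X E x y e" v] et[OF m] v by simp
    moreover have "elem X E x y e f = g x (base X) e - g y (base X) e"
      using m f by (simp add: elem_def f_def)
    then have "elem X E x y e f = \<phi> (elem X E x y e)" using gsub[OF m] by (simp add: g_def)
    moreover have "u f = elem X E x y e f + v f" using u f by simp
    ultimately show ?case using v Cons.prems tensors_iff[OF nE] by metis
  qed
  then have "\<phi> u = u f" if "u \<in> tensors X E" for u using that tensors_iff[OF nE] by blast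
  then show ?thesis using that f by blast
qed

text \<open>The canonical embedding \<open>X\<^sub>0 \<boxtimes> E\<^sub>0 \<rightarrow> X \<boxtimes> E\<close> is adjoint to restriction.\<close>

lemma restriction_lipv:
  assumes X: "pointed X" and E: "normed_sp E" and f: "f \<in> lipv X (ndual E)"
    and X\<^sub>0: "X\<^sub>0 \<subseteq> pts X" "base X \<in> X\<^sub>0" and E\<^sub>0: "vsubspace E E\<^sub>0"
  shows "(\<lambda>x\<in>X\<^sub>0. \<lambda>e\<in>E\<^sub>0. f x e) \<in> lipv (subpm X X\<^sub>0) (ndual (subsp E E\<^sub>0))"
proof -
  interpret E: nvspace E using nvspaceI[OF E] .
  have i: "(\<lambda>e\<in>E\<^sub>0. e) \<in> bounded_ops (subsp E E\<^sub>0) E"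
    using E.vsubspace_closed[OF E\<^sub>0]
    unfolding bounded_ops_def linear_map_def by (auto simp: subsp_def intro!: exI[of _ 1])
  have "pointed (subpm X X\<^sub>0)" using X\<^sub>0 by (simp add: pointed_def)
  from lip0_precompose[OF inclusion_lip0[OF X\<^sub>0] this E.subsp_normed_sp[OF E\<^sub>0] E i f]
  have "(\<lambda>x\<in>X\<^sub>0. \<lambda>e\<in>E\<^sub>0. f ((\<lambda>x\<in>X\<^sub>0. x) x) ((\<lambda>e\<in>E\<^sub>0. e) e)) \<in> lipv (subpm X X\<^sub>0) (ndual (subsp E E\<^sub>0))"
    using X\<^sub>0 by (simp add: subsp_def)
  then show ?thesis by (simp cong: restrict_cong)
qed

text \<open>
  A representation of \<open>u\<close> involves finitely many points and vectors. Hence the infimum in the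
  definition of finite generation is over a nonempty set.
\<close>

lemma finite_tensor_preimage:
  assumes X: "pointed X" and E: "normed_sp E" and u: "u \<in> tensors X E"
  obtains X\<^sub>0 E\<^sub>0 v where "finite X\<^sub>0" "X\<^sub>0 \<subseteq> pts X" "base X \<in> X\<^sub>0" "vsubspace E E\<^sub>0" "fin_dim (subsp E E\<^sub>0)"
    "v \<in> tensors (subpm X X\<^sub>0) (subsp E E\<^sub>0)"
    "tensor_map (subpm X X\<^sub>0) (subsp E E\<^sub>0) X E (\<lambda>x. x) (\<lambda>e. e) v = u"
proof -
  interpret E: nvspace E using nvspaceI[OF E] .
  obtain l where l: "is_rep X E l u" using u tensors_iff[OF E] by blast
  define X\<^sub>0 where "X\<^sub>0 = insert (base X) (fst ` set l \<union> (fst \<circ> snd) ` set l)"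
  define S where "S = (snd \<circ> snd) ` set l"
  define E\<^sub>0 where "E\<^sub>0 = vspan E S"
  have S: "S \<subseteq> carr E" using l unfolding S_def is_rep_def by force
  have E\<^sub>0: "vsubspace E E\<^sub>0" unfolding E\<^sub>0_def by (rule E.vsubspace_vspan[OF S])
  have SE: "S \<subseteq> E\<^sub>0" unfolding E\<^sub>0_def by (rule E.vspan_superset)
  have X\<^sub>0: "finite X\<^sub>0" "X\<^sub>0 \<subseteq> pts X" "base X \<in> X\<^sub>0"
    using l X unfolding X\<^sub>0_def is_rep_def pointed_def by force+
  have fd: "fin_dim (subsp E E\<^sub>0)"
  proof -
    interpret E0: nvspace "subsp E E\<^sub>0" using nvspaceI[OF E.subsp_normed_sp[OF E\<^sub>0]] .
    have c: "carr (subsp E E\<^sub>0) = E\<^sub>0" by (simp add: subsp_def)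
    have "S \<subseteq> carr (subsp E E\<^sub>0)" using SE c by simp
    note sp = E0.vsubspace_vspan[OF this]
    then have "vsubspace E (vspan (subsp E E\<^sub>0) S)"
      using E.vsubspace_closed(1)[OF E\<^sub>0] unfolding vsubspace_def by (auto simp: subsp_def)
    then have "E\<^sub>0 \<subseteq> vspan (subsp E E\<^sub>0) S"
      unfolding E\<^sub>0_def using E.vspan_least E0.vspan_superset E\<^sub>0_def by metis
    moreover have "vspan (subsp E E\<^sub>0) S \<subseteq> E\<^sub>0" using sp c unfolding vsubspace_def by simp
    ultimately show ?thesis
      unfolding fin_dim_def using SE c by (intro exI[of _ S]) (auto simp: S_def)
  qed
  define v where "v = (\<lambda>f\<in>lipv (subpm X X\<^sub>0) (ndual (subsp E E\<^sub>0)).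
      \<Sum>(x, y, e)\<leftarrow>l. elem (subpm X X\<^sub>0) (subsp E E\<^sub>0) x y e f)"
  have lmem: "x \<in> X\<^sub>0 \<and> y \<in> X\<^sub>0 \<and> e \<in> E\<^sub>0" if "(x, y, e) \<in> set l" for x y e
    using that SE unfolding X\<^sub>0_def S_def by force
  have "is_rep (subpm X X\<^sub>0) (subsp E E\<^sub>0) l v"
    using lmem X\<^sub>0(2) unfolding is_rep_def v_def by (auto simp: subsp_def)
  note rep = this
  then have "v \<in> tensors (subpm X X\<^sub>0) (subsp E E\<^sub>0)"
    using tensors_iff[OF E.subsp_normed_sp[OF E\<^sub>0]] by blast
  moreover have "tensor_map (subpm X X\<^sub>0) (subsp E E\<^sub>0) X E (\<lambda>x. x) (\<lambda>e. e) v = u"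
  proof (rule extensionalityI[of _ "lipv X (ndual E)"])
    show "tensor_map (subpm X X\<^sub>0) (subsp E E\<^sub>0) X E (\<lambda>x. x) (\<lambda>e. e) v \<in> extensional (lipv X (ndual E))"
      by (simp add: tensor_map_def)
    show "u \<in> extensional (lipv X (ndual E))" using l by (simp add: is_rep_def)
    fix f assume f: "f \<in> lipv X (ndual E)"
    note r = restriction_lipv[OF X E f X\<^sub>0(2,3) E\<^sub>0]
    have "tensor_map (subpm X X\<^sub>0) (subsp E E\<^sub>0) X E (\<lambda>x. x) (\<lambda>e. e) v f
        = v (\<lambda>x\<in>X\<^sub>0. \<lambda>e\<in>E\<^sub>0. f x e)"
      using f X\<^sub>0(2) by (simp add: tensor_map_def subsp_def)
    also have "\<dots> = (\<Sum>(x, y, e)\<leftarrow>l. f x e - f y e)"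
      unfolding is_rep_apply[OF rep r] using lmem
      by (intro arg_cong[of _ _ sum_list] map_cong refl) auto
    finally show "tensor_map (subpm X X\<^sub>0) (subsp E E\<^sub>0) X E (\<lambda>x. x) (\<lambda>e. e) v f = u f"
      using is_rep_apply[OF l f] by simp
  qed
  ultimately show ?thesis using that X\<^sub>0 E\<^sub>0 fd by blast
qed

lemma tensor_map_bound:
  assumes \<alpha>: "generic_cross_norm \<alpha>" and X: "pointed X" and Y: "Y \<subseteq> pts X" "base X \<in> Y"
    and H: "banach_sp H" and G: "banach_sp G" and T: "T \<in> bounded_ops H G"
    and v: "v \<in> tensors (subpm X Y) H"
  shows "tensor_map (subpm X Y) H X G (\<lambda>x\<in>Y. x) T v \<in> tensors X G"
    and "\<alpha> X G (tensor_map (subpm X Y) H X G (\<lambda>x\<in>Y. x) T v) \<le> op_norm H G T * \<alpha> (subpm X Y) H v"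
proof -
  have Yp: "pointed (subpm X Y)" using Y by (simp add: pointed_def)
  let ?m = "tensor_map (subpm X Y) H X G (\<lambda>x\<in>Y. x) T"
  let ?A = "tensor_sp \<alpha> (subpm X Y) H" and ?B = "tensor_sp \<alpha> X G"
  have m: "restrict ?m (tensors (subpm X Y) H) \<in> bounded_ops ?A ?B"
    and le: "op_norm ?A ?B ?m \<le> Lip (subpm X Y) X (\<lambda>x\<in>Y. x) * op_norm H G T"
    using \<alpha> Yp X H G inclusion_lip0[OF Y] T unfolding generic_cross_norm_def by blast+
  note nA = tensor_sp_normed[OF \<alpha> Yp H]
  interpret A: nvspace ?A using nvspaceI[OF nA] .
  note mD = bounded_opsD[OF m nA]
  show "?m v \<in> tensors X G" using mD(5)[of v] v by simp
  have "\<alpha> X G (?m v) \<le> op_norm ?A ?B ?m * \<alpha> (subpm X Y) H v"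
    using mD(4)[of v] v op_norm_restrict[of ?A ?B ?m] by simp
  also have "\<dots> \<le> op_norm H G T * \<alpha> (subpm X Y) H v"
  proof (rule mult_right_mono)
    have "Lip (subpm X Y) X (\<lambda>x\<in>Y. x) * op_norm H G T \<le> 1 * op_norm H G T"
      using inclusion_Lip(1)[OF Y(1)] bounded_opsD(3)[OF T banach_sp_normed[OF H]] by (rule mult_right_mono)
    then show "op_norm ?A ?B ?m \<le> op_norm H G T" using le by simp
    show "0 \<le> \<alpha> (subpm X Y) H v" using A.norm_nonneg[of v] v by simp
  qed
  finally show "\<alpha> X G (?m v) \<le> op_norm H G T * \<alpha> (subpm X Y) H v" .
qed

section \<open>Ideals and pairings\<close>

text \<open>
  The two relations concern \<open>F = E\<^sup>*\<close>, \<open>G = E\<close> and \<open>F = E\<close>, \<open>G = E\<^sup>*\<close>. A pairing \<open>B : F \<rightarrow> G\<^sup>*\<close>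
  treats them alike.
\<close>

definition contractive_pairing ::
  "('k::real_or_complex, 'a) nspace \<Rightarrow> ('k, 'b) nspace \<Rightarrow> ('a \<Rightarrow> 'b \<Rightarrow> 'k) \<Rightarrow> bool" where
  "contractive_pairing F G B \<longleftrightarrow> linear_map F (ndual G) B \<and>
     (\<forall>y\<in>carr F. op_norm G scalars (B y) \<le> vnorm F y)"

text \<open>
  Through \<open>B\<close>, the space \<open>G\<close> is to reach all of \<open>F\<^sup>*\<close> as seen from finite dimensions: a bound for the
  pairing of finitely many \<open>h\<^sub>i \<otimes> y\<^sub>i \<in> H \<otimes> F\<close> with the operators \<open>T : H \<rightarrow> G\<close> of norm at most 1
  persists for the operators \<open>S : H \<rightarrow> F\<^sup>*\<close> of norm at most 1.
\<close>

definition locally_dual_pairing ::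
  "('k::real_or_complex, 'a) nspace \<Rightarrow> ('k, 'a) nspace \<Rightarrow> ('a \<Rightarrow> 'a \<Rightarrow> 'k) \<Rightarrow> bool" where
  "locally_dual_pairing F G B \<longleftrightarrow>
     (\<forall>H S (I :: nat set) h y K. normed_sp H \<and> fin_dim H \<and> linear_map H (ndual F) S \<and>
        (\<forall>x\<in>carr H. op_norm F scalars (S x) \<le> vnorm H x) \<and>
        finite I \<and> (\<forall>i\<in>I. h i \<in> carr (H :: ('k, 'a) nspace) \<and> y i \<in> carr F) \<and> 0 \<le> K \<and>
        (\<forall>T\<in>bounded_ops H G. norm (\<Sum>i\<in>I. B (y i) (T (h i))) \<le> K * op_norm H G T) \<longrightarrow>
        norm (\<Sum>i\<in>I. S (h i) (y i)) \<le> K)"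

lemma locally_dual_pairingD:
  fixes F G H :: "('k::real_or_complex, 'a) nspace" and I :: "nat set"
  assumes "locally_dual_pairing F G B" and "normed_sp H" "fin_dim H" "linear_map H (ndual F) S"
    and "\<And>x. x \<in> carr H \<Longrightarrow> op_norm F scalars (S x) \<le> vnorm H x"
    and "finite I" and "\<And>i. i \<in> I \<Longrightarrow> h i \<in> carr H" and "\<And>i. i \<in> I \<Longrightarrow> y i \<in> carr F" and "0 \<le> K"
    and "\<And>T. T \<in> bounded_ops H G \<Longrightarrow> norm (\<Sum>i\<in>I. B (y i) (T (h i))) \<le> K * op_norm H G T"
  shows "norm (\<Sum>i\<in>I. S (h i) (y i)) \<le> K"
  using assms(1)[unfolded locally_dual_pairing_def, THEN spec[of _ H], THEN spec[of _ S],
      THEN spec[of _ I], THEN spec[of _ h], THEN spec[of _ y], THEN spec[of _ K], THEN mp] assms(2-)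
  by simp

lemma contractive_pairingD:
  assumes "contractive_pairing F G B" and G: "normed_sp G"
  shows "linear_map F (ndual G) B"
    and "y \<in> carr F \<Longrightarrow> op_norm G scalars (B y) \<le> vnorm F y"
    and "y \<in> carr F \<Longrightarrow> B y \<in> bounded_ops G scalars"
    and "y \<in> carr F \<Longrightarrow> linear_map G scalars (B y)"
    and "y \<in> carr F \<Longrightarrow> g \<in> carr G \<Longrightarrow> norm (B y g) \<le> vnorm F y * vnorm G g"
proof -
  interpret G: nvspace G using nvspaceI[OF G] .
  show B: "linear_map F (ndual G) B"
    and n: "y \<in> carr F \<Longrightarrow> op_norm G scalars (B y) \<le> vnorm F y" for y
    using assms(1) unfolding contractive_pairing_def by blast+
  show m: "y \<in> carr F \<Longrightarrow> B y \<in> bounded_ops G scalars" for y using linear_map_simps(1)[OF B] by simp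
  then show "y \<in> carr F \<Longrightarrow> linear_map G scalars (B y)" using bounded_opsD(1)[OF _ G] by blast
  assume y: "y \<in> carr F" and g: "g \<in> carr G"
  have "norm (B y g) \<le> op_norm G scalars (B y) * vnorm G g" using bounded_opsD(4)[OF m[OF y] G g] by simp
  also have "\<dots> \<le> vnorm F y * vnorm G g" using n[OF y] g by (intro mult_right_mono) auto
  finally show "norm (B y g) \<le> vnorm F y * vnorm G g" .
qed

lemma pairing_lipv:
  assumes B: "contractive_pairing F G B" and F: "normed_sp F" and G: "normed_sp G" and X: "pointed X"
    and f: "f \<in> lipv X F"
  shows "(\<lambda>x\<in>pts X. B (f x)) \<in> lipv X (ndual G)"
  using contractive_pairingD(1,2)[OF B G]
  by (intro lipv_compose[OF f F normed_sp_ndual[OF G] X]) auto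

lemma ideal_lipv:
  assumes "generic_ideal A nA" "pointed X" "banach_sp F" "f \<in> A X F"
  shows "f \<in> lipv X F" and "0 \<le> nA X F f"
proof -
  have 1: "vsubspace (lip_space X F) (A X F)" "banach_sp (fspace (pts X) F (A X F) (nA X F))"
    using assms unfolding generic_ideal_def by blast+
  show "f \<in> lipv X F" using 1(1) assms(4) unfolding vsubspace_def lip_space_def by auto
  interpret N: nvspace "fspace (pts X) F (A X F) (nA X F)"
    using nvspaceI[OF banach_sp_normed[OF 1(2)]] .
  show "0 \<le> nA X F f" using N.norm_nonneg[of f] assms(4) by simp
qed

text \<open>
  By finite generation it suffices to treat \<open>u \<in> X\<^sub>0 \<boxtimes> G\<^sub>0\<close> with \<open>X\<^sub>0\<close> finite and \<open>G\<^sub>0\<close> of finite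
  dimension. There \<open>u (B \<circ> f)\<close> is the value at \<open>u\<close> of the functional attached to \<open>R \<circ> f \<circ> I\<close>, where
  \<open>I : X\<^sub>0 \<rightarrow> X\<close> is the inclusion and \<open>R : F \<rightarrow> G\<^sub>0\<^sup>*\<close> the restriction of the pairing, and the
  association of \<open>A\<close> with \<open>\<alpha>\<close> applies.
\<close>

lemma ideal_norm_bounds_functional:
  fixes A :: "('m, 'u, 'k::real_or_complex) gideal"
  assumes A: "generic_ideal A nA" and \<alpha>: "generic_cross_norm \<alpha>" and fg: "finitely_generated \<alpha>"
    and as: "associated A nA \<alpha>" and X: "pointed X" and F: "banach_sp F" and G: "banach_sp G"
    and B: "contractive_pairing F G B" and f: "f \<in> A X F" and u: "u \<in> tensors X G"
  shows "norm (u (\<lambda>x\<in>pts X. B (f x))) \<le> nA X F f * \<alpha> X G u"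
proof -
  note nF = banach_sp_normed[OF F] and nG = banach_sp_normed[OF G]
  interpret G: nvspace G using nvspaceI[OF nG] .
  note BD = contractive_pairingD[OF B nG]
  note fl = ideal_lipv(1)[OF A X F f] and f0 = ideal_lipv(2)[OF A X F f]
  let ?Bf = "\<lambda>x\<in>pts X. B (f x)"
  have Bf: "?Bf \<in> lipv X (ndual G)" by (rule pairing_lipv[OF B nF nG X fl])
  have fX: "f x \<in> carr F" if "x \<in> pts X" for x using lipvD(2)[OF fl nF that] .
  define V where "V = {\<alpha> (subpm X X\<^sub>0) (subsp G E\<^sub>0) v | X\<^sub>0 E\<^sub>0 v.
          finite X\<^sub>0 \<and> X\<^sub>0 \<subseteq> pts X \<and> base X \<in> X\<^sub>0 \<and>
          vsubspace G E\<^sub>0 \<and> fin_dim (subsp G E\<^sub>0) \<and>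
          v \<in> tensors (subpm X X\<^sub>0) (subsp G E\<^sub>0) \<and>
          tensor_map (subpm X X\<^sub>0) (subsp G E\<^sub>0) X G (\<lambda>x. x) (\<lambda>e. e) v = u}"
  have \<alpha>u: "\<alpha> X G u = Inf V"
    using fg X G u unfolding finitely_generated_def V_def by blast
  have ne: "V \<noteq> {}"
    by (rule finite_tensor_preimage[OF X nG u]) (auto simp: V_def)
  have le: "norm (u ?Bf) \<le> nA X F f * a" if a: "a \<in> V" for a
  proof -
    obtain X\<^sub>0 E\<^sub>0 v where X\<^sub>0: "finite X\<^sub>0" "X\<^sub>0 \<subseteq> pts X" "base X \<in> X\<^sub>0"
      and E\<^sub>0: "vsubspace G E\<^sub>0" "fin_dim (subsp G E\<^sub>0)" and v: "v \<in> tensors (subpm X X\<^sub>0) (subsp G E\<^sub>0)"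
      and uv: "u = tensor_map (subpm X X\<^sub>0) (subsp G E\<^sub>0) X G (\<lambda>x. x) (\<lambda>e. e) v"
      and a: "a = \<alpha> (subpm X X\<^sub>0) (subsp G E\<^sub>0) v"
      using a unfolding V_def by blast
    let ?X = "subpm X X\<^sub>0" and ?E = "subsp G E\<^sub>0"
    have Xp: "pointed ?X" "finite (pts ?X)" using X\<^sub>0 by (simp_all add: pointed_def)
    note nE = G.subsp_normed_sp[OF E\<^sub>0(1)]
    interpret E: nvspace ?E using nvspaceI[OF nE] .
    have cE: "carr ?E = E\<^sub>0" and nvE: "vnorm ?E = vnorm G" by (simp_all add: subsp_def)
    have EG: "e \<in> carr G" if "e \<in> E\<^sub>0" for e using G.vsubspace_closed(1)[OF E\<^sub>0(1) that] .
    have bE: "banach_sp ?E" by (rule E.fin_dim_banach_sp[OF E\<^sub>0(2)])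
    obtain D :: "('k, 'u) nspace" and J where D: "banach_sp D" and J: "isometric_iso D (ndual ?E) J"
      by (rule fin_dim_dual_pair[OF nE E\<^sub>0(2)])
    note nD = banach_sp_normed[OF D]
    interpret D: nvspace D using nvspaceI[OF nD] .
    obtain K where K: "linear_map (ndual ?E) D K" and JK: "\<And>y. y \<in> carr (ndual ?E) \<Longrightarrow> J (K y) = y"
      and nK: "\<And>y. y \<in> carr (ndual ?E) \<Longrightarrow> vnorm D (K y) = vnorm (ndual ?E) y"
      using isometric_iso_inverse[OF J D.vector_sp] by metis
    define \<rho> where "\<rho> y = (\<lambda>e\<in>E\<^sub>0. B y e)" for y
    have \<rho>: "\<rho> y \<in> bounded_ops ?E scalars" "op_norm ?E scalars (\<rho> y) \<le> vnorm F y" if y: "y \<in> carr F" for y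
    proof -
      interpret F: nvspace F using nvspaceI[OF nF] .
      have l: "linear_map ?E scalars (B y)"
        using BD(4)[OF y] EG unfolding linear_map_scalars_iff by (simp add: subsp_def)
      have "norm (B y e) \<le> vnorm F y * vnorm ?E e" if "e \<in> carr ?E" for e
        using BD(5)[OF y EG] that by (simp add: cE nvE)
      note m = ndual_mem[OF l nE this F.norm_nonneg[OF y]]
      have eq: "\<rho> y = restrict (B y) (carr ?E)" by (simp add: \<rho>_def cE)
      show "\<rho> y \<in> bounded_ops ?E scalars" "op_norm ?E scalars (\<rho> y) \<le> vnorm F y"
        unfolding eq op_norm_restrict using m by blast+
    qed
    have \<rho>l: "linear_map F (ndual ?E) \<rho>"
      using \<rho>(1) linear_map_simps[OF BD(1)] EG
      unfolding linear_map_def by (auto simp: \<rho>_def cE fun_eq_iff)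
    define R where "R = (\<lambda>y\<in>carr F. K (\<rho> y))"
    have Rl: "linear_map F D (\<lambda>y. K (\<rho> y))" by (rule linear_map_comp[OF \<rho>l K])
    have Rn: "vnorm D (K (\<rho> y)) \<le> 1 * vnorm F y" if "y \<in> carr F" for y using nK \<rho> that by simp
    have R: "R \<in> bounded_ops F D" unfolding R_def by (rule bounded_opsI[OF Rl nF Rn])
    have R1: "op_norm F D R \<le> 1" unfolding R_def op_norm_restrict by (rule op_norm_le) (use Rn in auto)
    have R0: "0 \<le> op_norm F D R" by (rule bounded_opsD(3)[OF R nF])
    define g where "g = (\<lambda>z\<in>pts ?X. R (f ((\<lambda>x\<in>X\<^sub>0. x) z)))"
    have g: "g \<in> A ?X D"
      and ng: "nA ?X D g \<le> op_norm F D R * nA X F f * Lip ?X X (\<lambda>x\<in>X\<^sub>0. x)"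
      using A X Xp(1) F D f inclusion_lip0[OF X\<^sub>0(2,3)] R unfolding g_def generic_ideal_def by blast+
    have "op_norm F D R * nA X F f * Lip ?X X (\<lambda>x\<in>X\<^sub>0. x) \<le> 1 * nA X F f * 1"
      using R1 R0 f0 inclusion_Lip[OF X\<^sub>0(2)] by (intro mult_mono) auto
    then have ng: "nA ?X D g \<le> nA X F f" using ng by simp
    have "dual_relation A nA ?X ?E D J (tensor_sp \<alpha> ?X ?E) (\<lambda>u. u)"
      using as Xp bE E\<^sub>0(2) D J unfolding associated_def by blast
    then obtain \<Theta> where \<Theta>: "bij_betw \<Theta> (A ?X D) (carr (ndual (tensor_sp \<alpha> ?X ?E)))"
      and \<Theta>n: "\<And>f. f \<in> A ?X D \<Longrightarrow> vnorm (ndual (tensor_sp \<alpha> ?X ?E)) (\<Theta> f) = nA ?X D f"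
      and \<Theta>e: "\<And>f u. f \<in> A ?X D \<Longrightarrow> u \<in> tensors ?X ?E \<Longrightarrow> \<Theta> f u = u (\<lambda>x\<in>pts ?X. J (f x))"
      unfolding dual_relation_def by blast
    note nT = tensor_sp_normed[OF \<alpha> Xp(1) bE]
    interpret T: nvspace "tensor_sp \<alpha> ?X ?E" using nvspaceI[OF nT] .
    have \<Theta>g: "\<Theta> g \<in> bounded_ops (tensor_sp \<alpha> ?X ?E) scalars"
      using bij_betwE[OF \<Theta>] g by simp
    have "u ?Bf = v (\<lambda>x\<in>X\<^sub>0. \<lambda>e\<in>E\<^sub>0. ?Bf x e)"
      using Bf X\<^sub>0(2) by (simp add: uv tensor_map_def cE)
    also have "(\<lambda>x\<in>X\<^sub>0. \<lambda>e\<in>E\<^sub>0. ?Bf x e) = (\<lambda>x\<in>pts ?X. J (g x))"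
      using X\<^sub>0(2) fX JK \<rho>(1) by (auto simp: fun_eq_iff g_def R_def \<rho>_def subset_iff)
    also have "v \<dots> = \<Theta> g v" using \<Theta>e[OF g v] by simp
    finally have uBf: "u ?Bf = \<Theta> g v" .
    have "norm (u ?Bf) \<le> nA ?X D g * a"
      unfolding uBf using bounded_opsD(4)[OF \<Theta>g nT, of v] \<Theta>n[OF g] v a by simp
    also have "\<dots> \<le> nA X F f * a"
      using ng T.norm_nonneg[of v] v a by (intro mult_right_mono) auto
    finally show ?thesis .
  qed
  show ?thesis
  proof (cases "nA X F f = 0")
    case True
    then show ?thesis using le ne by auto
  next
    case False
    then have n: "0 < nA X F f" using f0 by simp
    have "norm (u ?Bf) / nA X F f \<le> Inf V"
      using le by (intro cInf_greatest[OF ne]) (simp add: pos_divide_le_eq[OF n] mult.commute)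
    then show ?thesis unfolding \<alpha>u by (simp add: pos_divide_le_eq[OF n] mult.commute)
  qed
qed

text \<open>
  By maximality it suffices to bound the norm of \<open>g = Q \<circ> f \<circ> I\<close> for the quotients \<open>Z = F/L\<close> of
  finite dimension and the finite sets \<open>Y\<close>. As \<open>Z = H\<^sup>*\<close> with \<open>H = Z\<^sup>*\<close>, this is the norm of the
  functional \<open>v \<mapsto> v (g)\<close> on \<open>Y \<boxtimes>\<^sub>\<alpha> H\<close>. Its value at \<open>v\<close> pairs \<open>f\<close> with the image of \<open>v\<close> under the
  adjoint \<open>S : H \<rightarrow> F\<^sup>*\<close> of \<open>Q\<close>; if \<open>S\<close> is replaced by an operator \<open>T : H \<rightarrow> G\<close>, then this image is a tensor in
  \<open>X \<boxtimes> G\<close> with norm at most \<open>\<parallel>T\<parallel> \<alpha> v\<close>, and local duality passes from all \<open>T\<close> to \<open>S\<close>.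
\<close>

lemma functional_bounds_ideal_norm:
  fixes A :: "('m, 'u, 'k::real_or_complex) gideal"
  assumes A: "generic_ideal A nA" and max: "maximal_ideal A nA" and \<alpha>: "generic_cross_norm \<alpha>"
    and as: "associated A nA \<alpha>" and X: "pointed X" and F: "banach_sp F" and G: "banach_sp G"
    and B: "contractive_pairing F G B" and BL: "locally_dual_pairing F G B"
    and f: "f \<in> lipv X F" and C: "0 \<le> C"
    and bound: "\<And>u. u \<in> tensors X G \<Longrightarrow> norm (u (\<lambda>x\<in>pts X. B (f x))) \<le> C * \<alpha> X G u"
  shows "f \<in> A X F" and "nA X F f \<le> C"
proof -
  note nF = banach_sp_normed[OF F] and nG = banach_sp_normed[OF G]
  interpret F: nvspace F using nvspaceI[OF nF] .
  interpret G: nvspace G using nvspaceI[OF nG] .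
  note BD = contractive_pairingD[OF B nG]
  let ?Bf = "\<lambda>x\<in>pts X. B (f x)"
  have Bf: "?Bf \<in> lipv X (ndual G)" by (rule pairing_lipv[OF B nF nG X f])
  have fX: "f x \<in> carr F" if "x \<in> pts X" for x using lipvD(2)[OF f nF that] .
  have le: "nA (subpm X Y) Z (\<lambda>y\<in>Y. J (vcoset F L (f y))) \<le> C"
    if Y: "finite Y" "Y \<subseteq> pts X" "base X \<in> Y" and L: "vsubspace F L" "fin_dim (quotient F L)"
      and Z: "banach_sp Z" and J: "isometric_iso (quotient F L) Z J"
    for Y L J and Z :: "('k, 'u) nspace"
  proof -
    let ?Y = "subpm X Y"
    have Yp: "pointed ?Y" "finite (pts ?Y)" using Y by (simp_all add: pointed_def)
    note nZ = banach_sp_normed[OF Z]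
    interpret Z: nvspace Z using nvspaceI[OF nZ] .
    interpret Q: vspace "quotient F L" by unfold_locales (rule F.quotient_vector_sp[OF L(1)])
    note JD = isometric_isoD[OF J]
    define q where "q y = J (vcoset F L y)" for y
    have ql: "linear_map F Z q" unfolding q_def by (rule linear_map_comp[OF F.quotient_linear_map[OF L(1)] JD(1)])
    have qn: "vnorm Z (q y) \<le> vnorm F y" if "y \<in> carr F" for y
      using F.quotient_norm_le(1)[OF L(1) that] JD(4)[of "vcoset F L y"] that
      by (simp add: q_def F.quotient_carr[OF L(1)])
    have fdZ: "fin_dim Z"
      using Q.fin_dim_linear_image[OF L(2) JD(1) Z.vector_sp] JD(2) by (simp add: bij_betw_def)
    obtain H :: "('k, 'u) nspace" and J\<^sub>0 where H: "banach_sp H" "fin_dim H"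
      and J\<^sub>0: "isometric_iso H (ndual Z) J\<^sub>0" and ev: "isometric_iso Z (ndual H) (\<lambda>e. \<lambda>d\<in>carr H. J\<^sub>0 d e)"
      by (rule fin_dim_dual_pair[OF nZ fdZ])
    note nH = banach_sp_normed[OF H(1)]
    interpret H: nvspace H using nvspaceI[OF nH] .
    note J0D = isometric_isoD[OF J\<^sub>0]
    define ev where "ev e = (\<lambda>d\<in>carr H. J\<^sub>0 d e)" for e
    have ev: "isometric_iso Z (ndual H) ev" using ev by (simp add: ev_def [abs_def])
    note evD = isometric_isoD[OF ev]
    define g where "g = (\<lambda>y\<in>Y. q (f y))"
    have gl: "g \<in> lipv ?Y Z"
    proof -
      have "(\<lambda>x\<in>pts X. q (f x)) \<in> lipv X Z" by (rule lipv_compose[OF f nF nZ X ql qn])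
      from lipv_subpm[OF this nZ Y(2,3)] show ?thesis
        using Y(2) by (simp add: g_def Int_absorb1 Int_absorb2)
    qed
    have evl: "(\<lambda>x\<in>pts ?Y. ev (g' x)) \<in> lipv ?Y (ndual H)" if "g' \<in> lipv ?Y Z" for g'
      by (rule lipv_compose[OF that nZ normed_sp_ndual[OF nH] Yp(1) evD(1)]) (use evD(4) in simp)
    let ?g = "\<lambda>x\<in>pts ?Y. ev (g x)"
    have "dual_relation A nA ?Y H Z ev (tensor_sp \<alpha> ?Y H) (\<lambda>u. u)"
      using as Yp H Z ev unfolding associated_def by blast
    then obtain \<Theta> where \<Theta>: "bij_betw \<Theta> (A ?Y Z) (carr (ndual (tensor_sp \<alpha> ?Y H)))"
      and \<Theta>n: "\<And>f. f \<in> A ?Y Z \<Longrightarrow> vnorm (ndual (tensor_sp \<alpha> ?Y H)) (\<Theta> f) = nA ?Y Z f"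
      and \<Theta>e: "\<And>f u. f \<in> A ?Y Z \<Longrightarrow> u \<in> tensors ?Y H \<Longrightarrow> \<Theta> f u = u (\<lambda>x\<in>pts ?Y. ev (f x))"
      unfolding dual_relation_def by blast
    note nT = tensor_sp_normed[OF \<alpha> Yp(1) H(1)]
    interpret T: nvspace "tensor_sp \<alpha> ?Y H" using nvspaceI[OF nT] .
    \<comment> \<open>the adjoint of the quotient map\<close>
    define S where "S h = (\<lambda>y\<in>carr F. J\<^sub>0 h (q y))" for h
    have J0h: "J\<^sub>0 h \<in> bounded_ops Z scalars" if "h \<in> carr H" for h using J0D(3)[OF that] by simp
    have Sm: "S h \<in> bounded_ops F scalars" "op_norm F scalars (S h) \<le> vnorm H h" if h: "h \<in> carr H" for h
    proof -
      note jD = bounded_opsD[OF J0h[OF h] nZ]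
      have l: "linear_map F scalars (\<lambda>y. J\<^sub>0 h (q y))" by (rule linear_map_comp[OF ql jD(1)])
      have "norm (J\<^sub>0 h (q y)) \<le> vnorm H h * vnorm F y" if y: "y \<in> carr F" for y
      proof -
        have "norm (J\<^sub>0 h (q y)) \<le> op_norm Z scalars (J\<^sub>0 h) * vnorm Z (q y)"
          using jD(4) linear_map_simps(1)[OF ql y] by simp
        also have "\<dots> \<le> vnorm H h * vnorm F y" using qn[OF y] J0D(4)[OF h] h by (simp add: mult_left_mono)
        finally show ?thesis .
      qed
      note m = ndual_mem[OF l nF this H.norm_nonneg[OF h]]
      show "S h \<in> bounded_ops F scalars" "op_norm F scalars (S h) \<le> vnorm H h"
        unfolding S_def op_norm_restrict using m by blast+
    qed
    have Sl: "linear_map H (ndual F) S"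
      using Sm(1) linear_map_simps[OF J0D(1)] linear_map_simps(1)[OF ql]
      unfolding linear_map_def by (auto simp: S_def fun_eq_iff)
    have main: "norm (v ?g) \<le> C * \<alpha> ?Y H v" if v: "v \<in> tensors ?Y H" for v
    proof -
      obtain l where l: "is_rep ?Y H l v" using v tensors_iff[OF nH] by blast
      define x y h where "x i = fst (l ! i)" and "y i = fst (snd (l ! i))" and "h i = snd (snd (l ! i))" for i
      have m: "x i \<in> Y" "y i \<in> Y" "h i \<in> carr H" if "i < length l" for i
        using is_rep_mem[OF l, of "x i" "y i" "h i"] that Y(2) by (simp_all add: x_def y_def h_def)
      have rep: "v k = (\<Sum>i<length l. k (x i) (h i) - k (y i) (h i))" if "k \<in> lipv ?Y (ndual H)" for k
        using is_rep_apply[OF l that]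
        by (simp add: sum_list_sum_nth x_def y_def h_def case_prod_unfold atLeast0LessThan)
      define z where "z i = vsub F (f (x i)) (f (y i))" for i
      have z: "z i \<in> carr F" if "i < length l" for i using m[OF that] fX subsetD[OF Y(2)] by (simp add: z_def)
      have "v ?g = (\<Sum>i<length l. S (h i) (z i))"
        unfolding rep[OF evl[OF gl]]
      proof (rule sum.cong[OF refl])
        fix i assume "i \<in> {..<length l}"
        then have i: "i < length l" by simp
        have fc: "f (x i) \<in> carr F" "f (y i) \<in> carr F" using m[OF i] fX Y(2) by auto
        have "S (h i) (z i) = S (h i) (f (x i)) - S (h i) (f (y i))"
          using F.linear_map_sub[OF bounded_opsD(1)[OF Sm(1)[OF m(3)[OF i]] nF] fc] by (simp add: z_def)
        then show "?g (x i) (h i) - ?g (y i) (h i) = S (h i) (z i)"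
          using m[OF i] Y(2) fc by (simp add: ev_def g_def S_def)
      qed
      also have "norm \<dots> \<le> C * \<alpha> ?Y H v"
      proof -
        have "norm (\<Sum>i<length l. B (z i) (T (h i))) \<le> C * \<alpha> ?Y H v * op_norm H G T"
          if T: "T \<in> bounded_ops H G" for T
        proof -
          note tm = tensor_map_bound[OF \<alpha> X Y(2,3) H(1) G T v]
          let ?u = "tensor_map ?Y H X G (\<lambda>x\<in>Y. x) T v"
          let ?k = "\<lambda>x\<in>pts ?Y. \<lambda>e\<in>carr H. ?Bf ((\<lambda>x\<in>Y. x) x) (T e)"
          have k: "?k \<in> lipv ?Y (ndual H)"
            by (rule lip0_precompose[OF inclusion_lip0[OF Y(2,3)] Yp(1) nH nG T Bf])
          have "(\<Sum>i<length l. B (z i) (T (h i))) = v ?k"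
            unfolding rep[OF k]
          proof (rule sum.cong[OF refl])
            fix i assume "i \<in> {..<length l}"
            then have i: "i < length l" by simp
            have fc: "f (x i) \<in> carr F" "f (y i) \<in> carr F" using m[OF i] fX Y(2) by auto
            have "B (z i) = vsub (ndual G) (B (f (x i))) (B (f (y i)))"
              using F.linear_map_sub[OF BD(1) fc] by (simp add: z_def)
            then have "B (z i) (T (h i)) = B (f (x i)) (T (h i)) - B (f (y i)) (T (h i))"
              using bounded_opsD(5)[OF T nH m(3)[OF i]] by (simp add: vsub_def)
            then show "B (z i) (T (h i)) = ?k (x i) (h i) - ?k (y i) (h i)"
              using m[OF i] Y(2) by (simp add: subset_iff)
          qed
          also have "v ?k = ?u ?Bf" using Bf by (simp add: tensor_map_def)
          also have "norm \<dots> \<le> C * \<alpha> X G ?u" by (rule bound[OF tm(1)])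
          also have "\<dots> \<le> C * (op_norm H G T * \<alpha> ?Y H v)" using tm(2) C by (rule mult_left_mono)
          finally show ?thesis by (simp add: mult_ac)
        qed
        moreover have "0 \<le> C * \<alpha> ?Y H v" using C T.norm_nonneg[of v] v by simp
        moreover have "finite {..<length l}" by simp
        ultimately show ?thesis
          by (intro locally_dual_pairingD[OF BL nH H(2) Sl Sm(2)]) (use m(3) z in auto)
      qed
      finally show ?thesis .
    qed
    have m\<Psi>: "restrict (\<lambda>u. u ?g) (carr (tensor_sp \<alpha> ?Y H)) \<in> bounded_ops (tensor_sp \<alpha> ?Y H) scalars"
      "op_norm (tensor_sp \<alpha> ?Y H) scalars (\<lambda>u. u ?g) \<le> C"
      by (rule ndual_mem[OF evaluation_linear[OF evl[OF gl]] nT _ C]; use main in simp)+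
    then obtain g' where g': "g' \<in> A ?Y Z"
      "\<Theta> g' = restrict (\<lambda>u. u ?g) (carr (tensor_sp \<alpha> ?Y H))"
      using \<Theta> unfolding bij_betw_def by (metis (no_types, lifting) imageE ndual_simps(1))
    have g'l: "g' \<in> lipv ?Y Z" by (rule ideal_lipv(1)[OF A Yp(1) Z g'(1)])
    have "(\<lambda>x\<in>pts ?Y. ev (g' x)) = ?g"
    proof (rule tensors_separate[OF nH Yp(1) evl[OF g'l] evl[OF gl]])
      fix u assume u: "u \<in> tensors ?Y H"
      then show "u (\<lambda>x\<in>pts ?Y. ev (g' x)) = u ?g" using \<Theta>e[OF g'(1) u] g'(2) by simp
    qed
    note ev_eq = this
    have evx: "ev (g' x) = ev (g x)" if "x \<in> pts ?Y" for x using fun_cong[OF ev_eq, of x] that by simp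
    have "g' = g"
    proof (rule extensionalityI[of _ "pts ?Y"])
      show "g' \<in> extensional (pts ?Y)" "g \<in> extensional (pts ?Y)" using lipvD(1)[OF g'l nZ] lipvD(1)[OF gl nZ] .
      show "g' x = g x" if "x \<in> pts ?Y" for x
        using evx[OF that] lipvD(2)[OF g'l nZ that] lipvD(2)[OF gl nZ that] evD(2)
        unfolding bij_betw_def inj_on_def by blast
    qed
    moreover have "op_norm (tensor_sp \<alpha> ?Y H) scalars (\<Theta> g') \<le> C"
      unfolding g'(2) op_norm_restrict by (rule m\<Psi>(2))
    ultimately have "nA ?Y Z g \<le> C" using \<Theta>n[OF g'(1)] by simp
    then show ?thesis by (simp add: g_def q_def)
  qed
  have mle: "max_norm nA X F f \<le> ennreal C"
    unfolding max_norm_def using le by (intro Sup_least) (auto intro!: ennreal_leI)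
  then have "max_norm nA X F f < \<infinity>" by (rule le_less_trans) simp
  then show fA: "f \<in> A X F" using max X F f unfolding maximal_ideal_def by blast
  then have "ennreal (nA X F f) = max_norm nA X F f" using max X F unfolding maximal_ideal_def by blast
  then have "ennreal (nA X F f) \<le> ennreal C" using mle by simp
  then show "nA X F f \<le> C" using ennreal_le_iff[OF C] by blast
qed

section \<open>The two duality relations\<close>

lemma dual_pairing:
  assumes "normed_sp E" and "isometric_iso D (ndual E) J"
  shows "contractive_pairing D E J"
  using isometric_isoD[OF assms(2)] unfolding contractive_pairing_def by simp

text \<open>Here \<open>F\<^sup>* = E\<^sup>*\<^sup>*\<close> and \<open>G = E\<close>, which is the situation of local reflexivity.\<close>

lemma dual_pairing_locally_dual:
  assumes E: "normed_sp E" and D: "normed_sp D" and J: "isometric_iso D (ndual E) J"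
  shows "locally_dual_pairing D E J"
  unfolding locally_dual_pairing_def
proof (intro allI impI, elim conjE)
  fix H :: "('a, 'b) nspace" and S and I :: "nat set" and h y and K :: real
  assume H: "normed_sp H" "fin_dim H" and S: "linear_map H (ndual D) S"
    and S1: "\<forall>x\<in>carr H. op_norm D scalars (S x) \<le> vnorm H x"
    and I: "finite I" and hy: "\<forall>i\<in>I. h i \<in> carr H \<and> y i \<in> carr D" and K: "0 \<le> K"
    and bound: "\<forall>T\<in>bounded_ops H E. norm (\<Sum>i\<in>I. J (y i) (T (h i))) \<le> K * op_norm H E T"
  interpret D: nvspace D using nvspaceI[OF D] .
  interpret H: nvspace H using nvspaceI[OF H(1)] .
  note dE = normed_sp_ndual[OF E]
  note JD = isometric_isoD[OF J]
  obtain M where M: "linear_map (ndual E) D M" and nM: "\<And>y. y \<in> carr (ndual E) \<Longrightarrow> vnorm D (M y) = vnorm (ndual E) y"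
    and MJ: "\<And>x. x \<in> carr D \<Longrightarrow> M (J x) = x"
    using isometric_iso_inverse[OF J D.vector_sp] by metis
  have Sm: "S x \<in> bounded_ops D scalars" if "x \<in> carr H" for x using linear_map_simps(1)[OF S that] by simp
  define S' where "S' x = (\<lambda>\<phi>\<in>carr (ndual E). S x (M \<phi>))" for x
  have S': "S' x \<in> bounded_ops (ndual E) scalars" "op_norm (ndual E) scalars (S' x) \<le> vnorm H x"
    if x: "x \<in> carr H" for x
  proof -
    note SD = bounded_opsD[OF Sm[OF x] D]
    have l: "linear_map (ndual E) scalars (\<lambda>\<phi>. S x (M \<phi>))" by (rule linear_map_comp[OF M SD(1)])
    have "norm (S x (M \<phi>)) \<le> vnorm H x * vnorm (ndual E) \<phi>" if p: "\<phi> \<in> carr (ndual E)" for \<phi>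
    proof -
      have "norm (S x (M \<phi>)) \<le> op_norm D scalars (S x) * vnorm D (M \<phi>)"
        using SD(4)[OF linear_map_simps(1)[OF M p]] by simp
      also have "\<dots> \<le> vnorm H x * vnorm D (M \<phi>)"
        using S1 x linear_map_simps(1)[OF M p] by (intro mult_right_mono) auto
      finally show ?thesis using nM[OF p] by simp
    qed
    note m = ndual_mem[OF l dE this H.norm_nonneg[OF x]]
    show "S' x \<in> bounded_ops (ndual E) scalars" "op_norm (ndual E) scalars (S' x) \<le> vnorm H x"
      unfolding S'_def op_norm_restrict using m by blast+
  qed
  have S'l: "linear_map H (ndual (ndual E)) S'"
    using S'(1) linear_map_simps[OF S] linear_map_simps(1)[OF M]
    unfolding linear_map_def by (auto simp: S'_def fun_eq_iff)
  have "norm (\<Sum>i\<in>I. S' (h i) (J (y i))) \<le> K"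
    by (rule local_reflexivity[OF H E I _ _ K _ S'l S'(2)]) (use hy bound JD(3) in auto)
  moreover have "S' (h i) (J (y i)) = S (h i) (y i)" if "i \<in> I" for i
    using hy that JD(3)[of "y i"] MJ by (simp add: S'_def)
  ultimately show "norm (\<Sum>i\<in>I. S (h i) (y i)) \<le> K" by simp
qed

lemma predual_pairing:
  assumes E: "normed_sp E" and D: "normed_sp D" and J: "isometric_iso D (ndual E) J"
  shows "contractive_pairing E D (\<lambda>e. \<lambda>d\<in>carr D. J d e)"
proof -
  interpret D: nvspace D using nvspaceI[OF D] .
  interpret E: nvspace E using nvspaceI[OF E] .
  note JD = isometric_isoD[OF J]
  have Jm: "J d \<in> bounded_ops E scalars" if "d \<in> carr D" for d using JD(3)[OF that] by simp
  have m: "(\<lambda>d\<in>carr D. J d e) \<in> bounded_ops D scalars" "op_norm D scalars (\<lambda>d. J d e) \<le> vnorm E e"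
    if e: "e \<in> carr E" for e
  proof -
    have l: "linear_map D scalars (\<lambda>d. J d e)"
      unfolding linear_map_scalars_iff using linear_map_simps[OF JD(1)] e by simp
    have "norm (J d e) \<le> vnorm E e * vnorm D d" if d: "d \<in> carr D" for d
      using bounded_opsD(4)[OF Jm[OF d] E e] JD(4)[OF d] by (simp add: mult.commute)
    note m = ndual_mem[OF l D this E.norm_nonneg[OF e]]
    show "(\<lambda>d\<in>carr D. J d e) \<in> bounded_ops D scalars" "op_norm D scalars (\<lambda>d. J d e) \<le> vnorm E e"
      using m by blast+
  qed
  have "linear_map E (ndual D) (\<lambda>e. \<lambda>d\<in>carr D. J d e)"
    using m(1) linear_map_simps[OF bounded_opsD(1)[OF Jm E]]
    unfolding linear_map_def by (auto simp: fun_eq_iff)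
  then show ?thesis unfolding contractive_pairing_def using m(2) by simp
qed

text \<open>Here \<open>G = E\<^sup>* = F\<^sup>*\<close>, so that \<open>S\<close> itself can serve as \<open>T\<close>.\<close>

lemma predual_pairing_locally_dual:
  assumes E: "normed_sp E" and D: "normed_sp D" and J: "isometric_iso D (ndual E) J"
  shows "locally_dual_pairing E D (\<lambda>e. \<lambda>d\<in>carr D. J d e)"
  unfolding locally_dual_pairing_def
proof (intro allI impI, elim conjE)
  fix H :: "('a, 'b) nspace" and S and I :: "nat set" and h y and K :: real
  assume H: "normed_sp H" "fin_dim H" and S: "linear_map H (ndual E) S"
    and S1: "\<forall>x\<in>carr H. op_norm E scalars (S x) \<le> vnorm H x"
    and I: "finite I" and hy: "\<forall>i\<in>I. h i \<in> carr H \<and> y i \<in> carr E" and K: "0 \<le> K"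
    and bound: "\<forall>T\<in>bounded_ops H D. norm (\<Sum>i\<in>I. (\<lambda>d\<in>carr D. J d (y i)) (T (h i))) \<le> K * op_norm H D T"
  interpret D: nvspace D using nvspaceI[OF D] .
  obtain M where M: "linear_map (ndual E) D M" and JM: "\<And>y. y \<in> carr (ndual E) \<Longrightarrow> J (M y) = y"
    and nM: "\<And>y. y \<in> carr (ndual E) \<Longrightarrow> vnorm D (M y) = vnorm (ndual E) y"
    using isometric_iso_inverse[OF J D.vector_sp] by metis
  have l: "linear_map H D (\<lambda>x. M (S x))" by (rule linear_map_comp[OF S M])
  have Sc: "S x \<in> carr (ndual E)" if "x \<in> carr H" for x using linear_map_simps(1)[OF S that] .
  have n: "vnorm D (M (S x)) \<le> 1 * vnorm H x" if "x \<in> carr H" for x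
    using nM[OF Sc[OF that]] S1 that by simp
  define T where "T = (\<lambda>x\<in>carr H. M (S x))"
  have T: "T \<in> bounded_ops H D" unfolding T_def by (rule bounded_opsI[OF l H(1) n])
  have T1: "op_norm H D T \<le> 1" unfolding T_def op_norm_restrict by (rule op_norm_le) (use n in auto)
  have "(\<lambda>d\<in>carr D. J d (y i)) (T (h i)) = S (h i) (y i)" if "i \<in> I" for i
    using hy that JM[OF Sc] linear_map_simps(1)[OF l] by (simp add: T_def)
  then have "norm (\<Sum>i\<in>I. S (h i) (y i)) \<le> K * op_norm H D T" using bspec[OF bound T] by simp
  also have "\<dots> \<le> K" using T1 K by (simp add: mult_left_le)
  finally show "norm (\<Sum>i\<in>I. S (h i) (y i)) \<le> K" .
qed

lemma ideal_norm_eq_op_norm: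
  fixes A :: "('m, 'u, 'k::real_or_complex) gideal"
  assumes A: "generic_ideal A nA" and max: "maximal_ideal A nA" and \<alpha>: "generic_cross_norm \<alpha>"
    and fg: "finitely_generated \<alpha>" and as: "associated A nA \<alpha>" and X: "pointed X"
    and F: "banach_sp F" and G: "banach_sp G"
    and B: "contractive_pairing F G B" and BL: "locally_dual_pairing F G B" and f: "f \<in> lipv X F"
  defines "\<phi> \<equiv> (\<lambda>u\<in>tensors X G. u (\<lambda>x\<in>pts X. B (f x)))"
  shows "f \<in> A X F \<longleftrightarrow> \<phi> \<in> bounded_ops (tensor_sp \<alpha> X G) scalars"
    and "f \<in> A X F \<Longrightarrow> op_norm (tensor_sp \<alpha> X G) scalars \<phi> = nA X F f"
proof -
  note nF = banach_sp_normed[OF F] and nG = banach_sp_normed[OF G] and nT = tensor_sp_normed[OF \<alpha> X G]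
  note lin = evaluation_linear[OF pairing_lipv[OF B nF nG X f]]
  have eq: "\<phi> = restrict (\<lambda>u. u (\<lambda>x\<in>pts X. B (f x))) (carr (tensor_sp \<alpha> X G))" by (simp add: \<phi>_def)
  have 1: "\<phi> \<in> bounded_ops (tensor_sp \<alpha> X G) scalars"
    "op_norm (tensor_sp \<alpha> X G) scalars \<phi> \<le> nA X F f" if fA: "f \<in> A X F"
  proof -
    note m = ndual_mem[OF lin nT _ ideal_lipv(2)[OF A X F fA]]
    have "norm (u (\<lambda>x\<in>pts X. B (f x))) \<le> nA X F f * vnorm (tensor_sp \<alpha> X G) u"
      if "u \<in> carr (tensor_sp \<alpha> X G)" for u
      using ideal_norm_bounds_functional[OF A \<alpha> fg as X F G B fA] that by simp
    then show "\<phi> \<in> bounded_ops (tensor_sp \<alpha> X G) scalars" "op_norm (tensor_sp \<alpha> X G) scalars \<phi> \<le> nA X F f"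
      unfolding eq op_norm_restrict using m by blast+
  qed
  have 2: "f \<in> A X F" "nA X F f \<le> op_norm (tensor_sp \<alpha> X G) scalars \<phi>"
    if \<phi>: "\<phi> \<in> bounded_ops (tensor_sp \<alpha> X G) scalars"
  proof -
    note \<phi>D = bounded_opsD[OF \<phi> nT]
    have "norm (u (\<lambda>x\<in>pts X. B (f x))) \<le> op_norm (tensor_sp \<alpha> X G) scalars \<phi> * \<alpha> X G u"
      if "u \<in> tensors X G" for u
      using \<phi>D(4)[of u] that by (simp add: \<phi>_def)
    note b = functional_bounds_ideal_norm[OF A max \<alpha> as X F G B BL f \<phi>D(3) this]
    show "f \<in> A X F" "nA X F f \<le> op_norm (tensor_sp \<alpha> X G) scalars \<phi>" using b by blast+
  qed
  show "f \<in> A X F \<longleftrightarrow> \<phi> \<in> bounded_ops (tensor_sp \<alpha> X G) scalars" using 1(1) 2(1) by blast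
  show "f \<in> A X F \<Longrightarrow> op_norm (tensor_sp \<alpha> X G) scalars \<phi> = nA X F f" using 1 2(2) by (intro antisym) blast+
qed

theorem theorem7p10:
  fixes A :: "('m, 'u, 'k::real_or_complex) gideal"
    and nA :: "('m, 'u, 'k) gideal_norm"
    and \<alpha> :: "('m, 'u, 'k) gnorm"
    and X :: "'m pmetric"
    and E D :: "('k, 'u) nspace"
    and J :: "'u \<Rightarrow> 'u \<Rightarrow> 'k"
  assumes "generic_ideal A nA" and "maximal_ideal A nA"
    and "generic_cross_norm \<alpha>" and "finitely_generated \<alpha>"
    and "associated A nA \<alpha>"
    and "pointed X" and "banach_sp E"
    and "banach_sp D" and "isometric_iso D (ndual E) J"
  shows "dual_relation A nA X E D J
           (ncompletion (tensor_sp \<alpha> X E)) (into_completion (tensor_sp \<alpha> X E)) \<and>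
         predual_relation A nA X E D J
           (ncompletion (tensor_sp \<alpha> X D)) (into_completion (tensor_sp \<alpha> X D))"
proof
  note A = assms(1,2) and \<alpha> = assms(3) and fg = assms(4) and as = assms(5) and X = assms(6)
    and E = assms(7) and D = assms(8) and J = assms(9)
  note nE = banach_sp_normed[OF E] and nD = banach_sp_normed[OF D]
  interpret D: nvspace D using nvspaceI[OF nD] .
  note JD = isometric_isoD[OF J]
  show "dual_relation A nA X E D J
      (ncompletion (tensor_sp \<alpha> X E)) (into_completion (tensor_sp \<alpha> X E))"
  proof -
    let ?V = "tensor_sp \<alpha> X E"
    note nV = tensor_sp_normed[OF \<alpha> X E]
    interpret V: nvspace ?V using nvspaceI[OF nV] .
    note B = dual_pairing[OF nE J] and BL = dual_pairing_locally_dual[OF nE nD J]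
    note eq = ideal_norm_eq_op_norm[OF A \<alpha> fg as X D E B BL]
    define \<Lambda> where "\<Lambda> f = (\<lambda>u\<in>tensors X E. u (\<lambda>x\<in>pts X. J (f x)))" for f
    have lip: "f \<in> lipv X D" if "f \<in> A X D" for f by (rule ideal_lipv(1)[OF A(1) X D that])
    have Jlip: "(\<lambda>x\<in>pts X. J (f x)) \<in> lipv X (ndual E)" if "f \<in> lipv X D" for f
      by (rule pairing_lipv[OF B nD nE X that])
    have \<Lambda>: "bij_betw \<Lambda> (A X D) (bounded_ops ?V scalars)"
    proof (rule bij_betwI')
      fix f g assume f: "f \<in> A X D" and g: "g \<in> A X D"
      have "f = g" if fg: "\<Lambda> f = \<Lambda> g"
      proof -
        have Jfg: "(\<lambda>x\<in>pts X. J (f x)) = (\<lambda>x\<in>pts X. J (g x))"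
        proof (rule tensors_separate[OF nE X Jlip[OF lip[OF f]] Jlip[OF lip[OF g]]])
          show "u (\<lambda>x\<in>pts X. J (f x)) = u (\<lambda>x\<in>pts X. J (g x))" if "u \<in> tensors X E" for u
            using fun_cong[OF fg, of u] that by (simp add: \<Lambda>_def)
        qed
        have Jx: "J (f x) = J (g x)" if "x \<in> pts X" for x using fun_cong[OF Jfg, of x] that by simp
        show ?thesis
        proof (rule extensionalityI[of _ "pts X"])
          show "f \<in> extensional (pts X)" "g \<in> extensional (pts X)"
            using lipvD(1)[OF lip[OF f] nD] lipvD(1)[OF lip[OF g] nD] .
          show "f x = g x" if "x \<in> pts X" for x
            using Jx[OF that] lipvD(2)[OF lip[OF f] nD that] lipvD(2)[OF lip[OF g] nD that] JD(2)
            unfolding bij_betw_def inj_on_def by blast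
        qed
      qed
      then show "\<Lambda> f = \<Lambda> g \<longleftrightarrow> f = g" by blast
    next
      show "\<Lambda> f \<in> bounded_ops ?V scalars" if "f \<in> A X D" for f
        using eq(1)[OF lip[OF that]] that unfolding \<Lambda>_def by blast
    next
      fix \<phi> assume \<phi>: "\<phi> \<in> bounded_ops ?V scalars"
      obtain k where k: "k \<in> lipv X (ndual E)" "\<And>u. u \<in> tensors X E \<Longrightarrow> \<phi> u = u k"
        using functional_is_evaluation[OF \<alpha> X E \<phi>] by blast
      obtain M where M: "linear_map (ndual E) D M" "\<And>y. y \<in> carr (ndual E) \<Longrightarrow> J (M y) = y"
        "\<And>y. y \<in> carr (ndual E) \<Longrightarrow> vnorm D (M y) = vnorm (ndual E) y"
        using isometric_iso_inverse[OF J D.vector_sp] by metis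
      define f where "f = (\<lambda>x\<in>pts X. M (k x))"
      note kD = lipvD[OF k(1) normed_sp_ndual[OF nE]]
      have f: "f \<in> lipv X D"
        unfolding f_def by (rule lipv_compose[OF k(1) normed_sp_ndual[OF nE] nD X M(1)]) (use M(3) in simp)
      have "(\<lambda>x\<in>pts X. J (f x)) = k"
        using kD(1,2) M(2) by (intro extensionalityI[of _ "pts X"]) (auto simp: f_def)
      then have \<phi>f: "\<phi> = \<Lambda> f"
        using k(2) bounded_opsD(2)[OF \<phi> nV]
        by (intro extensionalityI[of _ "tensors X E"]) (auto simp: \<Lambda>_def)
      then have "f \<in> A X D" using eq(1)[OF f] \<phi> unfolding \<Lambda>_def by simp
      then show "\<exists>f\<in>A X D. \<phi> = \<Lambda> f" using \<phi>f by blast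
    qed
    \<comment> \<open>restriction from the completion, an isometry of the duals\<close>
    define R where "R \<Phi> = (\<lambda>v\<in>carr ?V. \<Phi> (into_completion ?V v))" for \<Phi> :: "_ \<Rightarrow> 'k"
    define R' where "R' = inv_into (bounded_ops (ncompletion ?V) scalars) R"
    have R: "bij_betw R (bounded_ops (ncompletion ?V) scalars) (bounded_ops ?V scalars)"
      unfolding R_def by (rule V.completion_dual(1))
    have R'b: "bij_betw R' (bounded_ops ?V scalars) (bounded_ops (ncompletion ?V) scalars)"
      unfolding R'_def by (rule bij_betw_inv_into[OF R])
    have RR': "R (R' \<phi>) = \<phi>" if "\<phi> \<in> bounded_ops ?V scalars" for \<phi>
      unfolding R'_def by (rule bij_betw_inv_into_right[OF R that])
    show ?thesis
      unfolding dual_relation_def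
    proof (intro exI[of _ "R' \<circ> \<Lambda>"] conjI ballI)
      show "bij_betw (R' \<circ> \<Lambda>) (A X D) (carr (ndual (ncompletion ?V)))"
        using bij_betw_trans[OF \<Lambda> R'b] by simp
      fix f assume f: "f \<in> A X D"
      have \<Lambda>f: "\<Lambda> f \<in> bounded_ops ?V scalars" using bij_betwE[OF \<Lambda>] f by blast
      have R'f: "R' (\<Lambda> f) \<in> bounded_ops (ncompletion ?V) scalars" using bij_betwE[OF R'b] \<Lambda>f by blast
      show "vnorm (ndual (ncompletion ?V)) ((R' \<circ> \<Lambda>) f) = nA X D f"
        using V.completion_dual(2)[OF R'f] RR'[OF \<Lambda>f] eq(2)[OF lip[OF f] f]
        unfolding R_def \<Lambda>_def by simp
      show "(R' \<circ> \<Lambda>) f (into_completion ?V u) = u (\<lambda>x\<in>pts X. J (f x))" if u: "u \<in> tensors X E" for u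
      proof -
        have "R (R' (\<Lambda> f)) u = \<Lambda> f u" using RR'[OF \<Lambda>f] by simp
        then show ?thesis using u by (simp add: R_def \<Lambda>_def)
      qed
    qed
  qed
  show "predual_relation A nA X E D J
      (ncompletion (tensor_sp \<alpha> X D)) (into_completion (tensor_sp \<alpha> X D))"
  proof -
    let ?V = "tensor_sp \<alpha> X D"
    note nV = tensor_sp_normed[OF \<alpha> X D]
    interpret V: nvspace ?V using nvspaceI[OF nV] .
    note B = predual_pairing[OF nE nD J] and BL = predual_pairing_locally_dual[OF nE nD J]
    note eq = ideal_norm_eq_op_norm[OF A \<alpha> fg as X E D B BL]
    define \<Lambda> where "\<Lambda> f = (\<lambda>u\<in>tensors X D. u (\<lambda>x\<in>pts X. \<lambda>d\<in>carr D. J d (f x)))" for f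
    define represents where "represents \<Phi> f \<longleftrightarrow> (\<forall>u\<in>tensors X D.
        \<Phi> (into_completion ?V u) = u (\<lambda>x\<in>pts X. \<lambda>d\<in>carr D. J d (f x)))" for \<Phi> f
    have rep: "represents \<Phi> f \<longleftrightarrow> (\<lambda>v\<in>carr ?V. \<Phi> (into_completion ?V v)) = \<Lambda> f" for \<Phi> f
    proof
      assume "represents \<Phi> f"
      then show "(\<lambda>v\<in>carr ?V. \<Phi> (into_completion ?V v)) = \<Lambda> f"
        unfolding represents_def \<Lambda>_def by (auto simp: fun_eq_iff)
    next
      assume a: "(\<lambda>v\<in>carr ?V. \<Phi> (into_completion ?V v)) = \<Lambda> f"
      show "represents \<Phi> f"
        unfolding represents_def
      proof
        fix u assume u: "u \<in> tensors X D"
        show "\<Phi> (into_completion ?V u) = u (\<lambda>x\<in>pts X. \<lambda>d\<in>carr D. J d (f x))"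
          using fun_cong[OF a, of u] u by (simp add: \<Lambda>_def)
      qed
    qed
    have ex: "(\<exists>\<Phi>\<in>carr (ndual (ncompletion ?V)). represents \<Phi> f) \<longleftrightarrow> \<Lambda> f \<in> bounded_ops ?V scalars" for f
      using V.completion_dual(1) unfolding rep ndual_simps bij_betw_def by (metis (no_types, lifting) imageE imageI)
    have "A X E = {f \<in> lipv X E. \<exists>\<Phi>\<in>carr (ndual (ncompletion ?V)). represents \<Phi> f}"
      unfolding ex using eq(1) ideal_lipv(1)[OF A(1) X E] unfolding \<Lambda>_def by blast
    moreover have "nA X E f = vnorm (ndual (ncompletion ?V)) \<Phi>"
      if f: "f \<in> A X E" and \<Phi>: "\<Phi> \<in> carr (ndual (ncompletion ?V))" and r: "represents \<Phi> f" for f \<Phi>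
      using eq(2)[OF ideal_lipv(1)[OF A(1) X E f] f] V.completion_dual(2)[of \<Phi>] \<Phi> r
      unfolding rep \<Lambda>_def by simp
    ultimately show ?thesis
      unfolding predual_relation_def Let_def represents_def by blast
  qed
qed

end
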